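(* Let $(X_i,\nu_i)$ and $(Y_i,\mu_i)$ be standard measure spaces and let $\kappa_i\subseteq X_i\times Y_i$ be $\omega$-closed sets, for $i=1,2$. The set $\rho(\kappa_1\times\kappa_2)$ is an operator $M_0$-set if and only if both $\kappa_1$ and $\kappa_2$ are operator $M_0$-sets.
   Context: A measure space $(X,\mu)$ is a standard measure space if $\mu$ is a Radon measure with respect to some completely metrizable, separable and locally compact topology on $X$. Let $(X,\mu)$, $(Y,\nu)$ be standard measure spaces. A rectangle in $X\times Y$ is a set $A\times B$ with $A\subseteq X$, $B\subseteq Y$ measurable. A set $E\subseteq X\times Y$ is marginally null if $E\subseteq(X_0\times Y)\cup(X\times Y_0)$ with $\mu(X_0)=0$ and $\nu(Y_0)=0$; sets $E,F$ are marginally equivalent if $E\Delta F$ is marginally null. A set is $\omega$-open if it is marginally equivalent to a countable union of rectangles, and $\omega$-closed if its complement is $\omega$-open. The map $\rho:(X_1\times Y_1)\times(X_2\times Y_2)\to(X_1\times X_2)\times(Y_1\times Y_2)$ is $\rho((x_1,y_1),(x_2,y_2))=((x_1,x_2),(y_1,y_2))$; the products $X_1\times X_2$ and $Y_1\times Y_2$ carry the product measures. A complex measure $\sigma$ of finite total variation on the product $\sigma$-algebra of $X\times Y$ is an Arveson measure if there is $c>0$ with $|\sigma|_X\leq c\mu$ and $|\sigma|_Y\leq c\nu$, where $|\sigma|$ is the variation of $\sigma$ and $|\sigma|_X,|\sigma|_Y$ are its marginal measures. The set of Arveson measures on $X\times Y$ is $\mathbb{A}(X,Y)$, and for an $\omega$-closed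 $F\subseteq X\times Y$, $\mathbb{A}(F)$ is the set of $\sigma\in\mathbb{A}(X,Y)$ with $supp(\sigma)\subseteq F$, i.e. with $|\sigma|$ vanishing on the complement of $F$ (here marginally null sets are regarded as null for Arveson measures). For $\sigma\in\mathbb{A}(Y,X)$ there is a unique bounded operator $T_\sigma:L^2(X,\mu)\to L^2(Y,\nu)$ with $(T_\sigma f,g)=\int_{Y\times X}f(x)\overline{g(y)}\,d\sigma(y,x)$ for all $f\in L^2(X,\mu)$, $g\in L^2(Y,\nu)$. For an $\omega$-closed set $\kappa\subseteq X\times Y$ let $\hat\kappa=\{(y,x):(x,y)\in\kappa\}\subseteq Y\times X$. The set $\kappa$ is an operator $M_0$-set if there is a non-zero measure $\sigma\in\mathbb{A}(\hat\kappa)$ such that $T_\sigma$ is a compact operator from $L^2(X,\mu)$ to $L^2(Y,\nu)$. *)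

theory Defs
  imports "HOL-Analysis.Analysis"
begin

definition radon_measure :: "'a topology \<Rightarrow> 'a measure \<Rightarrow> bool" where
  "radon_measure T M \<longleftrightarrow>
     space M = topspace T \<and>
     sets M = sigma_sets (topspace T) {U. openin T U} \<and>
     (\<forall>K. compactin T K \<longrightarrow> emeasure M K < \<infinity>) \<and>
     (\<forall>E\<in>sets M. emeasure M E = (INF U\<in>{U. openin T U \<and> E \<subseteq> U}. emeasure M U)) \<and>
     (\<forall>U. openin T U \<longrightarrow>
        emeasure M U = (SUP K\<in>{K. compactin T K \<and> K \<subseteq> U}. emeasure M K))"

definition standard_measure :: "'a measure \<Rightarrow> bool" where
  "standard_measure M \<longleftrightarrow>
     (\<exists>T. completely_metrizable_space T \<and> separable_space T \<and> locally_compact_space T \<and>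
          radon_measure T M)"

definition marginally_null :: "'a measure \<Rightarrow> 'b measure \<Rightarrow> ('a \<times> 'b) set \<Rightarrow> bool" where
  "marginally_null M N E \<longleftrightarrow>
     (\<exists>X0\<in>null_sets M. \<exists>Y0\<in>null_sets N. E \<subseteq> (X0 \<times> space N) \<union> (space M \<times> Y0))"

definition marginally_equivalent ::
    "'a measure \<Rightarrow> 'b measure \<Rightarrow> ('a \<times> 'b) set \<Rightarrow> ('a \<times> 'b) set \<Rightarrow> bool" where
  "marginally_equivalent M N E F \<longleftrightarrow> marginally_null M N ((E - F) \<union> (F - E))"

definition omega_open :: "'a measure \<Rightarrow> 'b measure \<Rightarrow> ('a \<times> 'b) set \<Rightarrow> bool" where
  "omega_open M N E \<longleftrightarrow> E \<subseteq> space M \<times> space N \<and>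
     (\<exists>A B. (\<forall>i::nat. A i \<in> sets M \<and> B i \<in> sets N) \<and>
            marginally_equivalent M N E (\<Union>i. A i \<times> B i))"

definition omega_closed :: "'a measure \<Rightarrow> 'b measure \<Rightarrow> ('a \<times> 'b) set \<Rightarrow> bool" where
  "omega_closed M N F \<longleftrightarrow> F \<subseteq> space M \<times> space N \<and> omega_open M N (space M \<times> space N - F)"

definition rho :: "('a \<times> 'b) \<times> ('c \<times> 'd) \<Rightarrow> ('a \<times> 'c) \<times> ('b \<times> 'd)" where
  "rho = (\<lambda>((x1, y1), (x2, y2)). ((x1, x2), (y1, y2)))"

text \<open>A complex measure is a set function; in the definitions below the measure \<open>M\<close> only
  supplies the underlying measurable space, and the values of the set function outside
  \<open>sets M\<close> are irrelevant.\<close>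

definition complex_measure :: "'a measure \<Rightarrow> ('a set \<Rightarrow> complex) \<Rightarrow> bool" where
  "complex_measure M \<sigma> \<longleftrightarrow>
     \<sigma> {} = 0 \<and>
     (\<forall>A::nat \<Rightarrow> 'a set. range A \<subseteq> sets M \<and> disjoint_family A \<longrightarrow> (\<lambda>i. \<sigma> (A i)) sums \<sigma> (\<Union>i. A i))"

definition variation :: "'a measure \<Rightarrow> ('a set \<Rightarrow> complex) \<Rightarrow> 'a measure" where
  "variation M \<sigma> = measure_of (space M) (sets M)
     (\<lambda>E. SUP P\<in>{P. finite P \<and> disjoint P \<and> P \<subseteq> sets M \<and> \<Union>P = E}. \<Sum>A\<in>P. ennreal (norm (\<sigma> A)))"

text \<open>The Radon--Nikodym derivative of a complex measure of finite variation with respect to its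
  variation; it is unique almost everywhere and unimodular almost everywhere.\<close>

definition polar_density :: "'a measure \<Rightarrow> ('a set \<Rightarrow> complex) \<Rightarrow> 'a \<Rightarrow> complex" where
  "polar_density M \<sigma> = (SOME h. integrable (variation M \<sigma>) h \<and>
     (\<forall>E\<in>sets M. \<sigma> E = (LINT z:E|variation M \<sigma>. h z)))"

definition cm_integral :: "'a measure \<Rightarrow> ('a set \<Rightarrow> complex) \<Rightarrow> ('a \<Rightarrow> complex) \<Rightarrow> complex" where
  "cm_integral M \<sigma> f = (LINT z|variation M \<sigma>. f z * polar_density M \<sigma> z)"

text \<open>Elements of the L2 spaces are represented by square integrable functions, and operators act
  on these representatives. Operator identities are required almost everywhere only. Linearity and
  boundedness force an operator to send almost everywhere equal functions to almost everywhere
  equal functions, so it descends to the L2 spaces.\<close>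

definition L2 :: "'a measure \<Rightarrow> ('a \<Rightarrow> complex) set" where
  "L2 M = {f. f \<in> borel_measurable M \<and> integrable M (\<lambda>x. (norm (f x))\<^sup>2)}"

definition L2_norm :: "'a measure \<Rightarrow> ('a \<Rightarrow> complex) \<Rightarrow> real" where
  "L2_norm M f = sqrt (LINT x|M. (norm (f x))\<^sup>2)"

definition L2_inner :: "'a measure \<Rightarrow> ('a \<Rightarrow> complex) \<Rightarrow> ('a \<Rightarrow> complex) \<Rightarrow> complex" where
  "L2_inner M f g = (LINT x|M. f x * cnj (g x))"

definition bounded_L2_operator ::
    "'a measure \<Rightarrow> 'b measure \<Rightarrow> (('a \<Rightarrow> complex) \<Rightarrow> ('b \<Rightarrow> complex)) \<Rightarrow> bool" where
  "bounded_L2_operator M N T \<longleftrightarrow>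
     (\<forall>f\<in>L2 M. T f \<in> L2 N) \<and>
     (\<forall>f\<in>L2 M. \<forall>g\<in>L2 M. \<forall>a b.
        AE y in N. T (\<lambda>x. a * f x + b * g x) y = a * T f y + b * T g y) \<and>
     (\<exists>C. \<forall>f\<in>L2 M. L2_norm N (T f) \<le> C * L2_norm M f)"

definition compact_L2_operator ::
    "'a measure \<Rightarrow> 'b measure \<Rightarrow> (('a \<Rightarrow> complex) \<Rightarrow> ('b \<Rightarrow> complex)) \<Rightarrow> bool" where
  "compact_L2_operator M N T \<longleftrightarrow>
     bounded_L2_operator M N T \<and>
     (\<forall>F::nat \<Rightarrow> 'a \<Rightarrow> complex. (\<forall>n. F n \<in> L2 M) \<and> (\<exists>B. \<forall>n. L2_norm M (F n) \<le> B) \<longrightarrow>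
        (\<exists>r::nat \<Rightarrow> nat. \<exists>g\<in>L2 N. strict_mono r \<and>
           (\<lambda>n. L2_norm N (\<lambda>y. T (F (r n)) y - g y)) \<longlonglongrightarrow> 0))"

definition arveson_measures :: "'a measure \<Rightarrow> 'b measure \<Rightarrow> (('a \<times> 'b) set \<Rightarrow> complex) set" where
  "arveson_measures M N = {\<sigma>. complex_measure (M \<Otimes>\<^sub>M N) \<sigma> \<and>
     (let V = variation (M \<Otimes>\<^sub>M N) \<sigma> in
        emeasure V (space V) < \<infinity> \<and>
        (\<exists>c>0. (\<forall>A\<in>sets M. emeasure (distr V M fst) A \<le> ennreal c * emeasure M A) \<and>
                (\<forall>B\<in>sets N. emeasure (distr V N snd) B \<le> ennreal c * emeasure N B)))}"

text \<open>The complement of an omega-closed set need not lie in the product sigma-algebra, but it does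
  up to a marginally null set. Marginally null sets are null for the completion of the variation
  of an Arveson measure, hence the completion below.\<close>

definition arveson_measures_on ::
    "'a measure \<Rightarrow> 'b measure \<Rightarrow> ('a \<times> 'b) set \<Rightarrow> (('a \<times> 'b) set \<Rightarrow> complex) set" where
  "arveson_measures_on M N F = {\<sigma> \<in> arveson_measures M N.
     space M \<times> space N - F \<in> null_sets (completion (variation (M \<Otimes>\<^sub>M N) \<sigma>))}"

text \<open>For an Arveson measure on the product of \<open>N\<close> and \<open>M\<close>, in this order, this is an
  operator from \<open>L2 M\<close> to \<open>L2 N\<close>, determined up to almost everywhere equality of its values.\<close>

definition arveson_operator ::
    "'a measure \<Rightarrow> 'b measure \<Rightarrow> (('b \<times> 'a) set \<Rightarrow> complex) \<Rightarrow> ('a \<Rightarrow> complex) \<Rightarrow> ('b \<Rightarrow> complex)" where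
  "arveson_operator M N \<sigma> = (SOME T. bounded_L2_operator M N T \<and>
     (\<forall>f\<in>L2 M. \<forall>g\<in>L2 N.
        L2_inner N (T f) g = cm_integral (N \<Otimes>\<^sub>M M) \<sigma> (\<lambda>(y, x). f x * cnj (g y))))"

definition operator_M0_set :: "'a measure \<Rightarrow> 'b measure \<Rightarrow> ('a \<times> 'b) set \<Rightarrow> bool" where
  "operator_M0_set M N \<kappa> \<longleftrightarrow> omega_closed M N \<kappa> \<and>
     (\<exists>\<sigma>\<in>arveson_measures_on N M (\<kappa>\<inverse>).
        (\<exists>E\<in>sets (N \<Otimes>\<^sub>M M). \<sigma> E \<noteq> 0) \<and>
        compact_L2_operator M N (arveson_operator M N \<sigma>))"

end

theory Submission
  imports Defs "HOL-Library.Diagonal_Subsequence"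
begin

text \<open>If \<open>\<sigma>\<close> is a witness for the product, it is non-zero on some product of four sets \<open>B1\<close>, \<open>B2\<close>, \<open>A1\<close>,
  \<open>A2\<close> of finite measure. Restricting \<open>\<sigma>\<close> to the second coordinates in \<open>B2 \<times> A2\<close> and projecting to
  the first coordinates gives an Arveson measure on \<open>Y1 \<times> X1\<close> whose operator is the compression
  \<open>f \<mapsto> J'\<^sup>* (T (J f))\<close> with \<open>J f = f \<otimes> 1\<close> on \<open>A2\<close> and
  \<open>J' g = g \<otimes> 1\<close> on \<open>B2\<close>; hence it is compact. The same works for the other factor.

  Conversely, \<open>\<sigma>1 \<times> \<sigma>2\<close> with permuted coordinates induces an operator that acts as
  \<open>T1 \<otimes> T2\<close> on elementary tensors. Compactness of \<open>T1\<close> and \<open>T2\<close> gives finite orthonormal systems whose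
  projections \<open>P1\<close>, \<open>P2\<close> satisfy \<open>T1 \<otimes> T2 - P1 T1 \<otimes> P2 T2 = (T1 - P1 T1) \<otimes> T2 + P1 T1 \<otimes> (T2 - P2 T2)\<close>,
  which is small in operator norm.\<close>

section \<open>Square integrable functions\<close>

text \<open>Two obstacles shape the proof. \<open>arveson_operator\<close> and
  \<open>polar_density\<close> are choices, so they say nothing until existence is proved; this is
  the reason for developing completeness, a representation theorem and Radon-Nikodym densities. Even
  then an operator is known only through its pairing with test functions, up to null sets. Hence the
  adjoint of \<open>J'\<close> is never formed: testing the compressed operator \<open>S\<close>
  against its own value bounds the norm of \<open>S f\<close> by a multiple of the norm of
  \<open>T (J f)\<close>, and such a bound already transports compactness. Likewise no tensor
  product of operators is constructed: the induced operator is compared with a factorwise map on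
  lists of summands, and boundedness carries the estimate to the closure. The finite measure of the
  box serves twice: it makes \<open>J\<close> and \<open>J'\<close> bounded, and it keeps the
  marginals of the projected measure dominated. Supports raise a measurability problem. The
  complement of an omega-closed set is measurable only up to null strips, and the marginal bounds of
  Arveson measures are what makes these strips null.\<close>

lemma borel_measurable_cnj [measurable (raw)]:
  "f \<in> borel_measurable M \<Longrightarrow> (\<lambda>x. cnj (f x)) \<in> borel_measurable M"
  by (rule measurable_compose[OF _ borel_measurable_continuous_onI]) (auto intro: continuous_intros)

lemma L2_measurable [measurable_dest]: "f \<in> L2 M \<Longrightarrow> f \<in> borel_measurable M"
  by (simp add: L2_def)

text \<open>Nonnegative integrals carry no integrability side condition, so monotonicity, Fatou and
  Tonelli apply to squared norms directly; \<open>L2_norm_leI\<close> then returns membership and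
  the norm bound together.\<close>

lemma L2_iff_nn_integral:
  "f \<in> L2 M \<longleftrightarrow> f \<in> borel_measurable M \<and> (\<integral>\<^sup>+x. (ennreal (norm (f x)))\<^sup>2 \<partial>M) < \<infinity>"
  by (auto simp: L2_def integrable_iff_bounded ennreal_power)

lemma L2_norm_nonneg [simp]: "0 \<le> L2_norm M f"
  by (simp add: L2_norm_def)

lemma nn_integral_L2:
  assumes "f \<in> L2 M"
  shows "(\<integral>\<^sup>+x. (ennreal (norm (f x)))\<^sup>2 \<partial>M) = ennreal ((L2_norm M f)\<^sup>2)"
proof -
  have "(\<integral>\<^sup>+x. (ennreal (norm (f x)))\<^sup>2 \<partial>M) = (\<integral>\<^sup>+x. ennreal ((norm (f x))\<^sup>2) \<partial>M)"
    by (simp add: ennreal_power)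
  also have "\<dots> = ennreal (LINT x|M. (norm (f x))\<^sup>2)"
    using assms by (intro nn_integral_eq_integral) (auto simp: L2_def)
  finally show ?thesis by (simp add: L2_norm_def)
qed

lemma L2_norm_leI:
  assumes "f \<in> borel_measurable M" "0 \<le> c"
    and "(\<integral>\<^sup>+x. (ennreal (norm (f x)))\<^sup>2 \<partial>M) \<le> ennreal (c\<^sup>2)"
  shows "f \<in> L2 M" "L2_norm M f \<le> c"
proof -
  show f: "f \<in> L2 M"
    using assms by (simp add: L2_iff_nn_integral) (use le_less_trans in force)
  have "(L2_norm M f)\<^sup>2 \<le> c\<^sup>2"
    using assms(3) nn_integral_L2[OF f] by simp
  then show "L2_norm M f \<le> c"
    using assms(2) by (rule power2_le_imp_le)
qed

lemma L2_scale:
  assumes "f \<in> L2 M" shows "(\<lambda>x. a * f x) \<in> L2 M"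
  using assms by (auto simp: L2_def norm_mult power_mult_distrib)

lemma L2_add:
  assumes [measurable]: "f \<in> L2 M" "g \<in> L2 M" shows "(\<lambda>x. f x + g x) \<in> L2 M"
proof -
  have "integrable M (\<lambda>x. (norm (f x + g x))\<^sup>2)"
  proof (rule Bochner_Integration.integrable_bound)
    show "integrable M (\<lambda>x. 2 * (norm (f x))\<^sup>2 + 2 * (norm (g x))\<^sup>2)"
      using assms by (auto simp: L2_def)
    have "(norm (a + b))\<^sup>2 \<le> 2 * (norm a)\<^sup>2 + 2 * (norm b)\<^sup>2" for a b :: complex
    proof -
      have "(norm (a + b))\<^sup>2 \<le> (norm a + norm b)\<^sup>2"
        by (intro power_mono norm_triangle_ineq) auto
      also have "\<dots> \<le> 2 * (norm a)\<^sup>2 + 2 * (norm b)\<^sup>2"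
        using sum_squares_ge_zero[of "norm a - norm b" 0] by (simp add: power2_eq_square algebra_simps)
      finally show ?thesis .
    qed
    then show "AE x in M. norm ((norm (f x + g x))\<^sup>2) \<le> norm (2 * (norm (f x))\<^sup>2 + 2 * (norm (g x))\<^sup>2)"
      by auto
  qed measurable
  then show ?thesis by (simp add: L2_def)
qed

lemma L2_zero [simp]: "(\<lambda>x. 0) \<in> L2 M"
  by (simp add: L2_def)

lemma L2_lincomb:
  assumes "f \<in> L2 M" "g \<in> L2 M" shows "(\<lambda>x. a * f x + b * g x) \<in> L2 M"
  using L2_add[OF L2_scale[OF assms(1)] L2_scale[OF assms(2)]] .

lemma L2_diff:
  assumes "f \<in> L2 M" "g \<in> L2 M" shows "(\<lambda>x. f x - g x) \<in> L2 M"
  using L2_lincomb[OF assms, of 1 "-1"] by simp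

lemma L2_sum:
  assumes "\<And>i. i \<in> I \<Longrightarrow> f i \<in> L2 M" shows "(\<lambda>x. \<Sum>i\<in>I. f i x) \<in> L2 M"
  using assms by (induction I rule: infinite_finite_induct) (auto intro: L2_add)

lemma L2_norm_cong_AE:
  assumes "f \<in> borel_measurable M" "g \<in> borel_measurable M" "AE x in M. f x = g x"
  shows "L2_norm M f = L2_norm M g"
  unfolding L2_norm_def using assms by (intro arg_cong[where f=sqrt] integral_cong_AE) auto

lemma L2_inner_cong_AE:
  assumes "f \<in> borel_measurable M" "f' \<in> borel_measurable M" "AE x in M. f x = f' x"
    and "g \<in> borel_measurable M" "g' \<in> borel_measurable M" "AE x in M. g x = g' x"
  shows "L2_inner M f g = L2_inner M f' g'"
  unfolding L2_inner_def using assms by (intro integral_cong_AE) auto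

lemma L2_mult_bound:
  assumes [measurable]: "f \<in> L2 M" "g \<in> L2 M"
  shows "integrable M (\<lambda>x. norm (f x) * norm (g x))"
    and "(LINT x|M. norm (f x) * norm (g x)) \<le> L2_norm M f * L2_norm M g"
proof -
  let ?I = "\<integral>\<^sup>+x. ennreal (norm (f x) * norm (g x)) \<partial>M"
  have "?I\<^sup>2 = (\<integral>\<^sup>+x. ennreal (norm (f x)) * ennreal (norm (g x)) \<partial>M)\<^sup>2"
    by (simp add: ennreal_mult)
  also have "\<dots> \<le> ennreal ((L2_norm M f)\<^sup>2) * ennreal ((L2_norm M g)\<^sup>2)"
    using Cauchy_Schwarz_nn_integral[of "\<lambda>x. ennreal (norm (f x))" M "\<lambda>x. ennreal (norm (g x))"]
    unfolding nn_integral_L2[OF assms(1)] nn_integral_L2[OF assms(2)] by simp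
  also have "\<dots> = ennreal ((L2_norm M f * L2_norm M g)\<^sup>2)"
    by (simp only: ennreal_mult[OF zero_le_power2 zero_le_power2] power_mult_distrib)
  finally have *: "?I\<^sup>2 \<le> ennreal ((L2_norm M f * L2_norm M g)\<^sup>2)" .
  have **: "?I \<le> ennreal (L2_norm M f * L2_norm M g)"
  \<comment> \<open>Only the square of the integral is bounded so far; the root may be taken once an
    infinite integral is excluded.\<close>
  proof (cases ?I)
    case (real r)
    then have "r\<^sup>2 \<le> (L2_norm M f * L2_norm M g)\<^sup>2"
      using * by (simp add: ennreal_power)
    then show ?thesis
      using real by (auto intro: ennreal_leI power2_le_imp_le)
  next
    case top
    then show ?thesis using * by (simp add: power2_eq_square top_unique)
  qed
  then show i: "integrable M (\<lambda>x. norm (f x) * norm (g x))"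
    by (auto simp: integrable_iff_bounded norm_mult intro: le_less_trans)
  show "(LINT x|M. norm (f x) * norm (g x)) \<le> L2_norm M f * L2_norm M g"
    using ** nn_integral_eq_integral[OF i] by simp
qed

lemma L2_mult_integrable:
  assumes [measurable]: "f \<in> L2 M" "g \<in> L2 M"
  shows "integrable M (\<lambda>x. f x * cnj (g x))"
  by (rule Bochner_Integration.integrable_bound[OF L2_mult_bound(1)[OF assms]])
    (auto simp: norm_mult)

lemma L2_inner_CS:
  assumes "f \<in> L2 M" "g \<in> L2 M"
  shows "norm (L2_inner M f g) \<le> L2_norm M f * L2_norm M g"
proof -
  have "norm (L2_inner M f g) \<le> (LINT x|M. norm (f x * cnj (g x)))"
    unfolding L2_inner_def by (rule integral_norm_bound)
  also have "\<dots> = (LINT x|M. norm (f x) * norm (g x))"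
    by (simp add: norm_mult)
  finally show ?thesis using L2_mult_bound(2)[OF assms] by simp
qed

lemma L2_inner_lincomb_left:
  assumes "f \<in> L2 M" "g \<in> L2 M" "h \<in> L2 M"
  shows "L2_inner M (\<lambda>x. a * f x + b * g x) h = a * L2_inner M f h + b * L2_inner M g h"
  using L2_mult_integrable[OF assms(1,3)] L2_mult_integrable[OF assms(2,3)]
  by (simp add: L2_inner_def distrib_right mult.assoc)

lemma L2_inner_cnj:
  "L2_inner M g f = cnj (L2_inner M f g)"
  unfolding L2_inner_def Bochner_Integration.integral_cnj[symmetric] by (simp add: mult.commute)

lemma L2_inner_lincomb_right:
  assumes "f \<in> L2 M" "g \<in> L2 M" "h \<in> L2 M"
  shows "L2_inner M h (\<lambda>x. a * f x + b * g x) = cnj a * L2_inner M h f + cnj b * L2_inner M h g"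
  using L2_inner_lincomb_left[OF assms, of a b]
  by (metis L2_inner_cnj complex_cnj_add complex_cnj_mult)

lemma L2_inner_diff_left:
  "\<lbrakk>f \<in> L2 M; g \<in> L2 M; h \<in> L2 M\<rbrakk> \<Longrightarrow>
    L2_inner M (\<lambda>x. f x - g x) h = L2_inner M f h - L2_inner M g h"
  using L2_inner_lincomb_left[of f M g h 1 "-1"] by simp

lemma L2_inner_scale_left:
  "L2_inner M (\<lambda>x. a * f x) h = a * L2_inner M f h"
  by (simp add: L2_inner_def mult.assoc)

lemma L2_inner_scale_right:
  "L2_inner M h (\<lambda>x. a * f x) = cnj a * L2_inner M h f"
  by (metis L2_inner_cnj L2_inner_scale_left complex_cnj_mult)

lemma L2_inner_sum_left:
  assumes "\<And>i. i \<in> I \<Longrightarrow> f i \<in> L2 M" "h \<in> L2 M"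
  shows "L2_inner M (\<lambda>x. \<Sum>i\<in>I. f i x) h = (\<Sum>i\<in>I. L2_inner M (f i) h)"
  using L2_mult_integrable[OF assms(1,2)]
  by (simp add: L2_inner_def sum_distrib_right)

lemma L2_inner_self:
  "L2_inner M f f = complex_of_real ((L2_norm M f)\<^sup>2)"
  unfolding L2_inner_def L2_norm_def complex_norm_square[symmetric]
  by (simp add: integral_complex_of_real del: of_real_power flip: of_real_power)

lemma L2_norm_sq: "(L2_norm M f)\<^sup>2 = Re (L2_inner M f f)"
  by (simp add: L2_inner_self)

lemma L2_norm_scale: "L2_norm M (\<lambda>x. a * f x) = norm a * L2_norm M f"
  by (simp add: L2_norm_def norm_mult power_mult_distrib real_sqrt_mult)

lemma L2_norm_zero [simp]: "L2_norm M (\<lambda>x. 0) = 0"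
  by (simp add: L2_norm_def)

text \<open>Two free coefficients let one expansion serve the triangle inequality, the midpoint and
  the difference in the parallelogram argument, and the perturbation \<open>F n + t * g\<close> of a
  minimising sequence.\<close>

lemma L2_norm_add_sq:
  assumes "f \<in> L2 M" "g \<in> L2 M"
  shows "(L2_norm M (\<lambda>x. a * f x + b * g x))\<^sup>2 = (norm a)\<^sup>2 * (L2_norm M f)\<^sup>2
     + 2 * Re (a * cnj b * L2_inner M f g) + (norm b)\<^sup>2 * (L2_norm M g)\<^sup>2"
proof -
  have "L2_inner M (\<lambda>x. a * f x + b * g x) (\<lambda>x. a * f x + b * g x)
     = a * cnj a * L2_inner M f f + a * cnj b * L2_inner M f g
       + b * cnj a * L2_inner M g f + b * cnj b * L2_inner M g g"
    using assms by (simp add: L2_inner_lincomb_left L2_inner_lincomb_right L2_lincomb algebra_simps)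
  moreover have "Re (b * cnj a * L2_inner M g f) = Re (a * cnj b * L2_inner M f g)"
    unfolding L2_inner_cnj[of M g f] by (simp add: algebra_simps)
  moreover have "Re (a * cnj a * L2_inner M f f) = (norm a)\<^sup>2 * (L2_norm M f)\<^sup>2" for a f
    by (simp add: L2_inner_self flip: complex_norm_square)
  ultimately show ?thesis
    by (simp only: L2_norm_sq[of M "\<lambda>x. a * f x + b * g x"] plus_complex.sel)
qed

lemma L2_norm_triangle:
  assumes "f \<in> L2 M" "g \<in> L2 M"
  shows "L2_norm M (\<lambda>x. f x + g x) \<le> L2_norm M f + L2_norm M g"
proof (rule power2_le_imp_le)
  have "Re (L2_inner M f g) \<le> L2_norm M f * L2_norm M g"
    using L2_inner_CS[OF assms] complex_Re_le_cmod order_trans by blast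
  then show "(L2_norm M (\<lambda>x. f x + g x))\<^sup>2 \<le> (L2_norm M f + L2_norm M g)\<^sup>2"
    using L2_norm_add_sq[OF assms, of 1 1] by (simp add: power2_sum)
qed simp

lemma L2_norm_minus_commute: "L2_norm M (\<lambda>x. f x - g x) = L2_norm M (\<lambda>x. g x - f x)"
  by (simp add: L2_norm_def norm_minus_commute)

lemma L2_norm_triangle_diff:
  assumes "f \<in> L2 M" "g \<in> L2 M" "h \<in> L2 M"
  shows "L2_norm M (\<lambda>x. f x - h x) \<le> L2_norm M (\<lambda>x. f x - g x) + L2_norm M (\<lambda>x. g x - h x)"
  using L2_norm_triangle[OF L2_diff[OF assms(1,2)] L2_diff[OF assms(2,3)]] by simp

lemma L2_norm_le_diff_add:
  assumes "f \<in> L2 M" "g \<in> L2 M"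
  shows "L2_norm M f \<le> L2_norm M (\<lambda>x. f x - g x) + L2_norm M g"
  using L2_norm_triangle_diff[OF assms L2_zero] by simp

lemma L2_norm_sum:
  assumes "\<And>i. i \<in> I \<Longrightarrow> f i \<in> L2 M"
  shows "L2_norm M (\<lambda>x. \<Sum>i\<in>I. f i x) \<le> (\<Sum>i\<in>I. L2_norm M (f i))"
  using assms
proof (induction I rule: infinite_finite_induct)
  case (insert i I)
  then show ?case
    using L2_norm_triangle[of "f i" M "\<lambda>x. \<Sum>i\<in>I. f i x"] by (force intro: L2_sum)
qed auto

lemma L2_norm_eq_0:
  assumes "f \<in> L2 M" "L2_norm M f = 0"
  shows "AE x in M. f x = 0"
proof -
  have "(LINT x|M. (norm (f x))\<^sup>2) = 0"
    using assms by (simp add: L2_norm_def)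
  then have "AE x in M. (norm (f x))\<^sup>2 = 0"
    using assms by (subst (asm) integral_nonneg_eq_0_iff_AE) (auto simp: L2_def)
  then show ?thesis by simp
qed

lemma L2_orthogonal_self:
  assumes "f \<in> L2 M" "L2_inner M f f = 0"
  shows "AE x in M. f x = 0"
  using assms by (intro L2_norm_eq_0) (auto simp: L2_inner_self)

text \<open>Along a subsequence with successive distances at most \<open>4 ^ (- k)\<close> the weighted series of
  \<open>2 ^ k * norm (u (k + 1) - u k) ^ 2\<close> is integrable, which gives almost everywhere convergence
  without Minkowski's inequality for infinite sums.\<close>

theorem L2_complete:
  assumes F: "\<And>n. F n \<in> L2 M"
    and cauchy: "\<And>e. 0 < e \<Longrightarrow> \<exists>N. \<forall>m\<ge>N. \<forall>n\<ge>N. L2_norm M (\<lambda>x. F m x - F n x) \<le> e"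
  shows "\<exists>g\<in>L2 M. (\<lambda>n. L2_norm M (\<lambda>x. F n x - g x)) \<longlonglongrightarrow> 0"
proof -
  have [measurable]: "F n \<in> borel_measurable M" for n
    using F by (rule L2_measurable)
  have "\<exists>N. \<forall>k::nat. (\<forall>m\<ge>N k. \<forall>n\<ge>N k. L2_norm M (\<lambda>x. F m x - F n x) \<le> (1/4)^k)"
    using cauchy by (intro choice) simp
  then obtain N where N: "\<And>k m n. m \<ge> N k \<Longrightarrow> n \<ge> N k \<Longrightarrow> L2_norm M (\<lambda>x. F m x - F n x) \<le> (1/4)^k"
    by blast
  \<comment> \<open>The sum dominates every threshold \<open>N j\<close> with
    \<open>j \<le> k\<close>, and the extra summand \<open>k\<close> makes the indices tend to
    infinity even if all thresholds vanish.\<close>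
  define r where "r k = k + (\<Sum>j\<le>k. N j)" for k
  have r_ge: "N j \<le> r k" if "j \<le> k" for j k
    using that member_le_sum[of j "{..k}" N] by (simp add: r_def)
  have r_id: "k \<le> r k" for k by (simp add: r_def)
  define u where "u k = F (r k)" for k
  have [measurable]: "u k \<in> borel_measurable M" for k by (simp add: u_def)
  have uL2: "u k \<in> L2 M" for k by (simp add: u_def F)
  define w where "w k x = ennreal (2^k) * (ennreal (norm (u (Suc k) x - u k x)))\<^sup>2" for k x
  have [measurable]: "w k \<in> borel_measurable M" for k unfolding w_def by measurable
  have w: "(\<integral>\<^sup>+x. w k x \<partial>M) \<le> ennreal ((1/2)^k)" for k
  proof -
    have "(\<integral>\<^sup>+x. w k x \<partial>M) = ennreal (2^k) * (\<integral>\<^sup>+x. (ennreal (norm (u (Suc k) x - u k x)))\<^sup>2 \<partial>M)"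
      unfolding w_def by (intro nn_integral_cmult) measurable
    also have "\<dots> = ennreal (2^k) * ennreal ((L2_norm M (\<lambda>x. u (Suc k) x - u k x))\<^sup>2)"
      using uL2 by (subst nn_integral_L2) (auto intro: L2_diff)
    also have "\<dots> = ennreal (2^k * (L2_norm M (\<lambda>x. u (Suc k) x - u k x))\<^sup>2)"
      by (simp add: ennreal_mult)
    also have "\<dots> \<le> ennreal (2^k * ((1/4)^k)\<^sup>2)"
      unfolding u_def
      by (intro ennreal_leI mult_left_mono power_mono N) (auto intro: r_ge)
    also have "\<dots> \<le> ennreal ((1/2)^k)"
    proof (intro ennreal_leI)
      have "(2::real)^k * ((1/4)^k)\<^sup>2 = (1/8)^k"
        by (simp add: power2_eq_square flip: power_mult_distrib)
      also have "\<dots> \<le> (1/2)^k" by (intro power_mono) auto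
      finally show "(2::real)^k * ((1/4)^k)\<^sup>2 \<le> (1/2)^k" .
    qed
    finally show ?thesis .
  qed
  have "(\<integral>\<^sup>+x. (\<Sum>k. w k x) \<partial>M) = (\<Sum>k. \<integral>\<^sup>+x. w k x \<partial>M)"
    by (intro nn_integral_suminf) measurable
  also have "\<dots> \<le> (\<Sum>k. ennreal ((1/2)^k))"
    by (intro suminf_le w) auto
  also have "\<dots> = ennreal (\<Sum>k. (1/2)^k)"
    by (intro suminf_ennreal2) (auto intro: summable_geometric)
  also have "\<dots> < \<infinity>" by simp
  finally have "AE x in M. (\<Sum>k. w k x) \<noteq> \<infinity>"
    by (intro nn_integral_PInf_AE) auto
  moreover have "convergent (\<lambda>k. u k x)" if "(\<Sum>k. w k x) \<noteq> \<infinity>" for x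
  proof -
    define c where "c = enn2real (\<Sum>k. w k x)"
    have c: "(\<Sum>k. w k x) = ennreal c" "c \<ge> 0"
      using that by (auto simp: c_def less_top)
    \<comment> \<open>A single term of the weighted series is at most its sum \<open>c\<close>;
      dividing by the weight \<open>2 ^ k\<close> and taking roots gives geometric decay with ratio
      \<open>1 / sqrt 2\<close>.\<close>
    have le: "norm (u (Suc k) x - u k x) \<le> sqrt c * (1 / sqrt 2)^k" for k
    proof (rule power2_le_imp_le)
      have "w k x \<le> ennreal c"
        using c(1) sum_le_suminf[of "\<lambda>k. w k x" "{k}"] by simp
      then have "2^k * (norm (u (Suc k) x - u k x))\<^sup>2 \<le> c"
        using c(2) by (simp add: w_def ennreal_power flip: ennreal_mult)
      then have "(norm (u (Suc k) x - u k x))\<^sup>2 \<le> c * (1/2)^k"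
        by (simp add: field_simps)
      also have "\<dots> = (sqrt c * (1 / sqrt 2)^k)\<^sup>2"
        using c(2) by (simp add: power_mult_distrib power_divide flip: power_mult)
            (simp add: power_mult mult.commute[of k 2])
      finally show "(norm (u (Suc k) x - u k x))\<^sup>2 \<le> (sqrt c * (1 / sqrt 2)^k)\<^sup>2" .
    qed (use c in auto)
    have "summable (\<lambda>k. u (Suc k) x - u k x)"
    proof (rule summable_comparison_test')
      show "summable (\<lambda>k. sqrt c * (1 / sqrt 2)^k)"
        by (intro summable_mult summable_geometric) simp
    qed (rule le)
    then have "convergent (\<lambda>n. \<Sum>k<n. u (Suc k) x - u k x)"
      by (simp add: summable_iff_convergent)
    then have "convergent (\<lambda>n. u n x - u 0 x)"
      using sum_lessThan_telescope[of "\<lambda>k. u k x"] by simp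
    then show ?thesis
      by (simp add: convergent_diff_const_right_iff)
  qed
  ultimately have conv: "AE x in M. convergent (\<lambda>k. u k x)" by auto
  define g where "g x = lim (\<lambda>k. u k x)" for x
  have [measurable]: "g \<in> borel_measurable M"
    unfolding g_def by (rule borel_measurable_lim_metric) measurable
  have lim: "AE x in M. (\<lambda>k. u k x) \<longlonglongrightarrow> g x"
    using conv by (auto simp: g_def convergent_LIMSEQ_iff)
  \<comment> \<open>Fatou along \<open>u\<close> turns a bound for the tail of the sequence into
    membership of the difference \<open>F n - g\<close> together with its norm bound. Membership of
    \<open>g\<close> follows by subtracting this difference from \<open>F n\<close>.\<close>
  have fatou: "(\<lambda>x. F n x - g x) \<in> L2 M \<and> L2_norm M (\<lambda>x. F n x - g x) \<le> e"
    if n: "0 < e" "\<And>m. m \<ge> K \<Longrightarrow> L2_norm M (\<lambda>x. F n x - F m x) \<le> e" for n K e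
  proof -
    have "(\<integral>\<^sup>+x. (ennreal (norm (F n x - g x)))\<^sup>2 \<partial>M)
        = (\<integral>\<^sup>+x. liminf (\<lambda>k. (ennreal (norm (F n x - u k x)))\<^sup>2) \<partial>M)"
    proof (rule nn_integral_cong_AE)
      have "liminf (\<lambda>k. (ennreal (norm (F n x - u k x)))\<^sup>2) = (ennreal (norm (F n x - g x)))\<^sup>2"
        if "(\<lambda>k. u k x) \<longlonglongrightarrow> g x" for x
        using that by (intro lim_imp_Liminf) (auto simp: ennreal_power intro!: tendsto_intros)
      then show "AE x in M. (ennreal (norm (F n x - g x)))\<^sup>2
          = liminf (\<lambda>k. (ennreal (norm (F n x - u k x)))\<^sup>2)"
        using lim by auto
    qed
    also have "\<dots> \<le> liminf (\<lambda>k. \<integral>\<^sup>+x. (ennreal (norm (F n x - u k x)))\<^sup>2 \<partial>M)"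
      by (intro nn_integral_liminf) measurable
    also have "\<dots> \<le> ennreal (e\<^sup>2)"
    proof (rule Liminf_le)
      have "(\<integral>\<^sup>+x. (ennreal (norm (F n x - u k x)))\<^sup>2 \<partial>M) \<le> ennreal (e\<^sup>2)" if "k \<ge> K" for k
      proof -
        have "r k \<ge> K" using that r_id[of k] by simp
        then show ?thesis
          using n F unfolding u_def by (subst nn_integral_L2) (auto intro!: L2_diff power_mono)
      qed
      then show "\<forall>\<^sub>F k in sequentially. (\<integral>\<^sup>+x. (ennreal (norm (F n x - u k x)))\<^sup>2 \<partial>M) \<le> ennreal (e\<^sup>2)"
        by (auto simp: eventually_sequentially)
    qed simp
    finally show ?thesis
      using L2_norm_leI[of "\<lambda>x. F n x - g x" M e] \<open>0 < e\<close> by auto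
  qed
  have gL2: "g \<in> L2 M"
  proof -
    obtain K where K: "\<And>m n. m \<ge> K \<Longrightarrow> n \<ge> K \<Longrightarrow> L2_norm M (\<lambda>x. F m x - F n x) \<le> 1"
      using cauchy[of 1] by auto
    then have "(\<lambda>x. F K x - g x) \<in> L2 M" using fatou[of 1 K K] by simp
    from L2_diff[OF F[of K] this] show ?thesis by simp
  qed
  moreover have "(\<lambda>n. L2_norm M (\<lambda>x. F n x - g x)) \<longlonglongrightarrow> 0"
  proof (rule LIMSEQ_I)
    fix e :: real assume "0 < e"
    then obtain K where K: "\<And>m n. m \<ge> K \<Longrightarrow> n \<ge> K \<Longrightarrow> L2_norm M (\<lambda>x. F m x - F n x) \<le> e/2"
      using cauchy[of "e/2"] by auto
    have "L2_norm M (\<lambda>x. F n x - g x) \<le> e/2" if "n \<ge> K" for n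
      using fatou[of "e/2" K n] K that \<open>0 < e\<close> by simp
    then show "\<exists>K. \<forall>n\<ge>K. norm (L2_norm M (\<lambda>x. F n x - g x) - 0) < e"
      using \<open>0 < e\<close> by (intro exI[of _ K]) force
  qed
  ultimately show ?thesis by blast
qed

section \<open>Representation, projections and compactness\<close>

text \<open>Minimising \<open>J f\<close>, the square norm of \<open>f\<close> minus
  \<open>2 * Re (\<phi> f)\<close>, over \<open>S\<close>: the parallelogram law makes a minimising
  sequence Cauchy, and stationarity at its limit \<open>u\<close> is the representation.
  \<open>S\<close> is not assumed closed, so \<open>u\<close> may leave \<open>S\<close>; the
  sequence in \<open>S\<close> is returned as well. With \<open>S\<close> the whole space this is
  the Riesz theorem, with \<open>\<phi>\<close> the pairing with some \<open>h\<close> it is a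
  density criterion. Antilinearity matches the second argument of \<open>L2_inner\<close>.\<close>

theorem L2_representation:
  fixes \<phi> :: "('a \<Rightarrow> complex) \<Rightarrow> complex"
  assumes S: "S \<subseteq> L2 M" and S0: "(\<lambda>x. 0) \<in> S"
    and Slin: "\<And>f g a b. f \<in> S \<Longrightarrow> g \<in> S \<Longrightarrow> (\<lambda>x. a * f x + b * g x) \<in> S"
    and lin: "\<And>f g a b. f \<in> S \<Longrightarrow> g \<in> S \<Longrightarrow> \<phi> (\<lambda>x. a * f x + b * g x) = cnj a * \<phi> f + cnj b * \<phi> g"
    and bound: "\<And>f. f \<in> S \<Longrightarrow> norm (\<phi> f) \<le> C * L2_norm M f"
  obtains u F where "u \<in> L2 M" "\<And>n::nat. F n \<in> S" "(\<lambda>n. L2_norm M (\<lambda>x. F n x - u x)) \<longlonglongrightarrow> 0"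
    "\<And>g. g \<in> S \<Longrightarrow> L2_inner M u g = \<phi> g"
proof -
  define J where "J f = (L2_norm M f)\<^sup>2 - 2 * Re (\<phi> f)" for f
  define m where "m = Inf (J ` S)"
  \<comment> \<open>Completing the square: the infimum is finite because the linear part is
    controlled by the norm.\<close>
  have "- C\<^sup>2 \<le> J f" if "f \<in> S" for f
  proof -
    have "Re (\<phi> f) \<le> C * L2_norm M f"
      using bound[OF that] complex_Re_le_cmod order_trans by blast
    moreover have "0 \<le> (L2_norm M f - C)\<^sup>2" by simp
    ultimately show ?thesis by (simp add: J_def power2_diff mult_ac)
  qed
  then have bdd: "bdd_below (J ` S)"
    by (intro bdd_belowI2)
  have mle: "m \<le> J f" if "f \<in> S" for f
    unfolding m_def using that bdd by (intro cInf_lower) auto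
  have "\<exists>f\<in>S. J f < m + 1 / real (Suc n)" for n
  proof -
    have "Inf (J ` S) < m + 1 / real (Suc n)" by (simp add: m_def)
    then show ?thesis
      using S0 bdd by (subst (asm) cInf_less_iff) auto
  qed
  then obtain F where FS: "\<And>n. F n \<in> S" and FJ: "\<And>n. J (F n) < m + 1 / real (Suc n)"
    by metis
  have FL2: "F n \<in> L2 M" for n using FS S by auto
  \<comment> \<open>The midpoint of \<open>f\<close> and \<open>g\<close> stays in \<open>S\<close>,
    so its value is at least \<open>m\<close>; the rest is the parallelogram law.\<close>
  have par: "(L2_norm M (\<lambda>x. f x - g x))\<^sup>2 \<le> 2 * J f + 2 * J g - 4 * m" if fg: "f \<in> S" "g \<in> S" for f g
  proof -
    have L: "f \<in> L2 M" "g \<in> L2 M" using fg S by auto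
    have "m \<le> J (\<lambda>x. (1/2) * f x + (1/2) * g x)"
      using fg by (intro mle Slin)
    moreover have "J (\<lambda>x. (1/2) * f x + (1/2) * g x) =
        (1/4) * (L2_norm M f)\<^sup>2 + (1/2) * Re (L2_inner M f g) + (1/4) * (L2_norm M g)\<^sup>2
         - Re (\<phi> f) - Re (\<phi> g)"
      unfolding J_def L2_norm_add_sq[OF L] lin[OF fg] by (simp add: power2_eq_square)
    moreover have "(L2_norm M (\<lambda>x. f x - g x))\<^sup>2
        = (L2_norm M f)\<^sup>2 - 2 * Re (L2_inner M f g) + (L2_norm M g)\<^sup>2"
      using L2_norm_add_sq[OF L, of 1 "-1"] by simp
    ultimately show ?thesis by (simp add: J_def)
  qed
  have "\<exists>N. \<forall>k\<ge>N. \<forall>n\<ge>N. L2_norm M (\<lambda>x. F k x - F n x) \<le> e" if "0 < e" for e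
  proof -
    obtain N where N: "4 / e\<^sup>2 < real N" using reals_Archimedean2 by blast
    have "L2_norm M (\<lambda>x. F k x - F n x) \<le> e" if kn: "k \<ge> N" "n \<ge> N" for k n
    proof (rule power2_le_imp_le)
      have small: "1 / real (Suc j) \<le> e\<^sup>2 / 4" if "j \<ge> N" for j
      proof -
        have "4 / e\<^sup>2 \<le> real (Suc j)" using N that by linarith
        then show ?thesis using \<open>0 < e\<close> by (simp add: field_simps)
      qed
      have "(L2_norm M (\<lambda>x. F k x - F n x))\<^sup>2 \<le> 2 * J (F k) + 2 * J (F n) - 4 * m"
        using FS by (intro par)
      also have "\<dots> \<le> e\<^sup>2"
        using FJ[of k] FJ[of n] small[OF kn(1)] small[OF kn(2)] by linarith
      finally show "(L2_norm M (\<lambda>x. F k x - F n x))\<^sup>2 \<le> e\<^sup>2" .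
    qed (use \<open>0 < e\<close> in simp)
    then show ?thesis by blast
  qed
  then obtain u where u: "u \<in> L2 M" "(\<lambda>n. L2_norm M (\<lambda>x. F n x - u x)) \<longlonglongrightarrow> 0"
    using L2_complete[of F M] FL2 by blast
  have "L2_inner M u g = \<phi> g" if g: "g \<in> S" for g
  proof -
    have gL2: "g \<in> L2 M" using g S by auto
    define d where "d = L2_inner M u g - \<phi> g"
    have limF: "(\<lambda>n. L2_inner M (F n) g - \<phi> g) \<longlonglongrightarrow> d"
    proof -
      have "(\<lambda>n. L2_inner M (F n) g - L2_inner M u g) \<longlonglongrightarrow> 0"
      proof (rule Lim_null_comparison)
        show "(\<lambda>n. L2_norm M (\<lambda>x. F n x - u x) * L2_norm M g) \<longlonglongrightarrow> 0"
          using tendsto_mult_left_zero[OF u(2)] by simp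
        show "\<forall>\<^sub>F n in sequentially. norm (L2_inner M (F n) g - L2_inner M u g)
            \<le> L2_norm M (\<lambda>x. F n x - u x) * L2_norm M g"
          using L2_inner_CS[OF L2_diff[OF FL2 u(1)] gL2] L2_inner_diff_left[OF FL2 u(1) gL2] by simp
      qed
      then have "(\<lambda>n. (L2_inner M (F n) g - L2_inner M u g) + d) \<longlonglongrightarrow> 0 + d"
        by (intro tendsto_intros)
      then show ?thesis by (simp add: d_def)
    qed
    \<comment> \<open>Moving from \<open>F n\<close> in direction \<open>t * g\<close> cannot go
      below the infimum, and \<open>F n\<close> exceeds it by less than \<open>1 / Suc n\<close>. In
      the limit the increment is nonnegative for every complex \<open>t\<close>.\<close>
    have quad: "0 \<le> (norm t)\<^sup>2 * (L2_norm M g)\<^sup>2 + 2 * Re (cnj t * d)" for t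
    proof -
      have "- (1 / real (Suc n)) \<le> (norm t)\<^sup>2 * (L2_norm M g)\<^sup>2
          + 2 * Re (cnj t * (L2_inner M (F n) g - \<phi> g))" for n
      proof -
        have "m \<le> J (\<lambda>x. 1 * F n x + t * g x)"
          using FS g by (intro mle Slin)
        also have "\<dots> = J (F n) + (norm t)\<^sup>2 * (L2_norm M g)\<^sup>2
            + 2 * Re (cnj t * (L2_inner M (F n) g - \<phi> g))"
          unfolding J_def L2_norm_add_sq[OF FL2 gL2] lin[OF FS g]
          by (simp add: algebra_simps)
        finally show ?thesis using FJ[of n] by linarith
      qed
      moreover have "(\<lambda>n. - (1 / real (Suc n))) \<longlonglongrightarrow> - 0"
        by (intro tendsto_minus lim_1_over_n[THEN LIMSEQ_Suc])
      moreover have "(\<lambda>n. (norm t)\<^sup>2 * (L2_norm M g)\<^sup>2 + 2 * Re (cnj t * (L2_inner M (F n) g - \<phi> g)))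
          \<longlonglongrightarrow> (norm t)\<^sup>2 * (L2_norm M g)\<^sup>2 + 2 * Re (cnj t * d)"
        by (intro tendsto_intros limF)
      ultimately show ?thesis
        using LIMSEQ_le[of "\<lambda>n. - (1 / real (Suc n))"] by force
    qed
    have "d = 0"
    proof (rule ccontr)
      assume "d \<noteq> 0"
      \<comment> \<open>For \<open>t = - s * d\<close> the linear term of \<open>quad\<close> must
        beat the quadratic one, which needs \<open>s\<close> times the square norm of
        \<open>g\<close> below 2. Adding 1 in the denominator covers the case that \<open>g\<close>
        has norm 0.\<close>
      define s where "s = 1 / (1 + (L2_norm M g)\<^sup>2)"
      have s: "0 < s" "s * (L2_norm M g)\<^sup>2 < 1"
        by (auto simp: s_def field_simps add_pos_nonneg)
      have "0 \<le> s\<^sup>2 * (norm d)\<^sup>2 * (L2_norm M g)\<^sup>2 - 2 * s * (norm d)\<^sup>2"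
      proof -
        have "cnj (- of_real s * d) * d = - of_real (s * (norm d)\<^sup>2)"
          by (simp only: of_real_mult complex_norm_square) (simp add: mult_ac)
        moreover have "(norm (- of_real s * d))\<^sup>2 = s\<^sup>2 * (norm d)\<^sup>2"
          by (simp add: norm_mult power_mult_distrib)
        ultimately have "0 \<le> s\<^sup>2 * (norm d)\<^sup>2 * (L2_norm M g)\<^sup>2 + 2 * Re (- of_real (s * (norm d)\<^sup>2))"
          using quad[of "- of_real s * d"] by (simp only:)
        then show ?thesis by (simp only: uminus_complex.sel Re_complex_of_real)
      qed
      also have "\<dots> = s * (norm d)\<^sup>2 * (s * (L2_norm M g)\<^sup>2 - 2)"
        by (simp add: algebra_simps power2_eq_square)
      also have "\<dots> < 0"
        using s \<open>d \<noteq> 0\<close> by (intro mult_pos_neg) auto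
      finally show False by simp
    qed
    then show ?thesis by (simp add: d_def)
  qed
  with u FS that show ?thesis by blast
qed

corollary L2_Riesz:
  fixes \<phi> :: "('a \<Rightarrow> complex) \<Rightarrow> complex"
  assumes "\<And>f g a b. f \<in> L2 M \<Longrightarrow> g \<in> L2 M \<Longrightarrow> \<phi> (\<lambda>x. a * f x + b * g x) = cnj a * \<phi> f + cnj b * \<phi> g"
    and "\<And>f. f \<in> L2 M \<Longrightarrow> norm (\<phi> f) \<le> C * L2_norm M f"
  obtains u where "u \<in> L2 M" "\<And>g. g \<in> L2 M \<Longrightarrow> L2_inner M u g = \<phi> g"
  by (rule L2_representation[of "L2 M" M \<phi> C]) (use assms in \<open>auto intro: L2_lincomb\<close>)

text \<open>The vector representing the pairing with \<open>h\<close> on \<open>S\<close> differs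
  from \<open>h\<close> by something orthogonal to \<open>S\<close>, hence by a null function; the
  approximants that produced it therefore converge to \<open>h\<close>.\<close>

corollary L2_dense_if_orthogonal_trivial:
  assumes S: "S \<subseteq> L2 M" "(\<lambda>x. 0) \<in> S"
    "\<And>f g a b. f \<in> S \<Longrightarrow> g \<in> S \<Longrightarrow> (\<lambda>x. a * f x + b * g x) \<in> S"
    and orth: "\<And>u. u \<in> L2 M \<Longrightarrow> (\<And>g. g \<in> S \<Longrightarrow> L2_inner M u g = 0) \<Longrightarrow> AE x in M. u x = 0"
    and h: "h \<in> L2 M"
  obtains F where "\<And>n::nat. F n \<in> S" "(\<lambda>n. L2_norm M (\<lambda>x. F n x - h x)) \<longlonglongrightarrow> 0"
proof -
  obtain u F where u: "u \<in> L2 M" "\<And>n::nat. F n \<in> S" "(\<lambda>n. L2_norm M (\<lambda>x. F n x - u x)) \<longlonglongrightarrow> 0"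
    "\<And>g. g \<in> S \<Longrightarrow> L2_inner M u g = L2_inner M h g"
  proof (rule L2_representation[of S M "L2_inner M h" "L2_norm M h"])
    show "L2_inner M h (\<lambda>x. a * f x + b * g x) = cnj a * L2_inner M h f + cnj b * L2_inner M h g"
      if "f \<in> S" "g \<in> S" for f g a b
      using that S h by (intro L2_inner_lincomb_right) auto
    show "norm (L2_inner M h f) \<le> L2_norm M h * L2_norm M f" if "f \<in> S" for f
      using that S h by (intro L2_inner_CS) auto
  qed (use S in auto)
  have FL2: "F n \<in> L2 M" for n using u(2) S by auto
  have "AE x in M. u x - h x = 0"
  proof (rule orth)
    show "(\<lambda>x. u x - h x) \<in> L2 M" using u h by (intro L2_diff)
    show "L2_inner M (\<lambda>x. u x - h x) g = 0" if "g \<in> S" for g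
      using that S u h by (subst L2_inner_diff_left) auto
  qed
  then have "L2_norm M (\<lambda>x. F n x - u x) = L2_norm M (\<lambda>x. F n x - h x)" for n
    using u(1) h FL2 by (intro L2_norm_cong_AE) (auto dest!: L2_measurable)
  with u(3) have "(\<lambda>n. L2_norm M (\<lambda>x. F n x - h x)) \<longlonglongrightarrow> 0" by simp
  with u(2) show ?thesis by (rule that)
qed

section \<open>Finite orthonormal systems and projections\<close>

definition L2_orthonormal :: "'a measure \<Rightarrow> ('a \<Rightarrow> complex) set \<Rightarrow> bool" where
  "L2_orthonormal M E \<longleftrightarrow> finite E \<and> E \<subseteq> L2 M \<and> (\<forall>e\<in>E. L2_norm M e = 1) \<and>
    (\<forall>e\<in>E. \<forall>e'\<in>E. e \<noteq> e' \<longrightarrow> L2_inner M e e' = 0)"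

text \<open>This is the orthogonal projection when \<open>E\<close> is orthonormal. For an arbitrary
  finite set of square integrable functions it is still a map of finite rank, and in this generality
  it enters \<open>finite_rank_approx_imp_compact_L2_operator\<close>.\<close>

definition L2_proj :: "'a measure \<Rightarrow> ('a \<Rightarrow> complex) set \<Rightarrow> ('a \<Rightarrow> complex) \<Rightarrow> 'a \<Rightarrow> complex" where
  "L2_proj M E u = (\<lambda>x. \<Sum>e\<in>E. L2_inner M u e * e x)"

lemma L2_proj_L2:
  assumes "E \<subseteq> L2 M" shows "L2_proj M E u \<in> L2 M"
  unfolding L2_proj_def using assms by (intro L2_sum L2_scale) auto

lemma L2_proj_lincomb:
  assumes "E \<subseteq> L2 M" "f \<in> L2 M" "g \<in> L2 M"
  shows "L2_proj M E (\<lambda>x. a * f x + b * g x) = (\<lambda>x. a * L2_proj M E f x + b * L2_proj M E g x)"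
proof -
  have "L2_inner M (\<lambda>x. a * f x + b * g x) e = a * L2_inner M f e + b * L2_inner M g e"
    if "e \<in> E" for e
    using that assms by (intro L2_inner_lincomb_left) auto
  then show ?thesis
    unfolding L2_proj_def
    by (simp add: distrib_right sum.distrib sum_distrib_left mult.assoc cong: sum.cong)
qed

lemma L2_proj_diff:
  assumes "E \<subseteq> L2 M" "f \<in> L2 M" "g \<in> L2 M"
  shows "L2_proj M E (\<lambda>x. f x - g x) = (\<lambda>x. L2_proj M E f x - L2_proj M E g x)"
  using L2_proj_lincomb[OF assms, of 1 "-1"] by simp

text \<open>The argument enters only through its coefficients, so almost everywhere equality of
  arguments becomes true equality of functions.\<close>

lemma L2_proj_cong_AE:
  assumes "E \<subseteq> L2 M" "f \<in> L2 M" "g \<in> L2 M" "AE x in M. f x = g x"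
  shows "L2_proj M E f = L2_proj M E g"
proof -
  have "L2_inner M f e = L2_inner M g e" if "e \<in> E" for e
    using that assms by (intro L2_inner_cong_AE) (auto dest!: L2_measurable)
  then show ?thesis by (simp add: L2_proj_def cong: sum.cong)
qed

text \<open>Bessel's identity. The residual is orthogonal to \<open>E\<close>, hence to the
  projection, so its square norm equals its pairing with \<open>u\<close>, and expanding that
  pairing leaves the squared coefficients.\<close>

lemma L2_norm_minus_proj:
  assumes E: "L2_orthonormal M E" and u: "u \<in> L2 M"
  shows "(L2_norm M (\<lambda>x. u x - L2_proj M E u x))\<^sup>2
    = (L2_norm M u)\<^sup>2 - (\<Sum>e\<in>E. (norm (L2_inner M u e))\<^sup>2)"
    and "\<And>e. e \<in> E \<Longrightarrow> L2_inner M (\<lambda>x. u x - L2_proj M E u x) e = 0"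
proof -
  have fin: "finite E" and EL2: "E \<subseteq> L2 M" using E by (auto simp: L2_orthonormal_def)
  let ?P = "L2_proj M E u"
  have PL2: "?P \<in> L2 M" using EL2 by (rule L2_proj_L2)
  let ?r = "\<lambda>x. u x - ?P x"
  have rL2: "?r \<in> L2 M" using u PL2 by (rule L2_diff)
  have Pin: "L2_inner M ?P h = (\<Sum>e\<in>E. L2_inner M u e * L2_inner M e h)" if "h \<in> L2 M" for h
    unfolding L2_proj_def using that EL2
    by (subst L2_inner_sum_left) (auto intro: L2_scale simp: L2_inner_scale_left)
  show r0: "L2_inner M ?r e = 0" if e: "e \<in> E" for e
  proof -
    have "L2_inner M ?P e = (\<Sum>e'\<in>E. L2_inner M u e' * L2_inner M e' e)"
      using e EL2 by (intro Pin) auto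
    also have "\<dots> = (\<Sum>e'\<in>E. if e' = e then L2_inner M u e else 0)"
      using E e by (intro sum.cong) (auto simp: L2_orthonormal_def L2_inner_self)
    also have "\<dots> = L2_inner M u e" using e fin by simp
    finally show ?thesis
      using e EL2 u PL2 by (subst L2_inner_diff_left) auto
  qed
  have "L2_inner M ?r ?P = cnj (L2_inner M ?P ?r)" by (rule L2_inner_cnj)
  also have "L2_inner M ?P ?r = (\<Sum>e\<in>E. L2_inner M u e * L2_inner M e ?r)"
    using rL2 by (rule Pin)
  also have "\<dots> = 0"
  proof (rule sum.neutral, rule ballI)
    fix e assume "e \<in> E"
    then show "L2_inner M u e * L2_inner M e ?r = 0"
      using r0[of e] by (subst L2_inner_cnj[of M e ?r]) simp
  qed
  finally have "L2_inner M ?r ?P = 0" by simp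
  then have "L2_inner M ?r ?r = L2_inner M ?r u"
    using L2_inner_lincomb_right[OF u PL2 rL2, of 1 "-1"] by simp
  also have "\<dots> = L2_inner M u u - (\<Sum>e\<in>E. L2_inner M u e * L2_inner M e u)"
    using L2_inner_diff_left[OF u PL2 u] Pin[OF u] by simp
  also have "(\<Sum>e\<in>E. L2_inner M u e * L2_inner M e u) = of_real (\<Sum>e\<in>E. (norm (L2_inner M u e))\<^sup>2)"
  proof -
    have "L2_inner M u e * L2_inner M e u = of_real ((norm (L2_inner M u e))\<^sup>2)" for e
      unfolding complex_norm_square L2_inner_cnj[of M e u] by (rule refl)
    then show ?thesis by (simp only: of_real_sum)
  qed
  finally have "complex_of_real ((L2_norm M ?r)\<^sup>2) =
      of_real ((L2_norm M u)\<^sup>2 - (\<Sum>e\<in>E. (norm (L2_inner M u e))\<^sup>2))"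
    by (simp only: L2_inner_self of_real_diff)
  then show "(L2_norm M ?r)\<^sup>2 = (L2_norm M u)\<^sup>2 - (\<Sum>e\<in>E. (norm (L2_inner M u e))\<^sup>2)"
    by (simp only: of_real_eq_iff)
qed

lemma L2_norm_minus_proj_le:
  assumes "L2_orthonormal M E" "u \<in> L2 M"
  shows "L2_norm M (\<lambda>x. u x - L2_proj M E u x) \<le> L2_norm M u"
proof (rule power2_le_imp_le)
  have "0 \<le> (\<Sum>e\<in>E. (norm (L2_inner M u e))\<^sup>2)" by (simp add: sum_nonneg)
  then show "(L2_norm M (\<lambda>x. u x - L2_proj M E u x))\<^sup>2 \<le> (L2_norm M u)\<^sup>2"
    using L2_norm_minus_proj(1)[OF assms] by linarith
qed simp

text \<open>Membership in the span is expressed by a residual of norm 0, since functions agree with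
  their projections only almost everywhere. A new vector contributes its normalised residual unless
  that residual already has norm 0.\<close>

lemma Gram_Schmidt_L2:
  assumes "finite G" "G \<subseteq> L2 M"
  shows "\<exists>E. L2_orthonormal M E \<and> (\<forall>g\<in>G. L2_norm M (\<lambda>x. g x - L2_proj M E g x) = 0)"
  using assms
proof (induction G)
  case empty
  then show ?case by (intro exI[of _ "{}"]) (simp add: L2_orthonormal_def)
next
  case (insert g G)
  then obtain E where E: "L2_orthonormal M E"
    and EG: "\<And>h. h \<in> G \<Longrightarrow> L2_norm M (\<lambda>x. h x - L2_proj M E h x) = 0" by auto
  have fin: "finite E" and EL2: "E \<subseteq> L2 M" using E by (auto simp: L2_orthonormal_def)
  have g: "g \<in> L2 M" using insert by auto
  define r where "r = (\<lambda>x. g x - L2_proj M E g x)"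
  have rL2: "r \<in> L2 M" unfolding r_def using g EL2 by (intro L2_diff L2_proj_L2)
  define \<rho> where "\<rho> = L2_norm M r"
  show ?case
  proof (cases "\<rho> = 0")
    case True
    then show ?thesis using E EG by (intro exI[of _ E]) (auto simp: r_def \<rho>_def)
  next
    case False
    then have pos: "0 < \<rho>" using L2_norm_nonneg[of M r] unfolding \<rho>_def by linarith
    define e where "e = (\<lambda>x. of_real (1 / \<rho>) * r x)"
    have eL2: "e \<in> L2 M" unfolding e_def using rL2 by (rule L2_scale)
    have norm_e: "L2_norm M e = 1"
      unfolding e_def L2_norm_scale using pos by (simp add: \<rho>_def norm_divide)
    have orth: "L2_inner M e e' = 0" if "e' \<in> E" for e'
      unfolding e_def L2_inner_scale_left r_def using L2_norm_minus_proj(2)[OF E g that] by simp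
    then have orth': "L2_inner M e' e = 0" if "e' \<in> E" for e'
      using that L2_inner_cnj[of M e' e] by simp
    have eE: "e \<notin> E" using orth[of e] norm_e by (auto simp: L2_inner_self)
    have E': "L2_orthonormal M (insert e E)"
      using E eL2 norm_e orth orth' by (auto simp: L2_orthonormal_def)
    have "L2_norm M (\<lambda>x. h x - L2_proj M (insert e E) h x) = 0" if h: "h \<in> insert g G" for h
    proof -
      have hL2: "h \<in> L2 M" using h insert by auto
      \<comment> \<open>Bessel's identity for both systems: adjoining \<open>e\<close> can only
        shrink a residual. Hence vanishing residuals stay zero, and for \<open>g\<close> the
        decrease is the square of \<open>\<rho>\<close>, the whole of what was left.\<close>
      have step: "(L2_norm M (\<lambda>x. h x - L2_proj M (insert e E) h x))\<^sup>2
          = (L2_norm M (\<lambda>x. h x - L2_proj M E h x))\<^sup>2 - (norm (L2_inner M h e))\<^sup>2"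
        using L2_norm_minus_proj(1)[OF E' hL2] L2_norm_minus_proj(1)[OF E hL2] fin eE by simp
      show ?thesis
      proof (cases "h = g")
        case False
        then have "(L2_norm M (\<lambda>x. h x - L2_proj M (insert e E) h x))\<^sup>2 \<le> 0"
          using step EG[of h] h by simp
        then show ?thesis by simp
      next
        case True
        have "L2_inner M (L2_proj M E g) e = 0"
          unfolding L2_proj_def using EL2 eL2 orth'
          by (subst L2_inner_sum_left) (auto intro: L2_scale simp: L2_inner_scale_left)
        then have "L2_inner M g e = L2_inner M r e"
          unfolding r_def using L2_inner_diff_left[OF g L2_proj_L2[OF EL2] eL2] by simp
        also have "\<dots> = of_real \<rho>"
          unfolding e_def L2_inner_scale_right L2_inner_self
          using pos by (simp add: \<rho>_def power2_eq_square)
        finally show ?thesis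
          using step True pos by (simp add: r_def[symmetric] \<rho>_def[symmetric])
      qed
    qed
    then show ?thesis using E' by blast
  qed
qed

section \<open>Bounded and compact operators\<close>

lemma bounded_L2_operator_L2: "bounded_L2_operator M N T \<Longrightarrow> f \<in> L2 M \<Longrightarrow> T f \<in> L2 N"
  by (simp add: bounded_L2_operator_def)

lemma bounded_L2_operator_lincomb:
  "bounded_L2_operator M N T \<Longrightarrow> f \<in> L2 M \<Longrightarrow> g \<in> L2 M \<Longrightarrow>
    AE y in N. T (\<lambda>x. a * f x + b * g x) y = a * T f y + b * T g y"
  by (simp add: bounded_L2_operator_def)

lemma bounded_L2_operator_scale:
  "bounded_L2_operator M N T \<Longrightarrow> f \<in> L2 M \<Longrightarrow> AE y in N. T (\<lambda>x. a * f x) y = a * T f y"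
  using bounded_L2_operator_lincomb[of M N T f f a 0] by simp

lemma bounded_L2_operator_bound:
  assumes "bounded_L2_operator M N T"
  obtains C where "0 < C" "\<And>f. f \<in> L2 M \<Longrightarrow> L2_norm N (T f) \<le> C * L2_norm M f"
proof -
  obtain C where C: "\<And>f. f \<in> L2 M \<Longrightarrow> L2_norm N (T f) \<le> C * L2_norm M f"
    using assms unfolding bounded_L2_operator_def by blast
  have "L2_norm N (T f) \<le> max C 1 * L2_norm M f" if "f \<in> L2 M" for f
    by (rule order_trans[OF C[OF that]]) (auto intro: mult_right_mono)
  then show ?thesis by (intro that[of "max C 1"]) auto
qed

lemma bounded_L2_operator_diff_norm:
  assumes T: "bounded_L2_operator M N T" and fg: "f \<in> L2 M" "g \<in> L2 M"
  shows "L2_norm N (\<lambda>y. T f y - T g y) = L2_norm N (T (\<lambda>x. f x - g x))"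
proof (rule L2_norm_cong_AE)
  show "AE y in N. T f y - T g y = T (\<lambda>x. f x - g x) y"
    using bounded_L2_operator_lincomb[OF T fg, of 1 "-1"] by auto
qed (use bounded_L2_operator_L2[OF T] L2_diff[OF fg] fg in \<open>auto dest!: L2_measurable\<close>)

text \<open>Compactness makes the image of the unit ball totally bounded. Orthonormalising the image
  of a finite net gives \<open>E\<close>: the residual vanishes on the net, and taking residuals is
  a contraction, so the distance to the net is not enlarged.\<close>

lemma compact_L2_operator_finite_rank_approx:
  assumes T: "compact_L2_operator M N T" and \<epsilon>: "0 < \<epsilon>"
  obtains E where "L2_orthonormal N E"
    "\<And>f. f \<in> L2 M \<Longrightarrow> L2_norm N (\<lambda>y. T f y - L2_proj N E (T f) y) \<le> \<epsilon> * L2_norm M f"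
proof -
  have bT: "bounded_L2_operator M N T" using T by (simp add: compact_L2_operator_def)
  note TL2 = bounded_L2_operator_L2[OF bT]
  define B where "B = {f \<in> L2 M. L2_norm M f \<le> 1}"
  \<comment> \<open>Without a finite net, points of the unit ball can be chosen one after another
    with images more than \<open>\<epsilon>\<close> apart; such a sequence has no convergent
    subsequence.\<close>
  have "\<exists>G. finite G \<and> G \<subseteq> B \<and> (\<forall>f\<in>B. \<exists>g\<in>G. L2_norm N (\<lambda>y. T f y - T g y) \<le> \<epsilon>)"
  proof (rule ccontr)
    assume neg: "\<not> ?thesis"
    have "\<exists>F. \<forall>n::nat. F n \<in> B \<and> (\<forall>k<n. \<epsilon> < L2_norm N (\<lambda>y. T (F n) y - T (F k) y))"
    proof (rule dependent_wellorder_choice)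
      fix F :: "nat \<Rightarrow> 'a \<Rightarrow> complex" and n
      assume "\<And>k. k < n \<Longrightarrow> F k \<in> B \<and> (\<forall>j<k. \<epsilon> < L2_norm N (\<lambda>y. T (F k) y - T (F j) y))"
      then have "finite (F ` {..<n}) \<and> F ` {..<n} \<subseteq> B" by auto
      then have "\<not> (\<forall>f\<in>B. \<exists>g\<in>F ` {..<n}. L2_norm N (\<lambda>y. T f y - T g y) \<le> \<epsilon>)"
        using neg by blast
      then show "\<exists>f. f \<in> B \<and> (\<forall>k<n. \<epsilon> < L2_norm N (\<lambda>y. T f y - T (F k) y))"
        by (auto simp: not_le)
    qed simp
    then obtain F :: "nat \<Rightarrow> 'a \<Rightarrow> complex" where F: "\<And>n. F n \<in> B"
      and far: "\<And>n k. k < n \<Longrightarrow> \<epsilon> < L2_norm N (\<lambda>y. T (F n) y - T (F k) y)" by blast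
    have "(\<forall>n. F n \<in> L2 M) \<and> (\<exists>B. \<forall>n. L2_norm M (F n) \<le> B)"
      using F by (auto simp: B_def)
    then obtain r g where r: "strict_mono (r :: nat \<Rightarrow> nat)" "g \<in> L2 N"
      "(\<lambda>n. L2_norm N (\<lambda>y. T (F (r n)) y - g y)) \<longlonglongrightarrow> 0"
      using T[unfolded compact_L2_operator_def, THEN conjunct2, rule_format, of F] by auto
    have FL2: "T (F n) \<in> L2 N" for n using F[of n] TL2 by (simp add: B_def)
    obtain K where K: "\<And>n. n \<ge> K \<Longrightarrow> L2_norm N (\<lambda>y. T (F (r n)) y - g y) < \<epsilon> / 2"
      using LIMSEQ_D[OF r(3), of "\<epsilon>/2"] \<epsilon> by auto
    have "L2_norm N (\<lambda>y. T (F (r (Suc K))) y - T (F (r K)) y)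
        \<le> L2_norm N (\<lambda>y. T (F (r (Suc K))) y - g y) + L2_norm N (\<lambda>y. g y - T (F (r K)) y)"
      by (intro L2_norm_triangle_diff FL2 r)
    also have "L2_norm N (\<lambda>y. g y - T (F (r K)) y) = L2_norm N (\<lambda>y. T (F (r K)) y - g y)"
      by (rule L2_norm_minus_commute)
    finally have "L2_norm N (\<lambda>y. T (F (r (Suc K))) y - T (F (r K)) y) < \<epsilon>"
      using K[of K] K[of "Suc K"] by simp
    moreover have "r K < r (Suc K)" using r(1) by (simp add: strict_mono_Suc_iff)
    ultimately show False
      using far[of "r K" "r (Suc K)"] by simp
  qed
  then obtain G where G: "finite G" "G \<subseteq> B"
    and net: "\<And>f. f \<in> B \<Longrightarrow> \<exists>g\<in>G. L2_norm N (\<lambda>y. T f y - T g y) \<le> \<epsilon>" by blast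
  have "finite (T ` G)" "T ` G \<subseteq> L2 N" using G TL2 by (auto simp: B_def)
  from Gram_Schmidt_L2[OF this] obtain E where E: "L2_orthonormal N E"
    and EG: "\<And>g. g \<in> G \<Longrightarrow> L2_norm N (\<lambda>y. T g y - L2_proj N E (T g) y) = 0"
    by blast
  have EL2: "E \<subseteq> L2 N" using E by (simp add: L2_orthonormal_def)
  have unit: "L2_norm N (\<lambda>y. T f y - L2_proj N E (T f) y) \<le> \<epsilon>" if f: "f \<in> B" for f
  proof -
    obtain g where g: "g \<in> G" "L2_norm N (\<lambda>y. T f y - T g y) \<le> \<epsilon>" using net[OF f] by blast
    have L: "T f \<in> L2 N" "T g \<in> L2 N" using f g G TL2 by (auto simp: B_def)
    let ?v = "\<lambda>y. T f y - T g y"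
    have v: "?v \<in> L2 N" using L by (rule L2_diff)
    have "L2_norm N (\<lambda>y. T f y - L2_proj N E (T f) y)
       = L2_norm N (\<lambda>y. (?v y - L2_proj N E ?v y) + (T g y - L2_proj N E (T g) y))"
      unfolding L2_proj_diff[OF EL2 L] by simp
    also have "\<dots> \<le> L2_norm N (\<lambda>y. ?v y - L2_proj N E ?v y) + L2_norm N (\<lambda>y. T g y - L2_proj N E (T g) y)"
      by (rule L2_norm_triangle[OF L2_diff[OF v L2_proj_L2[OF EL2]] L2_diff[OF L(2) L2_proj_L2[OF EL2]]])
    also have "\<dots> \<le> \<epsilon>"
      using L2_norm_minus_proj_le[OF E v] g(2) EG[OF g(1)] by linarith
    finally show ?thesis .
  qed
  have "L2_norm N (\<lambda>y. T f y - L2_proj N E (T f) y) \<le> \<epsilon> * L2_norm M f" if f: "f \<in> L2 M" for f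
  \<comment> \<open>Homogeneity needs a nonzero norm to divide by. For norm 0, boundedness gives
    \<open>T f\<close> norm 0, and so has the residual.\<close>
  proof (cases "L2_norm M f = 0")
    case True
    obtain C where "L2_norm N (T f) \<le> C * L2_norm M f"
      using bT f unfolding bounded_L2_operator_def by blast
    then show ?thesis using L2_norm_minus_proj_le[OF E TL2[OF f]] True by simp
  next
    case False
    define s where "s = complex_of_real (1 / L2_norm M f)"
    have pos: "0 < L2_norm M f" using False L2_norm_nonneg[of M f] by linarith
    have norm_s: "norm s = 1 / L2_norm M f" using pos by (simp add: s_def norm_divide)
    define h where "h = (\<lambda>x. s * f x)"
    have h: "h \<in> L2 M" unfolding h_def using f by (rule L2_scale)
    have "L2_norm M h = 1" unfolding h_def L2_norm_scale norm_s using pos by simp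
    then have "h \<in> B" using h unfolding B_def by simp
    have ae: "AE y in N. T h y = s * T f y"
      unfolding h_def using bT f by (rule bounded_L2_operator_scale)
    have sT: "(\<lambda>y. s * T f y) \<in> L2 N" using TL2[OF f] by (rule L2_scale)
    have Ph: "L2_proj N E (T h) = (\<lambda>y. s * L2_proj N E (T f) y)"
      using L2_proj_cong_AE[OF EL2 TL2[OF h] sT ae]
        L2_proj_lincomb[OF EL2 TL2[OF f] TL2[OF f], of s 0] by simp
    have "L2_norm N (\<lambda>y. T h y - L2_proj N E (T h) y)
        = L2_norm N (\<lambda>y. s * (T f y - L2_proj N E (T f) y))"
    proof (rule L2_norm_cong_AE)
      show "AE y in N. T h y - L2_proj N E (T h) y = s * (T f y - L2_proj N E (T f) y)"
        using ae unfolding Ph by eventually_elim (simp add: right_diff_distrib)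
      show "(\<lambda>y. T h y - L2_proj N E (T h) y) \<in> borel_measurable N"
        by (rule L2_measurable[OF L2_diff[OF TL2[OF h] L2_proj_L2[OF EL2]]])
      show "(\<lambda>y. s * (T f y - L2_proj N E (T f) y)) \<in> borel_measurable N"
        by (rule L2_measurable[OF L2_scale[OF L2_diff[OF TL2[OF f] L2_proj_L2[OF EL2]]]])
    qed
    also have "\<dots> = L2_norm N (\<lambda>y. T f y - L2_proj N E (T f) y) / L2_norm M f"
      unfolding L2_norm_scale norm_s by simp
    finally show ?thesis
      using unit[OF \<open>h \<in> B\<close>] pos by (simp add: pos_divide_le_eq)
  qed
  with E that show ?thesis by blast
qed

text \<open>The union of the sets \<open>E k\<close> is countable and the images are bounded, so a
  diagonal subsequence has convergent coefficients against all its elements. Finitely many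
  coefficients control the part of finite rank, and the approximation error controls the
  rest.\<close>

lemma finite_rank_approx_imp_compact_L2_operator:
  assumes T: "bounded_L2_operator M N T"
    and approx: "\<And>\<epsilon>. 0 < \<epsilon> \<Longrightarrow> \<exists>E. finite E \<and> E \<subseteq> L2 N \<and>
      (\<forall>f\<in>L2 M. L2_norm N (\<lambda>y. T f y - L2_proj N E (T f) y) \<le> \<epsilon> * L2_norm M f)"
  shows "compact_L2_operator M N T"
  unfolding compact_L2_operator_def
proof (intro conjI allI impI T)
  fix F :: "nat \<Rightarrow> 'a \<Rightarrow> complex"
  assume "(\<forall>n. F n \<in> L2 M) \<and> (\<exists>B. \<forall>n. L2_norm M (F n) \<le> B)"
  then obtain B0 where F: "\<And>n. F n \<in> L2 M" and B0: "\<And>n. L2_norm M (F n) \<le> B0" by blast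
  define B where "B = max B0 1"
  have B: "L2_norm M (F n) \<le> B" "0 < B" for n using B0[of n] by (auto simp: B_def)
  have TF: "T (F n) \<in> L2 N" for n using T F by (rule bounded_L2_operator_L2)
  obtain C where C: "0 < C" "\<And>f. f \<in> L2 M \<Longrightarrow> L2_norm N (T f) \<le> C * L2_norm M f"
    using T by (rule bounded_L2_operator_bound) blast
  have TFB: "L2_norm N (T (F n)) \<le> C * B" for n
    using C(2)[OF F[of n]] mult_left_mono[OF B(1)[of n], of C] C(1) by linarith
  have "\<forall>k::nat. \<exists>E. finite E \<and> E \<subseteq> L2 N \<and>
      (\<forall>f\<in>L2 M. L2_norm N (\<lambda>y. T f y - L2_proj N E (T f) y) \<le> (1 / Suc k) * L2_norm M f)"
    by (intro allI approx) simp
  then obtain E where E: "\<And>k::nat. finite (E k)" "\<And>k. E k \<subseteq> L2 N"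
    "\<And>k f. f \<in> L2 M \<Longrightarrow> L2_norm N (\<lambda>y. T f y - L2_proj N (E k) (T f) y) \<le> (1 / Suc k) * L2_norm M f"
    by metis
  define P where "P k s \<longleftrightarrow> (\<forall>e\<in>E k. convergent (\<lambda>n. L2_inner N (T (F (s n))) e))"
    for k and s :: "nat \<Rightarrow> nat"
  interpret subseqs P
  proof
    fix k and s :: "nat \<Rightarrow> nat"
    have "\<exists>r. strict_mono r \<and> (\<forall>e\<in>D. convergent (\<lambda>n. L2_inner N (T (F (s (r n)))) e))"
      if "finite D" "D \<subseteq> L2 N" for D
      using that
    proof (induction D)
      case empty
      show ?case by (intro exI[of _ id]) (auto simp: strict_mono_def)
    next
      case (insert e D)
      then obtain r where r: "strict_mono r"
        "\<And>e. e \<in> D \<Longrightarrow> convergent (\<lambda>n. L2_inner N (T (F (s (r n)))) e)" by auto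
      have "norm (L2_inner N (T (F j)) e) \<le> C * B * L2_norm N e" for j
        using L2_inner_CS[OF TF, of e j] insert TFB[of j]
          mult_right_mono[OF TFB[of j], of "L2_norm N e"] by auto
      then have "bounded (range (\<lambda>n. L2_inner N (T (F (s (r n)))) e))"
        by (auto simp: bounded_iff)
      then obtain l r' where r': "strict_mono (r'::nat\<Rightarrow>nat)"
        "((\<lambda>n. L2_inner N (T (F (s (r n)))) e) \<circ> r') \<longlonglongrightarrow> l"
        using bounded_imp_convergent_subsequence by blast
      show ?case
      proof (intro exI[of _ "r \<circ> r'"] conjI ballI)
        show "strict_mono (r \<circ> r')" using r r' by (intro strict_mono_o)
        fix d assume d: "d \<in> insert e D"
        show "convergent (\<lambda>n. L2_inner N (T (F (s ((r \<circ> r') n)))) d)"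
        proof (cases "d = e")
          case True
          then show ?thesis using r'(2) by (auto simp: convergent_def o_def)
        next
          case False
          then have "convergent ((\<lambda>n. L2_inner N (T (F (s (r n)))) d) \<circ> r')"
            using d r'(1) r(2)[of d] by (intro convergent_subseq_convergent) auto
          then show ?thesis by (simp add: o_def)
        qed
      qed
    qed
    from this[OF E(1,2)[of k]] show "\<exists>r'. strict_mono r' \<and> P k (s \<circ> r')"
      by (simp add: P_def)
  qed
  have conv: "convergent (\<lambda>n. L2_inner N (T (F (diagseq n))) e)" if "e \<in> E k" for k e
  proof -
    \<comment> \<open>The diagonal sequence is a subsequence of the \<open>k\<close>-th one only
      from index \<open>Suc k\<close> on; the shift is removed afterwards because convergence
      ignores initial segments.\<close>
    have "P k (diagseq \<circ> ((+) (Suc k)))"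
    proof (rule diagseq_holds)
      fix r s :: "nat \<Rightarrow> nat" and n assume "strict_mono r" "P n s"
      then show "P n (s \<circ> r)"
        unfolding P_def using convergent_subseq_convergent[of "\<lambda>j. L2_inner N (T (F (s j))) _" r]
        by (simp add: o_def)
    qed
    then have "convergent (\<lambda>n. L2_inner N (T (F (diagseq (n + Suc k)))) e)"
      using that by (simp add: P_def add.commute)
    then show ?thesis by (subst (asm) convergent_ignore_initial_segment)
  qed
  have "\<exists>K. \<forall>m\<ge>K. \<forall>n\<ge>K. L2_norm N (\<lambda>y. T (F (diagseq m)) y - T (F (diagseq n)) y) \<le> e"
    if e: "0 < e" for e
  proof -
    \<comment> \<open>Differences of sequence members have norm at most \<open>2 * B\<close>; this
      \<open>k\<close> makes the approximation error on them at most \<open>e / 2\<close>.\<close>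
    obtain k where k: "4 * B / e < real k" using reals_Archimedean2 by blast
    have kk: "1 / real (Suc k) * (2 * B) \<le> e / 2"
      using k e B(2) by (simp add: field_simps)
    \<comment> \<open>Coefficient differences below \<open>e / (2 * W)\<close>, weighted by the
      norms of the elements of \<open>E k\<close>, add up to at most \<open>e / 2\<close>. The
      summand 1 keeps \<open>W\<close> positive when there are no such elements or all have norm
      0.\<close>
    define W where "W = 1 + (\<Sum>d\<in>E k. L2_norm N d)"
    have W: "0 < W" unfolding W_def by (intro add_pos_nonneg sum_nonneg) auto
    have "\<exists>K. \<forall>d\<in>D. \<forall>m\<ge>K. \<forall>n\<ge>K. norm (L2_inner N (T (F (diagseq m))) d - L2_inner N (T (F (diagseq n))) d) < e / (2 * W)"
      if "finite D" "D \<subseteq> E k" for D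
      using that
    proof (induction D)
      case (insert d D)
      then obtain K1 where K1: "\<forall>d\<in>D. \<forall>m\<ge>K1. \<forall>n\<ge>K1. norm (L2_inner N (T (F (diagseq m))) d - L2_inner N (T (F (diagseq n))) d) < e / (2 * W)"
        by auto
      have "Cauchy (\<lambda>n. L2_inner N (T (F (diagseq n))) d)"
        using conv[of d k] insert by (intro convergent_Cauchy) auto
      then obtain K2 where K2: "\<forall>m\<ge>K2. \<forall>n\<ge>K2. norm (L2_inner N (T (F (diagseq m))) d - L2_inner N (T (F (diagseq n))) d) < e / (2 * W)"
        using e W unfolding Cauchy_iff by (meson divide_pos_pos mult_pos_pos zero_less_numeral)
      show ?case using K1 K2 by (intro exI[of _ "max K1 K2"]) auto
    qed auto
    from this[OF E(1) order_refl] obtain K where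
      K: "\<And>d m n. d \<in> E k \<Longrightarrow> m \<ge> K \<Longrightarrow> n \<ge> K \<Longrightarrow>
        norm (L2_inner N (T (F (diagseq m))) d - L2_inner N (T (F (diagseq n))) d) < e / (2 * W)"
      by blast
    have "L2_norm N (\<lambda>y. T (F (diagseq m)) y - T (F (diagseq n)) y) \<le> e" if mn: "m \<ge> K" "n \<ge> K" for m n
    proof -
      let ?f = "F (diagseq m)" and ?g = "F (diagseq n)"
      let ?h = "\<lambda>x. ?f x - ?g x"
      let ?v = "\<lambda>y. T ?f y - T ?g y"
      have hL2: "?h \<in> L2 M" by (intro L2_diff F)
      have vL2: "?v \<in> L2 N" by (intro L2_diff TF)
      have ae: "AE y in N. T ?h y = ?v y"
        using bounded_L2_operator_lincomb[OF T F F, of 1 "diagseq m" "-1" "diagseq n"] by simp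
      have "L2_norm N (\<lambda>y. ?v y - L2_proj N (E k) ?v y) = L2_norm N (\<lambda>y. T ?h y - L2_proj N (E k) (T ?h) y)"
        unfolding L2_proj_cong_AE[OF E(2) bounded_L2_operator_L2[OF T hL2] vL2 ae]
        using ae by (intro L2_norm_cong_AE L2_measurable L2_diff TF L2_proj_L2 E bounded_L2_operator_L2[OF T] F) auto
      also have "\<dots> \<le> (1 / real (Suc k)) * L2_norm M ?h" by (intro E hL2)
      also have "\<dots> \<le> (1 / real (Suc k)) * (2 * B)"
      proof (intro mult_left_mono)
        have "L2_norm M ?h \<le> L2_norm M ?f + L2_norm M (\<lambda>x. - 1 * ?g x)"
          using L2_norm_triangle[OF F L2_scale[OF F], of "diagseq m" "-1" "diagseq n"] by simp
        then show "L2_norm M ?h \<le> 2 * B"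
          unfolding L2_norm_scale using B(1)[of "diagseq m"] B(1)[of "diagseq n"] by simp
      qed simp
      finally have 1: "L2_norm N (\<lambda>y. ?v y - L2_proj N (E k) ?v y) \<le> e / 2" using kk by simp
      have "L2_norm N (L2_proj N (E k) ?v) \<le> (\<Sum>d\<in>E k. L2_norm N (\<lambda>y. L2_inner N ?v d * d y))"
        unfolding L2_proj_def using E(2) by (intro L2_norm_sum L2_scale) auto
      also have "\<dots> \<le> (\<Sum>d\<in>E k. (e / (2 * W)) * L2_norm N d)"
      proof (rule sum_mono)
        fix d assume d: "d \<in> E k"
        then have "d \<in> L2 N" using E(2) by auto
        then have "L2_inner N ?v d = L2_inner N (T ?f) d - L2_inner N (T ?g) d"
          by (intro L2_inner_diff_left TF)
        then show "L2_norm N (\<lambda>y. L2_inner N ?v d * d y) \<le> (e / (2 * W)) * L2_norm N d"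
          unfolding L2_norm_scale using K[OF d mn] by (intro mult_right_mono) auto
      qed
      also have "\<dots> \<le> (e / (2 * W)) * W"
        unfolding sum_distrib_left[symmetric] using e W by (intro mult_left_mono) (auto simp: W_def)
      also have "\<dots> = e / 2" using W by simp
      finally have 2: "L2_norm N (L2_proj N (E k) ?v) \<le> e / 2" .
      show ?thesis
        using L2_norm_le_diff_add[OF vL2 L2_proj_L2[OF E(2)], of k ?v] 1 2 by simp
    qed
    then show ?thesis by blast
  qed
  then obtain g where "g \<in> L2 N" "(\<lambda>n. L2_norm N (\<lambda>y. T (F (diagseq n)) y - g y)) \<longlonglongrightarrow> 0"
    using L2_complete[of "\<lambda>n. T (F (diagseq n))" N] TF by blast
  then show "\<exists>r. \<exists>g\<in>L2 N. strict_mono r \<and> (\<lambda>n. L2_norm N (\<lambda>y. T (F (r n)) y - g y)) \<longlonglongrightarrow> 0"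
    using subseq_diagseq by blast
qed

text \<open>The hypothesis \<open>dom\<close> says that \<open>S\<close> is bounded by \<open>T \<circ> J\<close>, so Cauchy sequences in the image
  of \<open>T\<close> are transported to Cauchy sequences in the image of \<open>S\<close>.\<close>

lemma compact_L2_operator_dominated:
  assumes T: "compact_L2_operator M N T" and S: "bounded_L2_operator M' N' S"
    and J: "\<And>f. f \<in> L2 M' \<Longrightarrow> J f \<in> L2 M" "\<And>f. f \<in> L2 M' \<Longrightarrow> L2_norm M (J f) \<le> c * L2_norm M' f"
    and Jdiff: "\<And>f g. J (\<lambda>x. f x - g x) = (\<lambda>x. J f x - J g x)"
    and dom: "\<And>f. f \<in> L2 M' \<Longrightarrow> L2_norm N' (S f) \<le> C * L2_norm N (T (J f))"
  shows "compact_L2_operator M' N' S"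
  unfolding compact_L2_operator_def
proof (intro conjI allI impI S)
  fix F :: "nat \<Rightarrow> 'c \<Rightarrow> complex"
  assume "(\<forall>n. F n \<in> L2 M') \<and> (\<exists>B. \<forall>n. L2_norm M' (F n) \<le> B)"
  then obtain B where F: "\<And>n. F n \<in> L2 M'" and B: "\<And>n. L2_norm M' (F n) \<le> B" by blast
  have bT: "bounded_L2_operator M N T" using T by (simp add: compact_L2_operator_def)
  have "L2_norm M (J (F n)) \<le> \<bar>c\<bar> * B" for n
  proof -
    have "L2_norm M (J (F n)) \<le> c * L2_norm M' (F n)" using F by (rule J)
    also have "\<dots> \<le> \<bar>c\<bar> * L2_norm M' (F n)" by (intro mult_right_mono) auto
    also have "\<dots> \<le> \<bar>c\<bar> * B" by (intro mult_left_mono B) auto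
    finally show ?thesis .
  qed
  then have "(\<forall>n. J (F n) \<in> L2 M) \<and> (\<exists>B. \<forall>n. L2_norm M (J (F n)) \<le> B)"
    using J(1) F by blast
  then obtain r g where r: "strict_mono r" "g \<in> L2 N"
      "(\<lambda>n. L2_norm N (\<lambda>y. T (J (F (r n))) y - g y)) \<longlonglongrightarrow> 0"
    using T[unfolded compact_L2_operator_def, THEN conjunct2, rule_format, of "\<lambda>n. J (F n)"] by auto
  have TJ: "T (J (F n)) \<in> L2 N" for n by (intro bounded_L2_operator_L2[OF bT] J F)
  have "\<exists>K. \<forall>m\<ge>K. \<forall>n\<ge>K. L2_norm N' (\<lambda>y. S (F (r m)) y - S (F (r n)) y) \<le> e"
    if e: "0 < e" for e
  proof -
    \<comment> \<open>Nothing is assumed about the sign of \<open>C\<close>, so its absolute value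
      plus 1 serves as a positive denominator.\<close>
    have "0 < e / (2 * (\<bar>C\<bar> + 1))" using e by simp
    then obtain K where K: "\<And>n. n \<ge> K \<Longrightarrow> L2_norm N (\<lambda>y. T (J (F (r n))) y - g y) < e / (2 * (\<bar>C\<bar> + 1))"
      using LIMSEQ_D[OF r(3)] by auto
    have "L2_norm N' (\<lambda>y. S (F (r m)) y - S (F (r n)) y) \<le> e" if mn: "m \<ge> K" "n \<ge> K" for m n
    proof -
      have "L2_norm N' (\<lambda>y. S (F (r m)) y - S (F (r n)) y) = L2_norm N' (S (\<lambda>x. F (r m) x - F (r n) x))"
        by (rule bounded_L2_operator_diff_norm[OF S F F])
      also have "\<dots> \<le> C * L2_norm N (T (J (\<lambda>x. F (r m) x - F (r n) x)))"
        by (intro dom L2_diff F)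
      also have "\<dots> = C * L2_norm N (\<lambda>y. T (J (F (r m))) y - T (J (F (r n))) y)"
        unfolding Jdiff by (subst bounded_L2_operator_diff_norm[OF bT J(1)[OF F] J(1)[OF F]]) simp
      also have "\<dots> \<le> (\<bar>C\<bar> + 1) * L2_norm N (\<lambda>y. T (J (F (r m))) y - T (J (F (r n))) y)"
        by (intro mult_right_mono) auto
      also have "\<dots> \<le> (\<bar>C\<bar> + 1) * (e / (\<bar>C\<bar> + 1))"
      proof (intro mult_left_mono)
        have "L2_norm N (\<lambda>y. T (J (F (r m))) y - T (J (F (r n))) y)
          \<le> L2_norm N (\<lambda>y. T (J (F (r m))) y - g y) + L2_norm N (\<lambda>y. g y - T (J (F (r n))) y)"
          by (intro L2_norm_triangle_diff TJ r)
        also have "\<dots> \<le> e / (\<bar>C\<bar> + 1)"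
          using K[OF mn(1)] K[OF mn(2)] L2_norm_minus_commute[of N g "T (J (F (r n)))"] by (simp add: field_simps)
        finally show "L2_norm N (\<lambda>y. T (J (F (r m))) y - T (J (F (r n))) y) \<le> e / (\<bar>C\<bar> + 1)" .
      qed auto
      finally show ?thesis by simp
    qed
    then show ?thesis by blast
  qed
  then obtain h where "h \<in> L2 N'" "(\<lambda>n. L2_norm N' (\<lambda>y. S (F (r n)) y - h y)) \<longlonglongrightarrow> 0"
    using L2_complete[of "\<lambda>n. S (F (r n))" N'] bounded_L2_operator_L2[OF S F] by blast
  with r show "\<exists>r. \<exists>g\<in>L2 N'. strict_mono r \<and> (\<lambda>n. L2_norm N' (\<lambda>y. S (F (r n)) y - g y)) \<longlonglongrightarrow> 0"
    by blast
qed

section \<open>Complex measures and their densities\<close>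

lemma complex_measure_empty: "complex_measure M \<sigma> \<Longrightarrow> \<sigma> {} = 0"
  by (simp add: complex_measure_def)

lemma complex_measure_sums:
  "complex_measure M \<sigma> \<Longrightarrow> range A \<subseteq> sets M \<Longrightarrow> disjoint_family A \<Longrightarrow> (\<lambda>i. \<sigma> (A i)) sums \<sigma> (\<Union>i. A i)"
  by (simp add: complex_measure_def)

lemma complex_measure_Un:
  assumes "complex_measure M \<sigma>" "A \<in> sets M" "B \<in> sets M" "A \<inter> B = {}"
  shows "\<sigma> (A \<union> B) = \<sigma> A + \<sigma> B"
proof -
  have "(\<lambda>i. \<sigma> (binaryset A B i)) sums \<sigma> (\<Union>i. binaryset A B i)"
    using assms by (intro complex_measure_sums[of M])
      (auto simp: range_binaryset_eq disjoint_family_on_def binaryset_def)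
  moreover have "(\<lambda>i. \<sigma> (binaryset A B i)) sums (\<sigma> A + \<sigma> B)"
    using assms by (intro binaryset_sums complex_measure_empty)
  ultimately show ?thesis
    by (simp add: UN_binaryset_eq sums_unique2)
qed

text \<open>\<open>measure_of\<close> returns the set function it is given only if that function is
  a measure. Naming the supremum allows its countable additivity to be proved before
  \<open>variation\<close> is evaluated.\<close>

definition var_sum :: "'a measure \<Rightarrow> ('a set \<Rightarrow> complex) \<Rightarrow> 'a set \<Rightarrow> ennreal" where
  "var_sum M \<sigma> E = (SUP P\<in>{P. finite P \<and> disjoint P \<and> P \<subseteq> sets M \<and> \<Union>P = E}. \<Sum>A\<in>P. ennreal (norm (\<sigma> A)))"

lemma sets_variation [simp, measurable_cong]: "sets (variation M \<sigma>) = sets M"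
  by (simp add: variation_def)

lemma space_variation [simp]: "space (variation M \<sigma>) = space M"
  by (simp add: variation_def)

lemma var_sum_upper:
  "finite P \<Longrightarrow> disjoint P \<Longrightarrow> P \<subseteq> sets M \<Longrightarrow> \<Union>P = E \<Longrightarrow> (\<Sum>A\<in>P. ennreal (norm (\<sigma> A))) \<le> var_sum M \<sigma> E"
  unfolding var_sum_def by (rule SUP_upper) auto

lemma var_sum_least:
  "(\<And>P. finite P \<Longrightarrow> disjoint P \<Longrightarrow> P \<subseteq> sets M \<Longrightarrow> \<Union>P = E \<Longrightarrow> (\<Sum>A\<in>P. ennreal (norm (\<sigma> A))) \<le> c)
   \<Longrightarrow> var_sum M \<sigma> E \<le> c"
  unfolding var_sum_def by (rule SUP_least) auto

text \<open>Partitions of \<open>A\<close> and of \<open>B\<close> join to a partition of the union.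
  They can share at most the empty set, which carries no mass, so the two sums add up exactly; the
  suprema are then taken one at a time.\<close>

lemma var_sum_superadditive:
  assumes \<sigma>: "complex_measure M \<sigma>" and A: "A \<in> sets M" and B: "B \<in> sets M" and AB: "A \<inter> B = {}"
  shows "var_sum M \<sigma> A + var_sum M \<sigma> B \<le> var_sum M \<sigma> (A \<union> B)"
proof -
  let ?S = "\<lambda>P. \<Sum>A\<in>P. ennreal (norm (\<sigma> A))"
  let ?Part = "\<lambda>E. {P. finite P \<and> disjoint P \<and> P \<subseteq> sets M \<and> \<Union>P = E}"
  have ne: "?Part E \<noteq> {}" if "E \<in> sets M" for E
    using that by (intro ex_in_conv[THEN iffD1] exI[of _ "{E}"]) (simp add: disjoint_def)
  have step: "?S P + ?S Q \<le> var_sum M \<sigma> (A \<union> B)" if "P \<in> ?Part A" "Q \<in> ?Part B" for P Q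
  proof -
    have PQ: "P \<inter> Q \<subseteq> {{}}" using that AB by blast
    have "?S P + ?S Q = ?S (P \<union> Q) + ?S (P \<inter> Q)"
      using that by (intro sum.union_inter[symmetric]) auto
    also have "?S (P \<inter> Q) = 0"
      using PQ complex_measure_empty[OF \<sigma>] by (intro sum.neutral) auto
    also have "?S (P \<union> Q) \<le> var_sum M \<sigma> (A \<union> B)"
    proof (rule var_sum_upper)
      show "disjoint (P \<union> Q)" using that AB unfolding disjoint_def by blast
    qed (use that in auto)
    finally show ?thesis by simp
  qed
  have "var_sum M \<sigma> A + var_sum M \<sigma> B = (SUP P\<in>?Part A. ?S P + var_sum M \<sigma> B)"
    unfolding var_sum_def[of M \<sigma> A] using ne[OF A] by (rule ennreal_SUP_add_left[symmetric])
  also have "\<dots> \<le> var_sum M \<sigma> (A \<union> B)"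
  proof (rule SUP_least)
    fix P assume P: "P \<in> ?Part A"
    have "?S P + var_sum M \<sigma> B = (SUP Q\<in>?Part B. ?S P + ?S Q)"
      unfolding var_sum_def[of M \<sigma> B] using ne[OF B] by (rule ennreal_SUP_add_right)
    also have "\<dots> \<le> var_sum M \<sigma> (A \<union> B)"
      by (intro SUP_least step P)
    finally show "?S P + var_sum M \<sigma> B \<le> var_sum M \<sigma> (A \<union> B)" .
  qed
  finally show ?thesis .
qed

text \<open>One half of countable additivity is superadditivity on finite unions. For the other half
  each piece of a partition is cut along the sets \<open>A i\<close>: additivity of
  \<open>\<sigma>\<close> and the triangle inequality bound its mass by the masses of the cuts, and
  the two sums are exchanged.\<close>

lemma emeasure_variation:
  assumes \<sigma>: "complex_measure M \<sigma>" and E: "E \<in> sets M"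
  shows "emeasure (variation M \<sigma>) E = var_sum M \<sigma> E"
proof -
  have empty: "var_sum M \<sigma> {} = 0"
  proof -
    have "var_sum M \<sigma> {} \<le> 0"
    proof (rule var_sum_least)
      fix P :: "'a set set" assume "\<Union>P = {}"
      then have P: "A = {}" if "A \<in> P" for A using that by blast
      have "(\<Sum>A\<in>P. ennreal (norm (\<sigma> A))) = 0"
        by (rule sum.neutral) (auto dest!: P simp: complex_measure_empty[OF \<sigma>])
      then show "(\<Sum>A\<in>P. ennreal (norm (\<sigma> A))) \<le> 0" by simp
    qed
    then show ?thesis by simp
  qed
  have ca: "countably_additive (sets M) (var_sum M \<sigma>)"
    unfolding countably_additive_def
  proof (intro allI impI)
    fix A :: "nat \<Rightarrow> 'a set"
    assume A: "range A \<subseteq> sets M" "disjoint_family A" and UA: "(\<Union>i. A i) \<in> sets M"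
    have Ai: "A i \<in> sets M" for i using A by auto
    have dj: "A i \<inter> A j = {}" if "i \<noteq> j" for i j
      using A(2) that by (auto simp: disjoint_family_on_def)
    have mono: "var_sum M \<sigma> C \<le> var_sum M \<sigma> D" if "C \<in> sets M" "D \<in> sets M" "C \<subseteq> D" for C D
    proof -
      have "var_sum M \<sigma> C \<le> var_sum M \<sigma> C + var_sum M \<sigma> (D - C)" by simp
      also have "\<dots> \<le> var_sum M \<sigma> (C \<union> (D - C))"
        using that by (intro var_sum_superadditive \<sigma>) auto
      also have "C \<union> (D - C) = D" using that by auto
      finally show ?thesis .
    qed
    have fin: "(\<Sum>i<n. var_sum M \<sigma> (A i)) \<le> var_sum M \<sigma> (\<Union>i<n. A i)" for n
    proof (induction n)
      case (Suc n)
      have "(\<Sum>i<Suc n. var_sum M \<sigma> (A i)) \<le> var_sum M \<sigma> (\<Union>i<n. A i) + var_sum M \<sigma> (A n)"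
        using Suc by (simp add: add_right_mono)
      also have "\<dots> \<le> var_sum M \<sigma> ((\<Union>i<n. A i) \<union> A n)"
      proof (intro var_sum_superadditive \<sigma> Ai equals0I)
        fix x assume "x \<in> (\<Union>i<n. A i) \<inter> A n"
        then obtain i where "i < n" "x \<in> A i \<inter> A n" by auto
        then show False using dj[of i n] by auto
      qed (use Ai in auto)
      finally show ?case by (simp add: lessThan_Suc Un_commute)
    qed simp
    have "(\<Sum>i. var_sum M \<sigma> (A i)) \<le> var_sum M \<sigma> (\<Union>i. A i)"
    proof (rule suminf_le_const)
      show "(\<Sum>i<n. var_sum M \<sigma> (A i)) \<le> var_sum M \<sigma> (\<Union>i. A i)" for n
        by (rule order_trans[OF fin mono]) (use Ai UA in auto)
    qed simp
    moreover have "var_sum M \<sigma> (\<Union>i. A i) \<le> (\<Sum>i. var_sum M \<sigma> (A i))"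
    proof (rule var_sum_least)
      fix P assume P: "finite P" "disjoint P" "P \<subseteq> sets M" "\<Union>P = (\<Union>i. A i)"
      have "(\<Sum>B\<in>P. ennreal (norm (\<sigma> B))) \<le> (\<Sum>B\<in>P. \<Sum>i. ennreal (norm (\<sigma> (B \<inter> A i))))"
      proof (rule sum_mono)
        fix B assume B: "B \<in> P"
        have "(\<lambda>i. \<sigma> (B \<inter> A i)) sums \<sigma> (\<Union>i. B \<inter> A i)"
          using B P(3) Ai dj by (intro complex_measure_sums[OF \<sigma>]) (auto simp: disjoint_family_on_def, blast)
        also have "(\<Union>i. B \<inter> A i) = B" using B P(4) by blast
        finally have s: "(\<lambda>i. \<sigma> (B \<inter> A i)) sums \<sigma> B" .
        have lim: "(\<lambda>n. ennreal (norm (\<Sum>i<n. \<sigma> (B \<inter> A i)))) \<longlonglongrightarrow> ennreal (norm (\<sigma> B))"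
          using s by (intro tendsto_ennrealI tendsto_norm) (simp add: sums_def)
        show "ennreal (norm (\<sigma> B)) \<le> (\<Sum>i. ennreal (norm (\<sigma> (B \<inter> A i))))"
        proof (rule LIMSEQ_le_const2[OF lim], intro exI allI impI)
          fix n
          have "ennreal (norm (\<Sum>i<n. \<sigma> (B \<inter> A i))) \<le> ennreal (\<Sum>i<n. norm (\<sigma> (B \<inter> A i)))"
            by (intro ennreal_leI norm_sum)
          also have "\<dots> = (\<Sum>i<n. ennreal (norm (\<sigma> (B \<inter> A i))))" by simp
          also have "\<dots> \<le> (\<Sum>i. ennreal (norm (\<sigma> (B \<inter> A i))))" by (intro sum_le_suminf) auto
          finally show "ennreal (norm (\<Sum>i<n. \<sigma> (B \<inter> A i))) \<le> (\<Sum>i. ennreal (norm (\<sigma> (B \<inter> A i))))" .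
        qed
      qed
      also have "\<dots> = (\<Sum>i. \<Sum>B\<in>P. ennreal (norm (\<sigma> (B \<inter> A i))))"
        by (intro suminf_sum[symmetric]) auto
      also have "\<dots> \<le> (\<Sum>i. var_sum M \<sigma> (A i))"
      proof (intro suminf_le)
        fix i
        \<comment> \<open>Distinct pieces may have the same trace on \<open>A i\<close>, but by
          disjointness only the empty one, so reindexing loses nothing.\<close>
        let ?Q = "(\<lambda>B. B \<inter> A i) ` P"
        have "(\<Sum>B\<in>P. ennreal (norm (\<sigma> (B \<inter> A i)))) = (\<Sum>C\<in>?Q. ennreal (norm (\<sigma> C)))"
        proof (rule sum.reindex_nontrivial[OF P(1), symmetric, unfolded o_def])
          fix B C assume "B \<in> P" "C \<in> P" "B \<noteq> C" "B \<inter> A i = C \<inter> A i"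
          then have "B \<inter> A i = {}" using P(2) by (auto simp: disjoint_def)
          then show "ennreal (norm (\<sigma> (B \<inter> A i))) = 0" using complex_measure_empty[OF \<sigma>] by simp
        qed
        also have "\<dots> \<le> var_sum M \<sigma> (A i)"
        proof (rule var_sum_upper)
          show "disjoint ?Q" using P(2) unfolding disjoint_def by blast
          show "\<Union>?Q = A i" using P(4) by blast
          show "?Q \<subseteq> sets M" using P(3) Ai by blast
        qed (use P(1) in simp)
        finally show "(\<Sum>B\<in>P. ennreal (norm (\<sigma> (B \<inter> A i)))) \<le> var_sum M \<sigma> (A i)" .
      qed auto
      finally show "(\<Sum>B\<in>P. ennreal (norm (\<sigma> B))) \<le> (\<Sum>i. var_sum M \<sigma> (A i))" .
    qed
    ultimately show "(\<Sum>i. var_sum M \<sigma> (A i)) = var_sum M \<sigma> (\<Union>i. A i)"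
      by (rule antisym)
  qed
  show ?thesis
  proof (rule emeasure_measure_of)
    show "variation M \<sigma> = measure_of (space M) (sets M) (var_sum M \<sigma>)"
      by (simp add: variation_def var_sum_def[abs_def])
    show "sets M \<subseteq> Pow (space M)" by (rule sets.space_closed)
    show "positive (sets (variation M \<sigma>)) (var_sum M \<sigma>)"
      by (simp add: positive_def empty)
    show "countably_additive (sets (variation M \<sigma>)) (var_sum M \<sigma>)"
      using ca by simp
  qed (use E in simp)
qed

lemma norm_le_variation:
  assumes "complex_measure M \<sigma>" "E \<in> sets M"
  shows "ennreal (norm (\<sigma> E)) \<le> emeasure (variation M \<sigma>) E"
  using var_sum_upper[of "{E}" M E \<sigma>] assms by (simp add: emeasure_variation disjoint_def)

text \<open>Domination on single sets adds up over any finite partition. This minimality yields the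
  upper bounds for the variations of projected measures and of measures given by densities.\<close>

lemma variation_least:
  assumes \<sigma>: "complex_measure M \<sigma>" and E: "E \<in> sets M" and \<mu>: "sets \<mu> = sets M"
    and le: "\<And>A. A \<in> sets M \<Longrightarrow> ennreal (norm (\<sigma> A)) \<le> emeasure \<mu> A"
  shows "emeasure (variation M \<sigma>) E \<le> emeasure \<mu> E"
  unfolding emeasure_variation[OF \<sigma> E]
proof (rule var_sum_least)
  fix P assume P: "finite P" "disjoint P" "P \<subseteq> sets M" "\<Union>P = E"
  have "(\<Sum>A\<in>P. ennreal (norm (\<sigma> A))) \<le> (\<Sum>A\<in>P. emeasure \<mu> A)"
    using P by (intro sum_mono le) auto
  also have "\<dots> = emeasure \<mu> (\<Union>A\<in>P. A)"
    using P \<mu> by (intro sum_emeasure) (auto simp: disjoint_def disjoint_family_on_def)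
  finally show "(\<Sum>A\<in>P. ennreal (norm (\<sigma> A))) \<le> emeasure \<mu> E" using P by simp
qed

section \<open>Radon-Nikodym densities of complex measures\<close>

text \<open>Adding \<open>W\<close> makes the set function nonnegative, so it is the restriction of
  a measure absolutely continuous with respect to \<open>W\<close>. Subtracting 1 from the density
  undoes the shift.\<close>

lemma real_density_of_dominated:
  fixes \<tau> :: "'a set \<Rightarrow> real"
  assumes W: "finite_measure W"
    and sums: "\<And>A::nat \<Rightarrow> 'a set. range A \<subseteq> sets W \<Longrightarrow> disjoint_family A \<Longrightarrow> (\<lambda>i. \<tau> (A i)) sums \<tau> (\<Union>i. A i)"
    and empty: "\<tau> {} = 0"
    and dom: "\<And>E. E \<in> sets W \<Longrightarrow> \<bar>\<tau> E\<bar> \<le> measure W E"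
  obtains k where "integrable W k" "\<And>E. E \<in> sets W \<Longrightarrow> \<tau> E = (LINT z:E|W. k z)"
proof -
  interpret finite_measure W by fact
  define f where "f E = ennreal (\<tau> E + measure W E)" for E
  define N where "N = measure_of (space W) (sets W) f"
  have nn: "0 \<le> \<tau> E + measure W E" if "E \<in> sets W" for E using dom[OF that] by linarith
  have N: "emeasure N E = f E" if "E \<in> sets W" for E
    unfolding N_def
  proof (rule emeasure_measure_of[OF refl])
    show "countably_additive (sets (measure_of (space W) (sets W) f)) f"
      unfolding countably_additive_def
    proof (intro allI impI)
      fix A :: "nat \<Rightarrow> 'a set"
      assume A: "range A \<subseteq> sets (measure_of (space W) (sets W) f)" "disjoint_family A"
      then have A': "range A \<subseteq> sets W" by simp
      have "(\<lambda>i. \<tau> (A i) + measure W (A i)) sums (\<tau> (\<Union>i. A i) + measure W (\<Union>i. A i))"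
        using A A' by (intro sums_add sums finite_measure_UNION)
      then show "(\<Sum>i. f (A i)) = f (\<Union>i. A i)"
        unfolding f_def using nn A'
        by (subst suminf_ennreal2) (auto simp: sums_iff)
    qed
  qed (use that in \<open>auto simp: positive_def f_def empty sets.space_closed\<close>)
  have sN: "sets N = sets W" by (simp add: N_def)
  have "absolutely_continuous W N"
    unfolding absolutely_continuous_def
  proof
    fix E assume "E \<in> null_sets W"
    then have "E \<in> sets W" "measure W E = 0" by (auto simp: measure_def)
    then show "E \<in> null_sets N" using dom[of E] sN by (auto simp: N f_def)
  qed
  then obtain d where d: "d \<in> borel_measurable W" "density W d = N"
    using Radon_Nikodym[OF _ sN] by blast
  have fin: "(\<integral>\<^sup>+z. d z \<partial>W) < \<infinity>"
  proof -
    have "(\<integral>\<^sup>+z. d z \<partial>W) = (\<integral>\<^sup>+z. d z * indicator (space W) z \<partial>W)" by (intro nn_integral_cong) simp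
    also have "\<dots> = emeasure N (space W)" using d(1) unfolding d(2)[symmetric] by (simp add: emeasure_density)
    also have "\<dots> < \<infinity>" by (simp add: N f_def)
    finally show ?thesis .
  qed
  then have dfin: "AE z in W. d z = ennreal (enn2real (d z))"
    using nn_integral_PInf_AE[OF d(1)] by (auto elim!: eventually_mono simp: less_top)
  have int: "integrable W (\<lambda>z. enn2real (d z))"
  proof (rule integrableI_nonneg)
    show "(\<integral>\<^sup>+z. ennreal (enn2real (d z)) \<partial>W) < \<infinity>"
      using fin nn_integral_cong_AE[OF dfin] by simp
  qed (use d in auto)
  show ?thesis
  proof (rule that[of "\<lambda>z. enn2real (d z) - 1"])
    show "integrable W (\<lambda>z. enn2real (d z) - 1)" using int by simp
    fix E assume E: "E \<in> sets W"
    have i: "integrable W (\<lambda>z. enn2real (d z) * indicator E z)"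
      using integrable_mult_indicator[OF E int] by (simp add: mult.commute)
    have "ennreal (LINT z|W. enn2real (d z) * indicator E z) = (\<integral>\<^sup>+z. ennreal (enn2real (d z) * indicator E z) \<partial>W)"
      by (rule nn_integral_eq_integral[symmetric, OF i]) auto
    also have "\<dots> = (\<integral>\<^sup>+z. d z * indicator E z \<partial>W)"
      using dfin by (intro nn_integral_cong_AE) (auto elim!: eventually_mono split: split_indicator)
    also have "\<dots> = f E" using d E by (simp add: emeasure_density flip: N[OF E] d(2))
    finally have "(LINT z|W. enn2real (d z) * indicator E z) = \<tau> E + measure W E"
      using nn[OF E] by (simp add: f_def)
    moreover have "(LINT z|W. indicator E z) = measure W E"
      using sets.sets_into_space[OF E] by (simp add: Int_absorb2)
    moreover have "integrable W (\<lambda>z. indicator E z :: real)"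
      using E by (simp add: integrable_indicator_iff less_top[symmetric])
    ultimately have "(LINT z|W. enn2real (d z) * indicator E z - indicator E z) = \<tau> E"
      using i by (subst Bochner_Integration.integral_diff) auto
    then show "\<tau> E = (LINT z:E|W. enn2real (d z) - 1)"
      unfolding set_lebesgue_integral_def by (simp add: algebra_simps)
  qed
qed

theorem complex_measure_density:
  assumes \<sigma>: "complex_measure M \<sigma>" and W: "finite_measure W" and sets_W: "sets W = sets M"
    and dom: "\<And>E. E \<in> sets M \<Longrightarrow> ennreal (norm (\<sigma> E)) \<le> emeasure W E"
  obtains k where "integrable W k" "\<And>E. E \<in> sets M \<Longrightarrow> \<sigma> E = (LINT z:E|W. k z)"
proof -
  interpret finite_measure W by fact
  have dom': "norm (\<sigma> E) \<le> measure W E" if "E \<in> sets W" for E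
    using dom[of E] that sets_W by (simp add: emeasure_eq_measure)
  have s: "(\<lambda>i. Re (\<sigma> (A i))) sums Re (\<sigma> (\<Union>i. A i))" "(\<lambda>i. Im (\<sigma> (A i))) sums Im (\<sigma> (\<Union>i. A i))"
    if "range A \<subseteq> sets W" "disjoint_family A" for A :: "nat \<Rightarrow> 'a set"
    using complex_measure_sums[OF \<sigma>, of A] that sets_W by (auto intro: sums_Re sums_Im)
  have e: "Re (\<sigma> {}) = 0" "Im (\<sigma> {}) = 0" using complex_measure_empty[OF \<sigma>] by auto
  have d: "\<bar>Re (\<sigma> E)\<bar> \<le> measure W E" "\<bar>Im (\<sigma> E)\<bar> \<le> measure W E" if "E \<in> sets W" for E
    using dom'[OF that] abs_Re_le_cmod[of "\<sigma> E"] abs_Im_le_cmod[of "\<sigma> E"] by linarith+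
  obtain k1 where k1: "integrable W k1" "\<And>E. E \<in> sets W \<Longrightarrow> Re (\<sigma> E) = (LINT z:E|W. k1 z)"
    by (rule real_density_of_dominated[where \<tau>="\<lambda>E. Re (\<sigma> E)", OF W s(1) e(1) d(1)]) (assumption | rule that)+
  obtain k2 where k2: "integrable W k2" "\<And>E. E \<in> sets W \<Longrightarrow> Im (\<sigma> E) = (LINT z:E|W. k2 z)"
    by (rule real_density_of_dominated[where \<tau>="\<lambda>E. Im (\<sigma> E)", OF W s(2) e(2) d(2)]) (assumption | rule that)+
  show ?thesis
  proof (rule that[of "\<lambda>z. complex_of_real (k1 z) + \<i> * complex_of_real (k2 z)"])
    show "integrable W (\<lambda>z. complex_of_real (k1 z) + \<i> * complex_of_real (k2 z))"
      using k1(1) k2(1) by simp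
    fix E assume "E \<in> sets M"
    then have E: "E \<in> sets W" using sets_W by simp
    have i: "integrable W (\<lambda>z. indicator E z *\<^sub>R k1 z)" "integrable W (\<lambda>z. indicator E z *\<^sub>R k2 z)"
      by (intro integrable_mult_indicator E k1(1) k2(1))+
    have "(LINT z:E|W. complex_of_real (k1 z) + \<i> * complex_of_real (k2 z))
      = (LINT z|W. complex_of_real (indicator E z *\<^sub>R k1 z) + \<i> * complex_of_real (indicator E z *\<^sub>R k2 z))"
      unfolding set_lebesgue_integral_def by (intro Bochner_Integration.integral_cong) (auto simp: algebra_simps scaleR_conv_of_real)
    also have "\<dots> = complex_of_real (LINT z|W. indicator E z *\<^sub>R k1 z) + \<i> * complex_of_real (LINT z|W. indicator E z *\<^sub>R k2 z)"
    proof (subst Bochner_Integration.integral_add)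
      show "integrable W (\<lambda>z. complex_of_real (indicator E z *\<^sub>R k1 z))"
        using i(1) by (rule integrable_of_real)
      show "integrable W (\<lambda>z. \<i> * complex_of_real (indicator E z *\<^sub>R k2 z))"
        using i(2) by (intro integrable_mult_right integrable_of_real)
    qed (simp only: integral_complex_of_real integral_mult_right_zero)
    also have "\<dots> = \<sigma> E"
      using k1(2)[OF E] k2(2)[OF E] by (simp add: set_lebesgue_integral_def complex_eq_iff)
    finally show "\<sigma> E = (LINT z:E|W. complex_of_real (k1 z) + \<i> * complex_of_real (k2 z))" by simp
  qed
qed

text \<open>The hypothesis places all averages of \<open>k\<close> over sets of positive measure in
  the closed ball of radius \<open>c\<close>, so the averaging theorem places almost all values
  there.\<close>

lemma density_norm_le:
  fixes k :: "'a \<Rightarrow> complex"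
  assumes W: "finite_measure W" and k: "integrable W k" and "0 \<le> c"
    and dom: "\<And>E. E \<in> sets W \<Longrightarrow> norm (LINT z:E|W. k z) \<le> c * measure W E"
  shows "AE z in W. norm (k z) \<le> c"
proof -
  have "AE z in W. k z \<in> cball 0 c"
  proof (rule sigma_finite_measure.averaging_theorem[OF _ k])
    show "sigma_finite_measure W" by (rule finite_measure.axioms(1)[OF W])
    fix A assume A: "A \<in> sets W" "0 < measure W A"
    then show "(1 / measure W A) *\<^sub>R (LINT z:A|W. k z) \<in> cball 0 c"
      using dom[OF A(1)] by (simp add: divide_le_eq)
  qed simp
  then show ?thesis by simp
qed

text \<open>The choice in \<open>polar_density\<close> is legitimate because the variation itself
  dominates \<open>\<sigma>\<close>. The bound by 1 turns multiplication by the density into a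
  contraction on the square integrable functions.\<close>

lemma
  assumes \<sigma>: "complex_measure M \<sigma>" and fin: "emeasure (variation M \<sigma>) (space M) < \<infinity>"
  shows finite_measure_variation: "finite_measure (variation M \<sigma>)"
    and polar_density_integrable: "integrable (variation M \<sigma>) (polar_density M \<sigma>)"
    and polar_density_eq: "\<And>E. E \<in> sets M \<Longrightarrow> \<sigma> E = (LINT z:E|variation M \<sigma>. polar_density M \<sigma> z)"
    and polar_density_bound: "AE z in variation M \<sigma>. norm (polar_density M \<sigma> z) \<le> 1"
proof -
  show fm: "finite_measure (variation M \<sigma>)" using fin by (intro finite_measureI) auto
  then interpret finite_measure "variation M \<sigma>" .
  obtain k where "integrable (variation M \<sigma>) k" "\<And>E. E \<in> sets M \<Longrightarrow> \<sigma> E = (LINT z:E|variation M \<sigma>. k z)"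
    using complex_measure_density[OF \<sigma> fm sets_variation norm_le_variation[OF \<sigma>]] by blast
  then have "\<exists>h. integrable (variation M \<sigma>) h \<and> (\<forall>E\<in>sets M. \<sigma> E = (LINT z:E|variation M \<sigma>. h z))"
    by blast
  then have *: "integrable (variation M \<sigma>) (polar_density M \<sigma>) \<and>
      (\<forall>E\<in>sets M. \<sigma> E = (LINT z:E|variation M \<sigma>. polar_density M \<sigma> z))"
    unfolding polar_density_def by (rule someI_ex)
  then show i: "integrable (variation M \<sigma>) (polar_density M \<sigma>)"
    and eq: "\<And>E. E \<in> sets M \<Longrightarrow> \<sigma> E = (LINT z:E|variation M \<sigma>. polar_density M \<sigma> z)"
    by blast+
  show "AE z in variation M \<sigma>. norm (polar_density M \<sigma> z) \<le> 1"
  proof (rule density_norm_le[OF fm i])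
    fix E assume "E \<in> sets (variation M \<sigma>)"
    then show "norm (LINT z:E|variation M \<sigma>. polar_density M \<sigma> z) \<le> 1 * measure (variation M \<sigma>) E"
      using norm_le_variation[OF \<sigma>, of E] eq[of E] by (simp add: emeasure_eq_measure)
  qed simp
qed

section \<open>Dominated image measures and transfer of integrals\<close>

text \<open>The bound on sets is an inequality between the image measure and a scaled measure, and
  integration is monotone in the measure. Through \<open>L2_distr_dominated\<close>, marginal bounds
  become norm bounds with constant \<open>sqrt c\<close>.\<close>

lemma nn_integral_distr_dominated:
  assumes r: "r \<in> measurable W M"
    and dom: "\<And>A. A \<in> sets M \<Longrightarrow> emeasure W (r -` A \<inter> space W) \<le> ennreal c * emeasure M A"
    and f: "f \<in> borel_measurable M"
  shows "(\<integral>\<^sup>+z. f (r z) \<partial>W) \<le> ennreal c * (\<integral>\<^sup>+x. f x \<partial>M)"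
proof -
  have "(\<integral>\<^sup>+z. f (r z) \<partial>W) = (\<integral>\<^sup>+x. f x \<partial>distr W M r)"
    using r f by (simp add: nn_integral_distr)
  also have "\<dots> \<le> (\<integral>\<^sup>+x. f x \<partial>scale_measure (ennreal c) M)"
  proof (rule nn_integral_mono_measure)
    show "distr W M r \<le> scale_measure (ennreal c) M"
      using r dom by (subst le_measure) (auto simp: le_fun_def emeasure_distr emeasure_notin_sets)
  qed simp
  also have "\<dots> = ennreal c * (\<integral>\<^sup>+x. f x \<partial>M)"
    using f by (rule nn_integral_scale_measure)
  finally show ?thesis .
qed

lemma L2_distr_dominated:
  assumes r: "r \<in> measurable W M"
    and dom: "\<And>A. A \<in> sets M \<Longrightarrow> emeasure W (r -` A \<inter> space W) \<le> ennreal c * emeasure M A"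
    and c: "0 \<le> c" and f: "f \<in> L2 M"
  shows "(\<lambda>z. f (r z)) \<in> L2 W" "L2_norm W (\<lambda>z. f (r z)) \<le> sqrt c * L2_norm M f"
proof -
  have [measurable]: "f \<in> borel_measurable M" using f by (rule L2_measurable)
  note r[measurable]
  have "(\<integral>\<^sup>+z. (ennreal (norm (f (r z))))\<^sup>2 \<partial>W) \<le> ennreal c * (\<integral>\<^sup>+x. (ennreal (norm (f x)))\<^sup>2 \<partial>M)"
    using r dom by (rule nn_integral_distr_dominated) auto
  also have "\<dots> = ennreal ((sqrt c * L2_norm M f)\<^sup>2)"
    unfolding nn_integral_L2[OF f] using c by (simp add: power_mult_distrib ennreal_mult)
  finally have le: "(\<integral>\<^sup>+z. (ennreal (norm (f (r z))))\<^sup>2 \<partial>W) \<le> ennreal ((sqrt c * L2_norm M f)\<^sup>2)" .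
  show "(\<lambda>z. f (r z)) \<in> L2 W" "L2_norm W (\<lambda>z. f (r z)) \<le> sqrt c * L2_norm M f"
    using c by (intro L2_norm_leI[OF _ _ le]; simp)+
qed

text \<open>Two complex measures given by bounded densities that agree on sets through the map \<open>r\<close>
  give the same integrals; \<open>W\<close> is only required to be dominated by the image of \<open>W'\<close>.\<close>

lemma integral_density_transfer:
  fixes k k' :: "_ \<Rightarrow> complex" and u :: "_ \<Rightarrow> complex"
  assumes W: "finite_measure W" "finite_measure W'" and r: "r \<in> measurable W' W"
    and k: "k \<in> borel_measurable W" "AE z in W. norm (k z) \<le> C"
    and k': "k' \<in> borel_measurable W'" "AE z in W'. norm (k' z) \<le> C'"
    and eq: "\<And>E. E \<in> sets W \<Longrightarrow> (LINT z:E|W. k z) = (LINT z:r -` E \<inter> space W'|W'. k' z)"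
    and dom: "\<And>E. E \<in> sets W \<Longrightarrow> emeasure W E \<le> ennreal c * emeasure W' (r -` E \<inter> space W')"
    and u: "u \<in> borel_measurable W" "integrable W' (\<lambda>z. u (r z))"
  shows "(LINT z|W. u z * k z) = (LINT z|W'. u (r z) * k' z)"
proof -
  interpret W: finite_measure W by fact
  interpret W': finite_measure W' by fact
  note r[measurable] k(1)[measurable] k'(1)[measurable]
  have iW: "integrable W v" if v: "integrable (distr W' W r) v" for v :: "_ \<Rightarrow> complex"
  proof -
    have [measurable]: "v \<in> borel_measurable W" using borel_measurable_integrable[OF v] by simp
    have "(\<integral>\<^sup>+x. norm (v x) \<partial>W) \<le> ennreal c * (\<integral>\<^sup>+x. norm (v x) \<partial>distr W' W r)"
      using nn_integral_distr_dominated[of "\<lambda>x. x" W "distr W' W r" c "\<lambda>x. norm (v x)"] dom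
      by (simp add: emeasure_distr)
    also have "\<dots> < \<infinity>" using v by (simp add: integrable_iff_bounded ennreal_mult_less_top)
    finally show ?thesis by (simp add: integrable_iff_bounded)
  qed
  have iWk: "integrable W (\<lambda>z. v z * k z)" if v: "integrable (distr W' W r) v" for v
  proof (rule Bochner_Integration.integrable_bound[where f="\<lambda>z. C * norm (v z)"])
    show "integrable W (\<lambda>z. C * norm (v z))" using iW[OF v] by simp
    have "norm (v z * k z) \<le> norm (C * norm (v z))" if "norm (k z) \<le> C" for z
      using mult_left_mono[OF that, of "norm (v z)"] order_trans[OF norm_ge_zero that]
      by (simp add: norm_mult abs_mult mult.commute)
    then show "AE z in W. norm (v z * k z) \<le> norm (C * norm (v z))" using k(2) by auto
    show "(\<lambda>z. v z * k z) \<in> borel_measurable W"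
      using borel_measurable_integrable[OF iW[OF v]] k(1) by (rule borel_measurable_times)
  qed
  have iWk': "integrable W' (\<lambda>z. v (r z) * k' z)" if v: "integrable (distr W' W r) v" for v
  proof (rule Bochner_Integration.integrable_bound[where f="\<lambda>z. C' * norm (v (r z))"])
    have i: "integrable W' (\<lambda>z. v (r z))" using integrable_distr[OF r v] .
    then show "integrable W' (\<lambda>z. C' * norm (v (r z)))" by simp
    show "(\<lambda>z. v (r z) * k' z) \<in> borel_measurable W'"
      using borel_measurable_integrable[OF i] by simp
    have "norm (v (r z) * k' z) \<le> norm (C' * norm (v (r z)))" if "norm (k' z) \<le> C'" for z
      using mult_left_mono[OF that, of "norm (v (r z))"] order_trans[OF norm_ge_zero that]
      by (simp add: norm_mult abs_mult mult.commute)
    then show "AE z in W'. norm (v (r z) * k' z) \<le> norm (C' * norm (v (r z)))" using k'(2) by auto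
  qed
  \<comment> \<open>The induction runs over functions integrable for the image of \<open>W'\<close>.
    As \<open>W\<close> is dominated by this image, integrability for \<open>W\<close> follows and
    both sides make sense at every stage; the converse could fail.\<close>
  have "integrable (distr W' W r) u" using u by (subst integrable_distr_eq) auto
  then show ?thesis
  proof (induct u rule: integrable_induct)
    case (base A c)
    then have A: "A \<in> sets W" by simp
    have "(LINT z|W. (indicator A z *\<^sub>R c) * k z) = c * (LINT z:A|W. k z)"
      unfolding set_lebesgue_integral_def by (subst integral_mult_right_zero[symmetric]) (simp add: scaleR_conv_of_real mult_ac)
    also have "\<dots> = c * (LINT z:r -` A \<inter> space W'|W'. k' z)" by (simp add: eq[OF A])
    also have "\<dots> = (LINT z|W'. (indicator A (r z) *\<^sub>R c) * k' z)"
      unfolding set_lebesgue_integral_def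
      by (subst integral_mult_right_zero[symmetric], rule Bochner_Integration.integral_cong) (auto split: split_indicator)
    finally show ?case .
  next
    case (add f g)
    then show ?case
      using iWk[OF add(1)] iWk[OF add(3)] iWk'[OF add(1)] iWk'[OF add(3)] by (simp add: distrib_right)
  next
    case (lim f s)
    have bnd: "norm (s i x) \<le> 2 * norm (f x)" if "x \<in> space W" for i x using lim that by simp
    have conv: "(\<lambda>i. s i x) \<longlonglongrightarrow> f x" if "x \<in> space W" for x using lim that by simp
    have 1: "(\<lambda>i. LINT z|W. s i z * k z) \<longlonglongrightarrow> (LINT z|W. f z * k z)"
    proof (rule integral_dominated_convergence[where w="\<lambda>z. 2 * norm (f z * k z)"])
      show "integrable W (\<lambda>z. 2 * norm (f z * k z))" using iWk[OF lim(5)] by simp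
      show "AE z in W. (\<lambda>i. s i z * k z) \<longlonglongrightarrow> f z * k z"
        by (intro AE_I2 tendsto_intros conv)
      show "AE z in W. norm (s i z * k z) \<le> 2 * norm (f z * k z)" for i
        using bnd by (intro AE_I2) (simp add: norm_mult mult_right_mono mult.assoc[symmetric])
    qed (use iWk[OF lim(5)] iWk[OF lim(1)] in auto)
    have 2: "(\<lambda>i. LINT z|W'. s i (r z) * k' z) \<longlonglongrightarrow> (LINT z|W'. f (r z) * k' z)"
    proof (rule integral_dominated_convergence[where w="\<lambda>z. 2 * norm (f (r z) * k' z)"])
      show "integrable W' (\<lambda>z. 2 * norm (f (r z) * k' z))" using iWk'[OF lim(5)] by simp
      show "AE z in W'. (\<lambda>i. s i (r z) * k' z) \<longlonglongrightarrow> f (r z) * k' z"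
        by (intro AE_I2 tendsto_intros conv) (rule measurable_space[OF r])
      show "AE z in W'. norm (s i (r z) * k' z) \<le> 2 * norm (f (r z) * k' z)" for i
        using bnd measurable_space[OF r] by (intro AE_I2) (simp add: norm_mult mult_right_mono flip: mult.assoc)
    qed (use iWk'[OF lim(5)] iWk'[OF lim(1)] in auto)
    show ?case
      using LIMSEQ_unique[OF 1] 2 lim(2) by simp
  qed
qed

lemma complex_measure_set_integral:
  fixes k :: "'a \<Rightarrow> complex"
  assumes sW: "sets W = sets M" and k: "integrable W k"
  shows "complex_measure M (\<lambda>E. LINT z:E|W. k z)"
  unfolding complex_measure_def
proof (intro conjI allI impI)
  have intE: "set_integrable W E k" if "E \<in> sets W" for E
    using that k unfolding set_integrable_def by (rule integrable_mult_indicator)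
  show "(LINT z:{}|W. k z) = 0" by (simp add: set_lebesgue_integral_def)
  fix A :: "nat \<Rightarrow> 'a set" assume A: "range A \<subseteq> sets M \<and> disjoint_family A"
  then have Ai: "A i \<in> sets W" for i using sW by auto
  have "(\<Sum>i<n. LINT z:A i|W. k z) = (LINT z:(\<Union>i<n. A i)|W. k z)" for n
    using A Ai
    by (intro set_integral_finite_Union[symmetric] intE) (auto simp: disjoint_family_on_def)
  moreover have "(\<lambda>n. LINT z:(\<Union>i<n. A i)|W. k z) \<longlonglongrightarrow> (LINT z:(\<Union>n. \<Union>i<n. A i)|W. k z)"
  proof (rule set_integral_cont_up)
    show "incseq (\<lambda>n. \<Union>i<n. A i)" by (rule incseq_SucI) (auto intro: less_SucI)
    show "set_integrable W (\<Union>n. \<Union>i<n. A i) k" using Ai by (intro intE) blast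
  qed (use Ai in blast)
  moreover have "(\<Union>n. \<Union>i<n. A i) = (\<Union>i. A i)" by auto
  ultimately show "(\<lambda>i. LINT z:A i|W. k z) sums (LINT z:(\<Union>i. A i)|W. k z)"
    by (simp add: sums_def)
qed

text \<open>\<open>cm_integral\<close> uses the polar density with respect to the variation, not
  \<open>k\<close> with respect to \<open>W\<close>. These are two representations of the same set
  function, and \<open>integral_density_transfer\<close> along the identity compares them.\<close>

lemma complex_measure_from_density:
  fixes k :: "'a \<Rightarrow> complex"
  assumes W: "finite_measure W" and sW: "sets W = sets M"
    and k: "k \<in> borel_measurable W" "AE z in W. norm (k z) \<le> C"
  defines "\<sigma> \<equiv> \<lambda>E. LINT z:E|W. k z"
  shows "complex_measure M \<sigma>"
    and "\<And>E. E \<in> sets M \<Longrightarrow> emeasure (variation M \<sigma>) E \<le> ennreal C * emeasure W E"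
    and "\<And>u. u \<in> borel_measurable W \<Longrightarrow> integrable W u \<Longrightarrow> cm_integral M \<sigma> u = (LINT z|W. u z * k z)"
proof -
  interpret W: finite_measure W by fact
  have int: "integrable W k"
    by (rule W.integrable_const_bound[OF k(2,1)])
  have intE: "set_integrable W E k" if "E \<in> sets W" for E
    using that int unfolding set_integrable_def by (rule integrable_mult_indicator)
  show \<sigma>: "complex_measure M \<sigma>"
    unfolding \<sigma>_def using sW int by (rule complex_measure_set_integral)
  have \<sigma>_le: "ennreal (norm (\<sigma> E)) \<le> ennreal C * emeasure W E" if E: "E \<in> sets W" for E
  proof -
    have "ennreal (norm (\<sigma> E)) \<le> (\<integral>\<^sup>+z. ennreal (norm (indicator E z *\<^sub>R k z)) \<partial>W)"
      unfolding \<sigma>_def set_lebesgue_integral_def using intE[OF E]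
      by (intro integral_norm_bound_ennreal) (simp add: set_integrable_def)
    also have "\<dots> \<le> (\<integral>\<^sup>+z. ennreal C * indicator E z \<partial>W)"
      using k(2) by (intro nn_integral_mono_AE) (auto elim!: eventually_mono split: split_indicator intro: ennreal_leI)
    also have "\<dots> = ennreal C * emeasure W E" using E by (simp add: nn_integral_cmult_indicator)
    finally show ?thesis .
  qed
  show V: "emeasure (variation M \<sigma>) E \<le> ennreal C * emeasure W E" if "E \<in> sets M" for E
    using variation_least[OF \<sigma> that, of "scale_measure (ennreal C) W"] \<sigma>_le sW that by simp
  have fin: "emeasure (variation M \<sigma>) (space M) < \<infinity>"
  proof (rule le_less_trans[OF V])
    show "ennreal C * emeasure W (space M) < \<infinity>"
      using W.emeasure_finite[of "space M"] by (simp add: ennreal_mult_eq_top_iff less_top[symmetric])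
  qed simp
  note pd = polar_density_integrable[OF \<sigma> fin] polar_density_eq[OF \<sigma> fin] polar_density_bound[OF \<sigma> fin]
  fix u :: "'a \<Rightarrow> complex" assume u: "u \<in> borel_measurable W" "integrable W u"
  show "cm_integral M \<sigma> u = (LINT z|W. u z * k z)"
    unfolding cm_integral_def
  proof (rule integral_density_transfer[where r="\<lambda>z. z" and c=C])
    show "finite_measure (variation M \<sigma>)" by (rule finite_measure_variation[OF \<sigma> fin])
    show "(\<lambda>z. z) \<in> measurable W (variation M \<sigma>)" by (rule measurable_ident_sets) (simp add: sW)
    show "(LINT z:E|variation M \<sigma>. polar_density M \<sigma> z) = (LINT z:(\<lambda>z. z) -` E \<inter> space W|W. k z)"
      if "E \<in> sets (variation M \<sigma>)" for E
    proof -
      have "E \<in> sets M" using that by simp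
      moreover have "(\<lambda>z. z) -` E \<inter> space W = E"
        using that sW sets.sets_into_space[of E W] by auto
      ultimately show ?thesis using pd(2)[of E] by (simp add: \<sigma>_def)
    qed
    show "emeasure (variation M \<sigma>) E \<le> ennreal C * emeasure W ((\<lambda>z. z) -` E \<inter> space W)"
      if "E \<in> sets (variation M \<sigma>)" for E
    proof -
      have "(\<lambda>z. z) -` E \<inter> space W = E"
        using that sW sets.sets_into_space[of E W] by auto
      then show ?thesis using that V by simp
    qed
    show "u \<in> borel_measurable (variation M \<sigma>)"
      using u sW by (simp cong: measurable_cong_sets)
  qed (use W k pd u in auto)
qed

section \<open>Arveson measures and compression\<close>

lemma fst_vimage_pair_measure: "A \<in> sets M \<Longrightarrow> fst -` A \<inter> space (M \<Otimes>\<^sub>M N) = A \<times> space N"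
  using sets.sets_into_space[of A M] by (auto simp: space_pair_measure)

lemma snd_vimage_pair_measure: "B \<in> sets N \<Longrightarrow> snd -` B \<inter> space (M \<Otimes>\<^sub>M N) = space M \<times> B"
  using sets.sets_into_space[of B N] by (auto simp: space_pair_measure)

lemma measurable_variation [simp]: "measurable (variation M \<sigma>) K = measurable M K"
  by (simp cong: measurable_cong_sets)

lemma arveson_measuresI:
  assumes "complex_measure (N \<Otimes>\<^sub>M M) \<sigma>" and "0 < c"
    and "emeasure (variation (N \<Otimes>\<^sub>M M) \<sigma>) (space N \<times> space M) < \<infinity>"
    and "\<And>A. A \<in> sets N \<Longrightarrow> emeasure (variation (N \<Otimes>\<^sub>M M) \<sigma>) (A \<times> space M) \<le> ennreal c * emeasure N A"
    and "\<And>B. B \<in> sets M \<Longrightarrow> emeasure (variation (N \<Otimes>\<^sub>M M) \<sigma>) (space N \<times> B) \<le> ennreal c * emeasure M B"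
  shows "\<sigma> \<in> arveson_measures N M"
proof -
  let ?V = "variation (N \<Otimes>\<^sub>M M) \<sigma>"
  have "emeasure (distr ?V N fst) A \<le> ennreal c * emeasure N A" if "A \<in> sets N" for A
    using assms(4)[OF that] that by (simp add: emeasure_distr fst_vimage_pair_measure)
  moreover have "emeasure (distr ?V M snd) B \<le> ennreal c * emeasure M B" if "B \<in> sets M" for B
    using assms(5)[OF that] that by (simp add: emeasure_distr snd_vimage_pair_measure)
  moreover have "emeasure ?V (space ?V) < \<infinity>"
    using assms(3) by (simp add: space_pair_measure)
  ultimately show ?thesis
    using assms(1,2) unfolding arveson_measures_def Let_def by blast
qed

lemma arveson_measuresE:
  assumes "\<sigma> \<in> arveson_measures N M"
  obtains c where "0 < c" "complex_measure (N \<Otimes>\<^sub>M M) \<sigma>"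
    "emeasure (variation (N \<Otimes>\<^sub>M M) \<sigma>) (space (N \<Otimes>\<^sub>M M)) < \<infinity>"
    "\<And>A. A \<in> sets N \<Longrightarrow> emeasure (variation (N \<Otimes>\<^sub>M M) \<sigma>) (A \<times> space M) \<le> ennreal c * emeasure N A"
    "\<And>B. B \<in> sets M \<Longrightarrow> emeasure (variation (N \<Otimes>\<^sub>M M) \<sigma>) (space N \<times> B) \<le> ennreal c * emeasure M B"
proof -
  let ?V = "variation (N \<Otimes>\<^sub>M M) \<sigma>"
  have *: "complex_measure (N \<Otimes>\<^sub>M M) \<sigma>" "emeasure ?V (space (N \<Otimes>\<^sub>M M)) < \<infinity>"
    using assms by (auto simp: arveson_measures_def Let_def)
  obtain c where c: "0 < c" "\<forall>A\<in>sets N. emeasure (distr ?V N fst) A \<le> ennreal c * emeasure N A"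
    "\<forall>B\<in>sets M. emeasure (distr ?V M snd) B \<le> ennreal c * emeasure M B"
    using assms unfolding arveson_measures_def Let_def by blast
  show ?thesis
  proof (rule that[OF c(1) *])
    show "emeasure ?V (A \<times> space M) \<le> ennreal c * emeasure N A" if "A \<in> sets N" for A
      using c(2) that by (auto simp: emeasure_distr fst_vimage_pair_measure)
    show "emeasure ?V (space N \<times> B) \<le> ennreal c * emeasure M B" if "B \<in> sets M" for B
      using c(3) that by (auto simp: emeasure_distr snd_vimage_pair_measure)
  qed
qed

lemma L2_mult_unit_bounded:
  assumes f: "f \<in> L2 M" and h: "h \<in> borel_measurable M" "AE x in M. norm (h x) \<le> 1"
  shows "(\<lambda>x. f x * h x) \<in> L2 M" "L2_norm M (\<lambda>x. f x * h x) \<le> L2_norm M f"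
proof -
  have "(\<integral>\<^sup>+x. (ennreal (norm (f x * h x)))\<^sup>2 \<partial>M) \<le> (\<integral>\<^sup>+x. (ennreal (norm (f x)))\<^sup>2 \<partial>M)"
  proof (rule nn_integral_mono_AE)
    have "(ennreal (norm (f x * h x)))\<^sup>2 \<le> (ennreal (norm (f x)))\<^sup>2" if "norm (h x) \<le> 1" for x
      using that by (intro power_mono ennreal_leI) (auto simp: norm_mult mult_left_le)
    then show "AE x in M. (ennreal (norm (f x * h x)))\<^sup>2 \<le> (ennreal (norm (f x)))\<^sup>2"
      using h(2) by auto
  qed
  then have le: "(\<integral>\<^sup>+x. (ennreal (norm (f x * h x)))\<^sup>2 \<partial>M) \<le> ennreal ((L2_norm M f)\<^sup>2)"
    by (simp only: nn_integral_L2[OF f])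
  have m: "(\<lambda>x. f x * h x) \<in> borel_measurable M"
    using L2_measurable[OF f] h(1) by (rule borel_measurable_times)
  show "(\<lambda>x. f x * h x) \<in> L2 M" "L2_norm M (\<lambda>x. f x * h x) \<le> L2_norm M f"
    by (rule L2_norm_leI[OF m L2_norm_nonneg le])+
qed

lemma L2_eq_AE_if_inner_eq:
  assumes "u \<in> L2 M" "v \<in> L2 M" and "\<And>g. g \<in> L2 M \<Longrightarrow> L2_inner M u g = L2_inner M v g"
  shows "AE x in M. u x = v x"
proof -
  have d: "(\<lambda>x. u x - v x) \<in> L2 M" using assms by (intro L2_diff)
  have "AE x in M. u x - v x = 0"
    using L2_inner_diff_left[OF assms(1,2) d] assms(3)[OF d] by (intro L2_orthogonal_self[OF d]) simp
  then show ?thesis by simp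
qed

text \<open>The two marginal bounds say that the images of the variation under the projections are
  dominated, so functions of one variable pull back boundedly; one constant serves both
  variables.\<close>

lemma arveson_L2:
  assumes "\<sigma> \<in> arveson_measures N M"
  defines "V \<equiv> variation (N \<Otimes>\<^sub>M M) \<sigma>"
  obtains c where "0 < c"
    "\<And>f. f \<in> L2 M \<Longrightarrow> (\<lambda>z. f (snd z)) \<in> L2 V" "\<And>f. f \<in> L2 M \<Longrightarrow> L2_norm V (\<lambda>z. f (snd z)) \<le> sqrt c * L2_norm M f"
    "\<And>g. g \<in> L2 N \<Longrightarrow> (\<lambda>z. g (fst z)) \<in> L2 V" "\<And>g. g \<in> L2 N \<Longrightarrow> L2_norm V (\<lambda>z. g (fst z)) \<le> sqrt c * L2_norm N g"
proof -
  from assms(1) obtain c where c: "0 < c" "complex_measure (N \<Otimes>\<^sub>M M) \<sigma>"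
    "emeasure V (space (N \<Otimes>\<^sub>M M)) < \<infinity>"
    "\<And>A. A \<in> sets N \<Longrightarrow> emeasure V (A \<times> space M) \<le> ennreal c * emeasure N A"
    "\<And>B. B \<in> sets M \<Longrightarrow> emeasure V (space N \<times> B) \<le> ennreal c * emeasure M B"
    by (rule arveson_measuresE[of \<sigma> N M, folded V_def]) (rule that)
  have "snd \<in> measurable V M" "fst \<in> measurable V N" by (auto simp: V_def)
  moreover have "emeasure V (snd -` B \<inter> space V) \<le> ennreal c * emeasure M B" if "B \<in> sets M" for B
    using c(5)[OF that] that by (simp add: V_def snd_vimage_pair_measure)
  moreover have "emeasure V (fst -` A \<inter> space V) \<le> ennreal c * emeasure N A" if "A \<in> sets N" for A
    using c(4)[OF that] that by (simp add: V_def fst_vimage_pair_measure)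
  ultimately show ?thesis
    using L2_distr_dominated[of snd V M c] L2_distr_dominated[of fst V N c] c(1)
    by (intro that[of c]) auto
qed

text \<open>The pairing is a sesquilinear form bounded by \<open>c\<close>: Cauchy-Schwarz for the
  variation, with the polar density absorbed into the factor from \<open>f\<close>. The Riesz
  theorem gives \<open>T f\<close> for each \<open>f\<close> separately. Such a vector is determined
  by its pairings up to a null set, which is why linearity holds almost everywhere.\<close>

lemma arveson_operator_exists:
  assumes \<sigma>: "\<sigma> \<in> arveson_measures N M"
  shows "\<exists>T. bounded_L2_operator M N T \<and> (\<forall>f\<in>L2 M. \<forall>g\<in>L2 N.
    L2_inner N (T f) g = cm_integral (N \<Otimes>\<^sub>M M) \<sigma> (\<lambda>(y, x). f x * cnj (g y)))"
proof -
  define V where "V = variation (N \<Otimes>\<^sub>M M) \<sigma>"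
  define h where "h = polar_density (N \<Otimes>\<^sub>M M) \<sigma>"
  from \<sigma> have cm: "complex_measure (N \<Otimes>\<^sub>M M) \<sigma>" "emeasure V (space (N \<Otimes>\<^sub>M M)) < \<infinity>"
    by (auto simp: V_def elim: arveson_measuresE)
  have h: "h \<in> borel_measurable V" "AE z in V. norm (h z) \<le> 1"
    unfolding h_def V_def using polar_density_integrable[OF cm[unfolded V_def]] polar_density_bound[OF cm[unfolded V_def]]
    by (auto simp del: measurable_variation)
  obtain c where c: "0 < c"
    "\<And>f. f \<in> L2 M \<Longrightarrow> (\<lambda>z. f (snd z)) \<in> L2 V" "\<And>f. f \<in> L2 M \<Longrightarrow> L2_norm V (\<lambda>z. f (snd z)) \<le> sqrt c * L2_norm M f"
    "\<And>g. g \<in> L2 N \<Longrightarrow> (\<lambda>z. g (fst z)) \<in> L2 V" "\<And>g. g \<in> L2 N \<Longrightarrow> L2_norm V (\<lambda>z. g (fst z)) \<le> sqrt c * L2_norm N g"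
    using arveson_L2[OF \<sigma>] unfolding V_def by blast
  define b where "b f g = L2_inner V (\<lambda>z. f (snd z) * h z) (\<lambda>z. g (fst z))" for f g
  have b_eq: "cm_integral (N \<Otimes>\<^sub>M M) \<sigma> (\<lambda>(y, x). f x * cnj (g y)) = b f g" for f g
    unfolding cm_integral_def b_def L2_inner_def V_def h_def
    by (intro Bochner_Integration.integral_cong) (auto simp: mult_ac)
  have fh: "(\<lambda>z. f (snd z) * h z) \<in> L2 V" "L2_norm V (\<lambda>z. f (snd z) * h z) \<le> sqrt c * L2_norm M f"
    if "f \<in> L2 M" for f
    using L2_mult_unit_bounded[OF c(2)[OF that] h] c(3)[OF that] by auto
  have b_bound: "norm (b f g) \<le> (c * L2_norm M f) * L2_norm N g" if "f \<in> L2 M" "g \<in> L2 N" for f g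
  proof -
    have "norm (b f g) \<le> L2_norm V (\<lambda>z. f (snd z) * h z) * L2_norm V (\<lambda>z. g (fst z))"
      unfolding b_def using that by (intro L2_inner_CS fh c)
    also have "\<dots> \<le> (sqrt c * L2_norm M f) * (sqrt c * L2_norm N g)"
      using that c(1) by (intro mult_mono fh c mult_nonneg_nonneg) auto
    also have "\<dots> = (sqrt c * sqrt c) * L2_norm M f * L2_norm N g" by (simp only: mult_ac)
    finally show ?thesis using c(1) by simp
  qed
  have "\<exists>u. u \<in> L2 N \<and> (\<forall>g\<in>L2 N. L2_inner N u g = b f g)" if f: "f \<in> L2 M" for f
  proof -
    obtain u where "u \<in> L2 N" "\<And>g. g \<in> L2 N \<Longrightarrow> L2_inner N u g = b f g"
    proof (rule L2_Riesz[of N "b f" "c * L2_norm M f"])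
      show "b f (\<lambda>x. a1 * g1 x + a2 * g2 x) = cnj a1 * b f g1 + cnj a2 * b f g2"
        if "g1 \<in> L2 N" "g2 \<in> L2 N" for g1 g2 a1 a2
        unfolding b_def using that f by (intro L2_inner_lincomb_right fh c)
      show "norm (b f g) \<le> c * L2_norm M f * L2_norm N g" if "g \<in> L2 N" for g
        using f that by (rule b_bound)
    qed (assumption | rule that)+
    then show ?thesis by blast
  qed
  then obtain T where T: "\<And>f. f \<in> L2 M \<Longrightarrow> T f \<in> L2 N"
    "\<And>f g. f \<in> L2 M \<Longrightarrow> g \<in> L2 N \<Longrightarrow> L2_inner N (T f) g = b f g"
    by metis
  have "bounded_L2_operator M N T"
    unfolding bounded_L2_operator_def
  proof (intro conjI ballI allI)
    fix f g :: "'b \<Rightarrow> complex" and a1 a2 assume fg: "f \<in> L2 M" "g \<in> L2 M"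
    show "AE y in N. T (\<lambda>x. a1 * f x + a2 * g x) y = a1 * T f y + a2 * T g y"
    proof (rule L2_eq_AE_if_inner_eq)
      fix v assume v: "v \<in> L2 N"
      have "L2_inner N (T (\<lambda>x. a1 * f x + a2 * g x)) v = b (\<lambda>x. a1 * f x + a2 * g x) v"
        using fg v by (intro T L2_lincomb)
      also have "\<dots> = a1 * b f v + a2 * b g v"
        unfolding b_def using L2_inner_lincomb_left[OF fh(1)[OF fg(1)] fh(1)[OF fg(2)] c(4)[OF v], of a1 a2]
        by (simp add: distrib_right mult.assoc)
      also have "\<dots> = L2_inner N (\<lambda>y. a1 * T f y + a2 * T g y) v"
        using fg v T by (simp add: L2_inner_lincomb_left)
      finally show "L2_inner N (T (\<lambda>x. a1 * f x + a2 * g x)) v = L2_inner N (\<lambda>y. a1 * T f y + a2 * T g y) v" .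
    qed (use fg T in \<open>auto intro: L2_lincomb\<close>)
  next
    show "\<exists>C. \<forall>f\<in>L2 M. L2_norm N (T f) \<le> C * L2_norm M f"
    proof (intro exI ballI)
      fix f assume f: "f \<in> L2 M"
      \<comment> \<open>Testing the form against \<open>T f\<close> itself and cancelling one factor
        gives the operator bound \<open>c\<close>.\<close>
      have "(L2_norm N (T f))\<^sup>2 = norm (b f (T f))"
        unfolding T(2)[OF f T(1)[OF f], symmetric] L2_inner_self norm_of_real by simp
      also have "\<dots> \<le> c * L2_norm M f * L2_norm N (T f)"
        using f T(1) by (intro b_bound)
      finally have "L2_norm N (T f) * L2_norm N (T f) \<le> (c * L2_norm M f) * L2_norm N (T f)"
        by (simp add: power2_eq_square)
      then show "L2_norm N (T f) \<le> c * L2_norm M f"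
        using c(1) L2_norm_nonneg[of N "T f"]
        by (cases "L2_norm N (T f) = 0") (auto simp: mult_le_cancel_right)
    qed
  qed (use T in auto)
  then show ?thesis using T(2) by (intro exI[of _ T]) (simp add: b_eq)
qed

lemma
  assumes "\<sigma> \<in> arveson_measures N M"
  shows arveson_operator_bounded: "bounded_L2_operator M N (arveson_operator M N \<sigma>)"
    and arveson_operator_inner: "\<And>f g. f \<in> L2 M \<Longrightarrow> g \<in> L2 N \<Longrightarrow> L2_inner N (arveson_operator M N \<sigma> f) g
      = cm_integral (N \<Otimes>\<^sub>M M) \<sigma> (\<lambda>(y, x). f x * cnj (g y))"
  using someI_ex[OF arveson_operator_exists[OF assms]] unfolding arveson_operator_def by blast+

section \<open>Compression to a box\<close>

text \<open>For a coordinate projection \<open>p\<close> and a strip \<open>A\<close> with finite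
  cross-section this is the map \<open>f \<mapsto> f \<otimes> 1\<close> cut to \<open>A\<close>.
  Full preimages under \<open>p\<close> may have infinite measure; restricting \<open>X\<close> to
  \<open>A\<close> first makes the image measure dominated.\<close>

lemma L2_compress:
  assumes p: "p \<in> measurable X X1" and A: "A \<in> sets X" and K: "0 \<le> K"
    and dom: "\<And>C. C \<in> sets X1 \<Longrightarrow> emeasure X (p -` C \<inter> A) \<le> ennreal K * emeasure X1 C"
    and f: "f \<in> L2 X1"
  shows "(\<lambda>x. indicator A x * f (p x)) \<in> L2 X" "L2_norm X (\<lambda>x. indicator A x * f (p x)) \<le> sqrt K * L2_norm X1 f"
proof -
  have [measurable]: "f \<in> borel_measurable X1" using f by (rule L2_measurable)
  note p[measurable] A[measurable]
  define W where "W = density X (indicator A)"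
  have "(\<integral>\<^sup>+x. (ennreal (norm (indicator A x * f (p x))))\<^sup>2 \<partial>X) = (\<integral>\<^sup>+x. indicator A x * (ennreal (norm (f (p x))))\<^sup>2 \<partial>X)"
    by (intro nn_integral_cong) (auto split: split_indicator)
  also have "\<dots> = (\<integral>\<^sup>+x. (ennreal (norm (f (p x))))\<^sup>2 \<partial>W)"
    unfolding W_def by (subst nn_integral_density) auto
  also have "\<dots> \<le> ennreal K * (\<integral>\<^sup>+x. (ennreal (norm (f x)))\<^sup>2 \<partial>X1)"
  proof (rule nn_integral_distr_dominated)
    show "p \<in> measurable W X1" by (simp add: W_def p)
    fix C assume C: "C \<in> sets X1"
    have "emeasure W (p -` C \<inter> space W) = emeasure X (p -` C \<inter> A)"
    proof -
      have "emeasure W (p -` C \<inter> space W) = (\<integral>\<^sup>+x. indicator A x * indicator (p -` C \<inter> space X) x \<partial>X)"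
        unfolding W_def using C by (subst emeasure_density) auto
      also have "\<dots> = (\<integral>\<^sup>+x. indicator (p -` C \<inter> A) x \<partial>X)"
        by (intro nn_integral_cong) (auto split: split_indicator)
      also have "\<dots> = emeasure X (p -` C \<inter> A)"
      proof (rule nn_integral_indicator)
        have "p -` C \<inter> A = (p -` C \<inter> space X) \<inter> A" using sets.sets_into_space[OF A] by auto
        then show "p -` C \<inter> A \<in> sets X" using measurable_sets[OF p C] A by auto
      qed
      finally show ?thesis .
    qed
    then show "emeasure W (p -` C \<inter> space W) \<le> ennreal K * emeasure X1 C" using dom[OF C] by simp
  qed measurable
  also have "\<dots> = ennreal ((sqrt K * L2_norm X1 f)\<^sup>2)"
    unfolding nn_integral_L2[OF f] using K by (simp add: power_mult_distrib ennreal_mult)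
  finally have le: "(\<integral>\<^sup>+x. (ennreal (norm (indicator A x * f (p x))))\<^sup>2 \<partial>X) \<le> ennreal ((sqrt K * L2_norm X1 f)\<^sup>2)" .
  show "(\<lambda>x. indicator A x * f (p x)) \<in> L2 X" "L2_norm X (\<lambda>x. indicator A x * f (p x)) \<le> sqrt K * L2_norm X1 f"
    using K by (intro L2_norm_leI[OF _ _ le]; simp)+
qed

text \<open>The complement may fail to be measurable, so it is replaced by a countable union of
  rectangles, with coordinates already interchanged. The first inclusion covers the complement; the
  second keeps the union, off the null strips, inside it, so that the union can be pulled
  back.\<close>

lemma omega_closed_complement_cover:
  assumes "omega_closed M N \<kappa>"
  obtains U X0 Y0 where "U \<in> sets (N \<Otimes>\<^sub>M M)" "X0 \<in> null_sets M" "Y0 \<in> null_sets N"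
    "space N \<times> space M - \<kappa>\<inverse> \<subseteq> U \<union> (Y0 \<times> space M \<union> space N \<times> X0)"
    "U \<subseteq> (space N \<times> space M - \<kappa>\<inverse>) \<union> (Y0 \<times> space M \<union> space N \<times> X0)"
proof -
  let ?D = "space M \<times> space N - \<kappa>"
  obtain A B where AB: "\<And>i::nat. A i \<in> sets M" "\<And>i. B i \<in> sets N"
    "marginally_equivalent M N ?D (\<Union>i. A i \<times> B i)"
    using assms unfolding omega_closed_def omega_open_def by blast
  then obtain X0 Y0 where 0: "X0 \<in> null_sets M" "Y0 \<in> null_sets N"
    "(?D - (\<Union>i. A i \<times> B i)) \<union> ((\<Union>i. A i \<times> B i) - ?D) \<subseteq> X0 \<times> space N \<union> space M \<times> Y0"
    unfolding marginally_equivalent_def marginally_null_def by blast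
  show ?thesis
  proof (rule that[OF _ 0(1,2)])
    show "(\<Union>i. B i \<times> A i) \<in> sets (N \<Otimes>\<^sub>M M)" using AB by auto
    have "(x, y) \<in> (\<Union>i. A i \<times> B i) \<union> X0 \<times> space N \<union> space M \<times> Y0" if "(x, y) \<in> ?D" for x y
      using 0(3) that by blast
    then show "space N \<times> space M - \<kappa>\<inverse> \<subseteq> (\<Union>i. B i \<times> A i) \<union> (Y0 \<times> space M \<union> space N \<times> X0)"
      by fastforce
    have "(x, y) \<in> ?D \<union> X0 \<times> space N \<union> space M \<times> Y0" if "(x, y) \<in> (\<Union>i. A i \<times> B i)" for x y
      using 0(3) that by blast
    then show "(\<Union>i. B i \<times> A i) \<subseteq> (space N \<times> space M - \<kappa>\<inverse>) \<union> (Y0 \<times> space M \<union> space N \<times> X0)"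
      by fastforce
  qed
qed

text \<open>Abstract maps \<open>p\<close> and \<open>q\<close> let both factors be treated at once,
  with first or with second coordinates. The bounds \<open>pA\<close> and \<open>qB\<close> have two
  uses: they dominate the marginals of the projected measure, and they make the lifts of functions
  bounded.\<close>

theorem operator_M0_set_compress:
  assumes p: "p \<in> measurable X X1" and q: "q \<in> measurable Y Y1"
    and A: "A \<in> sets X" and B: "B \<in> sets Y" and K: "0 < K"
    and pA: "\<And>C. C \<in> sets X1 \<Longrightarrow> emeasure X (p -` C \<inter> A) \<le> ennreal K * emeasure X1 C"
    and qB: "\<And>C. C \<in> sets Y1 \<Longrightarrow> emeasure Y (q -` C \<inter> B) \<le> ennreal K * emeasure Y1 C"
    and \<kappa>1: "omega_closed X1 Y1 \<kappa>1" and \<kappa>: "\<And>x y. (x, y) \<in> \<kappa> \<Longrightarrow> (p x, q y) \<in> \<kappa>1"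
    and \<sigma>: "\<sigma> \<in> arveson_measures_on Y X (\<kappa>\<inverse>)"
    and T: "compact_L2_operator X Y (arveson_operator X Y \<sigma>)"
    and E: "E \<in> sets (Y1 \<Otimes>\<^sub>M X1)" "\<sigma> ((\<lambda>(y, x). (q y, p x)) -` E \<inter> (B \<times> A)) \<noteq> 0"
  shows "operator_M0_set X1 Y1 \<kappa>1"
proof -
  define r where "r = (\<lambda>(y, x). (q y, p x))"
  define R where "R = B \<times> A"
  define \<sigma>1 where "\<sigma>1 E = \<sigma> (r -` E \<inter> R)" for E
  define V where "V = variation (Y \<Otimes>\<^sub>M X) \<sigma>"
  define V1 where "V1 = variation (Y1 \<Otimes>\<^sub>M X1) \<sigma>1"
  have \<sigma>': "\<sigma> \<in> arveson_measures Y X" using \<sigma> by (simp add: arveson_measures_on_def)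
  from \<sigma>' obtain c where c: "0 < c" "complex_measure (Y \<Otimes>\<^sub>M X) \<sigma>"
    "emeasure V (space (Y \<Otimes>\<^sub>M X)) < \<infinity>"
    "\<And>A. A \<in> sets Y \<Longrightarrow> emeasure V (A \<times> space X) \<le> ennreal c * emeasure Y A"
    "\<And>B. B \<in> sets X \<Longrightarrow> emeasure V (space Y \<times> B) \<le> ennreal c * emeasure X B"
    by (rule arveson_measuresE[of \<sigma> Y X, folded V_def]) (rule that)
  have sV: "sets V = sets (Y \<Otimes>\<^sub>M X)" "space V = space Y \<times> space X"
    by (auto simp: V_def space_pair_measure)
  have sV1: "sets V1 = sets (Y1 \<Otimes>\<^sub>M X1)" "space V1 = space Y1 \<times> space X1"
    by (auto simp: V1_def space_pair_measure)
  have AX: "A \<subseteq> space X" and BY: "B \<subseteq> space Y" using A B by (auto dest: sets.sets_into_space)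
  have R: "R \<in> sets (Y \<Otimes>\<^sub>M X)" using A B by (auto simp: R_def)
  have RS: "R \<subseteq> space Y \<times> space X" using AX BY by (auto simp: R_def)
  have r: "r \<in> measurable (Y \<Otimes>\<^sub>M X) (Y1 \<Otimes>\<^sub>M X1)"
    unfolding r_def using p q by measurable
  have rE: "r -` C \<inter> R \<in> sets (Y \<Otimes>\<^sub>M X)" if "C \<in> sets (Y1 \<Otimes>\<^sub>M X1)" for C
  proof -
    have "r -` C \<inter> R = (r -` C \<inter> space (Y \<Otimes>\<^sub>M X)) \<inter> R" using RS by (auto simp: space_pair_measure)
    then show ?thesis using measurable_sets[OF r that] R by auto
  qed
  have cm1: "complex_measure (Y1 \<Otimes>\<^sub>M X1) \<sigma>1"
    unfolding complex_measure_def
  proof (intro conjI allI impI)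
    show "\<sigma>1 {} = 0" using complex_measure_empty[OF c(2)] by (simp add: \<sigma>1_def)
    fix F :: "nat \<Rightarrow> _" assume F: "range F \<subseteq> sets (Y1 \<Otimes>\<^sub>M X1) \<and> disjoint_family F"
    have "(\<lambda>i. \<sigma> (r -` F i \<inter> R)) sums \<sigma> (\<Union>i. r -` F i \<inter> R)"
    proof (rule complex_measure_sums[OF c(2)])
      show "disjoint_family (\<lambda>i. r -` F i \<inter> R)"
        using F unfolding disjoint_family_on_def by blast
    qed (use F in \<open>auto intro: rE\<close>)
    moreover have "(\<Union>i. r -` F i \<inter> R) = r -` (\<Union>i. F i) \<inter> R" by auto
    ultimately show "(\<lambda>i. \<sigma>1 (F i)) sums \<sigma>1 (\<Union>i. F i)" by (simp add: \<sigma>1_def)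
  qed
  have indR: "(\<lambda>z. indicator R z :: real) \<in> borel_measurable V"
    by (rule borel_measurable_indicator) (simp add: sV(1) R)
  define W where "W = density V (\<lambda>z. ennreal (indicator R z))"
  have sW: "sets W = sets (Y \<Otimes>\<^sub>M X)" "space W = space Y \<times> space X"
    by (auto simp: W_def sV)
  have emW: "emeasure W C = emeasure V (C \<inter> R)" if "C \<in> sets (Y \<Otimes>\<^sub>M X)" for C
  proof -
    have "emeasure W C = (\<integral>\<^sup>+z. ennreal (indicator R z) * indicator C z \<partial>V)"
      unfolding W_def using that indR by (subst emeasure_density) (auto simp: sV(1))
    also have "\<dots> = (\<integral>\<^sup>+z. indicator (C \<inter> R) z \<partial>V)"
      by (intro nn_integral_cong) (auto split: split_indicator)
    also have "\<dots> = emeasure V (C \<inter> R)"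
      using that R by (intro nn_integral_indicator) (auto simp: sV(1))
    finally show ?thesis .
  qed
  have rW: "r \<in> measurable W (Y1 \<Otimes>\<^sub>M X1)"
    using r sW(1) by (simp cong: measurable_cong_sets)
  have emW': "emeasure W (r -` C \<inter> space W) = emeasure V (r -` C \<inter> R)" if "C \<in> sets (Y1 \<Otimes>\<^sub>M X1)" for C
  proof -
    have "emeasure W (r -` C \<inter> space W) = emeasure V (r -` C \<inter> space W \<inter> R)"
      using measurable_sets[OF rW that] sW(1) by (intro emW) simp
    also have "r -` C \<inter> space W \<inter> R = r -` C \<inter> R" using RS sW(2) by auto
    finally show ?thesis .
  qed
  \<comment> \<open>Mass can cancel along the fibres of \<open>r\<close>, so the variation of the
    projected measure may be strictly below the image of the restricted variation. All that follows
    uses only this inequality.\<close>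
  have V1_le: "emeasure V1 C \<le> emeasure V (r -` C \<inter> R)" if C: "C \<in> sets (Y1 \<Otimes>\<^sub>M X1)" for C
  proof -
    have "emeasure V1 C \<le> emeasure (distr W (Y1 \<Otimes>\<^sub>M X1) r) C"
      unfolding V1_def
    proof (rule variation_least[OF cm1 C])
      show "ennreal (norm (\<sigma>1 C)) \<le> emeasure (distr W (Y1 \<Otimes>\<^sub>M X1) r) C" if "C \<in> sets (Y1 \<Otimes>\<^sub>M X1)" for C
        using norm_le_variation[OF c(2) rE[OF that]] emW'[OF that] that rW
        by (simp add: emeasure_distr \<sigma>1_def V_def)
    qed simp
    also have "\<dots> = emeasure V (r -` C \<inter> R)" using C rW emW'[OF C] by (simp add: emeasure_distr)
    finally show ?thesis .
  qed
  have V1_Y: "emeasure V1 (C \<times> space X1) \<le> ennreal (c * K) * emeasure Y1 C" if C: "C \<in> sets Y1" for C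
  proof -
    have qC: "q -` C \<inter> B \<in> sets Y"
    proof -
      have "q -` C \<inter> B = (q -` C \<inter> space Y) \<inter> B" using BY by auto
      then show ?thesis using measurable_sets[OF q C] B by auto
    qed
    have "emeasure V1 (C \<times> space X1) \<le> emeasure V (r -` (C \<times> space X1) \<inter> R)"
      using C by (intro V1_le) auto
    also have "\<dots> \<le> emeasure V ((q -` C \<inter> B) \<times> space X)"
      using qC AX by (intro emeasure_mono) (auto simp: r_def R_def sV(1))
    also have "\<dots> \<le> ennreal c * emeasure Y (q -` C \<inter> B)" using qC by (rule c)
    also have "\<dots> \<le> ennreal c * (ennreal K * emeasure Y1 C)" by (intro mult_left_mono qB C) simp
    also have "\<dots> = ennreal (c * K) * emeasure Y1 C" using c(1) K by (simp add: ennreal_mult mult.assoc)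
    finally show ?thesis .
  qed
  have V1_X: "emeasure V1 (space Y1 \<times> C) \<le> ennreal (c * K) * emeasure X1 C" if C: "C \<in> sets X1" for C
  proof -
    have pC: "p -` C \<inter> A \<in> sets X"
    proof -
      have "p -` C \<inter> A = (p -` C \<inter> space X) \<inter> A" using AX by auto
      then show ?thesis using measurable_sets[OF p C] A by auto
    qed
    have "emeasure V1 (space Y1 \<times> C) \<le> emeasure V (r -` (space Y1 \<times> C) \<inter> R)"
      using C by (intro V1_le) auto
    also have "\<dots> \<le> emeasure V (space Y \<times> (p -` C \<inter> A))"
      using pC BY by (intro emeasure_mono) (auto simp: r_def R_def sV(1))
    also have "\<dots> \<le> ennreal c * emeasure X (p -` C \<inter> A)" using pC by (rule c)
    also have "\<dots> \<le> ennreal c * (ennreal K * emeasure X1 C)" by (intro mult_left_mono pA C) simp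
    also have "\<dots> = ennreal (c * K) * emeasure X1 C" using c(1) K by (simp add: ennreal_mult mult.assoc)
    finally show ?thesis .
  qed
  have fin1: "emeasure V1 (space Y1 \<times> space X1) < \<infinity>"
  proof -
    have "emeasure V1 (space Y1 \<times> space X1) \<le> emeasure V (r -` (space Y1 \<times> space X1) \<inter> R)"
      by (intro V1_le) auto
    also have "\<dots> \<le> emeasure V (space V)" by (rule emeasure_space)
    also have "\<dots> < \<infinity>" using c(3) by (simp add: V_def)
    finally show ?thesis .
  qed
  have \<sigma>1: "\<sigma>1 \<in> arveson_measures Y1 X1"
    using c(1) K fin1 V1_Y V1_X unfolding V1_def
    by (intro arveson_measuresI[OF cm1, of "c * K"]) auto
  define T0 where "T0 = arveson_operator X Y \<sigma>"
  define T1 where "T1 = arveson_operator X1 Y1 \<sigma>1"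
  define J where "J f = (\<lambda>x. indicator A x * f (p x))" for f :: "_ \<Rightarrow> complex"
  define J' where "J' g = (\<lambda>y. indicator B y * g (q y))" for g :: "_ \<Rightarrow> complex"
  have J: "J f \<in> L2 X" "L2_norm X (J f) \<le> sqrt K * L2_norm X1 f" if "f \<in> L2 X1" for f
    unfolding J_def using K that by (auto intro!: L2_compress[OF p A _ pA])
  have J': "J' g \<in> L2 Y" "L2_norm Y (J' g) \<le> sqrt K * L2_norm Y1 g" if "g \<in> L2 Y1" for g
    unfolding J'_def using K that by (auto intro!: L2_compress[OF q B _ qB])
  \<comment> \<open>Transfer along \<open>r\<close> turns the integral against the polar density of
    \<open>\<sigma>1\<close> into one over \<open>W\<close>, the restriction of \<open>V\<close> to
    the box. There the integrand factors into the lifts \<open>J f\<close> and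
    \<open>J' g\<close>.\<close>
  have pairing: "L2_inner Y1 (T1 f) g = L2_inner Y (T0 (J f)) (J' g)" if fg: "f \<in> L2 X1" "g \<in> L2 Y1" for f g
  proof -
    define h where "h = polar_density (Y \<Otimes>\<^sub>M X) \<sigma>"
    define h1 where "h1 = polar_density (Y1 \<Otimes>\<^sub>M X1) \<sigma>1"
    have fm: "finite_measure V" "finite_measure V1"
      and h: "integrable V h" "\<And>E. E \<in> sets (Y \<Otimes>\<^sub>M X) \<Longrightarrow> \<sigma> E = (LINT z:E|V. h z)" "AE z in V. norm (h z) \<le> 1"
      and h1: "integrable V1 h1" "\<And>E. E \<in> sets (Y1 \<Otimes>\<^sub>M X1) \<Longrightarrow> \<sigma>1 E = (LINT z:E|V1. h1 z)" "AE z in V1. norm (h1 z) \<le> 1"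
    proof -
      have f1: "emeasure (variation (Y1 \<Otimes>\<^sub>M X1) \<sigma>1) (space (Y1 \<Otimes>\<^sub>M X1)) < \<infinity>"
        using fin1 by (simp add: V1_def space_pair_measure)
      note f0 = c(3)[unfolded V_def]
      show "finite_measure V" "finite_measure V1"
        unfolding V_def V1_def
        by (rule finite_measure_variation[OF c(2) f0], rule finite_measure_variation[OF cm1 f1])
      show "integrable V h" "\<And>E. E \<in> sets (Y \<Otimes>\<^sub>M X) \<Longrightarrow> \<sigma> E = (LINT z:E|V. h z)" "AE z in V. norm (h z) \<le> 1"
        unfolding V_def h_def using polar_density_integrable[OF c(2) f0] polar_density_eq[OF c(2) f0] polar_density_bound[OF c(2) f0] by auto
      show "integrable V1 h1" "\<And>E. E \<in> sets (Y1 \<Otimes>\<^sub>M X1) \<Longrightarrow> \<sigma>1 E = (LINT z:E|V1. h1 z)" "AE z in V1. norm (h1 z) \<le> 1"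
        unfolding V1_def h1_def using polar_density_integrable[OF cm1 f1] polar_density_eq[OF cm1 f1] polar_density_bound[OF cm1 f1] by auto
    qed
    define u where "u = (\<lambda>(y, x). f x * cnj (g y))"
    have hm: "h \<in> borel_measurable V" using h(1) by (rule borel_measurable_integrable)
    have fm': "f \<in> borel_measurable X1" "g \<in> borel_measurable Y1" using fg by (auto dest: L2_measurable)
    have um: "u \<in> borel_measurable (Y1 \<Otimes>\<^sub>M X1)"
      unfolding u_def using fm' by measurable
    have urm: "(\<lambda>z. u (r z)) \<in> borel_measurable V"
      using measurable_compose[OF r um] sV(1) by (simp cong: measurable_cong_sets)
    have Ju: "indicator R z *\<^sub>R u (r z) = J f (snd z) * cnj (J' g (fst z))" for z
      by (auto simp: J_def J'_def R_def r_def u_def split_beta mem_Times_iff split: split_indicator)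
    have iJu: "integrable V (\<lambda>z. indicator R z *\<^sub>R u (r z))"
      unfolding Ju
    proof -
      obtain c' where "\<And>f. f \<in> L2 X \<Longrightarrow> (\<lambda>z. f (snd z)) \<in> L2 V" "\<And>g. g \<in> L2 Y \<Longrightarrow> (\<lambda>z. g (fst z)) \<in> L2 V"
        using arveson_L2[OF \<sigma>'] unfolding V_def by metis
      then show "integrable V (\<lambda>z. J f (snd z) * cnj (J' g (fst z)))"
        using J(1)[OF fg(1)] J'(1)[OF fg(2)] by (intro L2_mult_integrable)
    qed
    have "cm_integral (Y1 \<Otimes>\<^sub>M X1) \<sigma>1 u = (LINT z|V1. u z * h1 z)"
      by (simp add: cm_integral_def V1_def h1_def)
    also have "\<dots> = (LINT z|W. u (r z) * h z)"
    proof (rule integral_density_transfer[where c=1 and C=1 and C'=1])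
      show "finite_measure W"
      proof (rule finite_measureI)
        have "emeasure W (space W) \<le> emeasure V (space V)"
          using emW[of "space W"] sets.top[of W] sW(1) by (simp add: emeasure_space)
        then show "emeasure W (space W) \<noteq> \<infinity>"
          using c(3) by (auto simp: V_def less_top top_unique)
      qed
      show "r \<in> measurable W V1" using rW sV1(1) by (simp cong: measurable_cong_sets)
      show "h \<in> borel_measurable W" using hm by (simp add: W_def)
      have "AE z in V. ennreal (indicator R z) > 0 \<longrightarrow> norm (h z) \<le> 1" using h(3) by auto
      then show "AE z in W. norm (h z) \<le> 1"
        unfolding W_def using indR by (subst AE_density) auto
      show "(LINT z:C|V1. h1 z) = (LINT z:r -` C \<inter> space W|W. h z)" if "C \<in> sets V1" for C
      proof -
        have C: "C \<in> sets (Y1 \<Otimes>\<^sub>M X1)" using that sV1 by simp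
        have m: "r -` C \<inter> space W \<in> sets V" using measurable_sets[OF rW C] sW(1) sV(1) by simp
        have "(LINT z:r -` C \<inter> space W|W. h z) = (LINT z|V. indicator R z *\<^sub>R (indicator (r -` C \<inter> space W) z *\<^sub>R h z))"
          unfolding set_lebesgue_integral_def W_def using indR m hm
          by (subst integral_density) (auto simp: W_def)
        also have "\<dots> = (LINT z:r -` C \<inter> R|V. h z)"
          unfolding set_lebesgue_integral_def using RS sW(2)
          by (intro Bochner_Integration.integral_cong) (auto split: split_indicator)
        also have "\<dots> = \<sigma>1 C" using h(2)[OF rE[OF C]] by (simp add: \<sigma>1_def)
        also have "\<dots> = (LINT z:C|V1. h1 z)" using h1(2)[OF C] .
        finally show ?thesis by simp
      qed
      show "emeasure V1 C \<le> ennreal 1 * emeasure W (r -` C \<inter> space W)" if "C \<in> sets V1" for C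
        using V1_le[of C] emW'[of C] that sV1 by simp
      show "u \<in> borel_measurable V1" using um sV1(1) by (simp cong: measurable_cong_sets)
      show "integrable W (\<lambda>z. u (r z))"
        unfolding W_def using indR urm iJu by (subst integrable_density) auto
    qed (use fm h1 in auto)
    also have "\<dots> = (LINT z|V. indicator R z *\<^sub>R (u (r z) * h z))"
      unfolding W_def using indR urm hm by (subst integral_density) auto
    also have "\<dots> = (LINT z|V. (J f (snd z) * cnj (J' g (fst z))) * h z)"
      unfolding Ju[symmetric] by simp
    also have "\<dots> = cm_integral (Y \<Otimes>\<^sub>M X) \<sigma> (\<lambda>(y, x). J f x * cnj (J' g y))"
      by (simp add: cm_integral_def V_def h_def split_beta)
    finally show ?thesis
      unfolding T1_def T0_def u_def
      using arveson_operator_inner[OF \<sigma>1 fg] arveson_operator_inner[OF \<sigma>' J(1)[OF fg(1)] J'(1)[OF fg(2)]] by simp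
  qed
  have bT1: "bounded_L2_operator X1 Y1 T1" unfolding T1_def by (rule arveson_operator_bounded[OF \<sigma>1])
  have bT0: "bounded_L2_operator X Y T0" unfolding T0_def by (rule arveson_operator_bounded[OF \<sigma>'])
  \<comment> \<open>Choosing \<open>g = T1 f\<close> in the pairing and cancelling one norm replaces
    the adjoint of \<open>J'\<close>.\<close>
  have dom: "L2_norm Y1 (T1 f) \<le> sqrt K * L2_norm Y (T0 (J f))" if f: "f \<in> L2 X1" for f
  proof -
    have T1f: "T1 f \<in> L2 Y1" using bT1 f by (rule bounded_L2_operator_L2)
    have "(L2_norm Y1 (T1 f))\<^sup>2 = norm (L2_inner Y1 (T1 f) (T1 f))"
      unfolding L2_inner_self norm_of_real by simp
    also have "\<dots> \<le> L2_norm Y (T0 (J f)) * L2_norm Y (J' (T1 f))"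
      unfolding pairing[OF f T1f] using J(1)[OF f] J'(1)[OF T1f] bounded_L2_operator_L2[OF bT0]
      by (intro L2_inner_CS) auto
    also have "\<dots> \<le> L2_norm Y (T0 (J f)) * (sqrt K * L2_norm Y1 (T1 f))"
      by (intro mult_left_mono J' T1f) simp
    finally have "L2_norm Y1 (T1 f) * L2_norm Y1 (T1 f) \<le> (sqrt K * L2_norm Y (T0 (J f))) * L2_norm Y1 (T1 f)"
      by (simp only: power2_eq_square mult_ac)
    moreover have "0 \<le> sqrt K * L2_norm Y (T0 (J f))" using K by simp
    ultimately show ?thesis
      using L2_norm_nonneg[of Y1 "T1 f"] by (cases "L2_norm Y1 (T1 f) = 0") (auto simp: mult_le_cancel_right)
  qed
  have compact: "compact_L2_operator X1 Y1 T1"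
  proof (rule compact_L2_operator_dominated[OF T[folded T0_def] bT1 J _ dom])
    show "J (\<lambda>x. f x - g x) = (\<lambda>x. J f x - J g x)" for f g
      by (simp add: J_def right_diff_distrib)
  qed auto
  \<comment> \<open>The marginal bounds make the exceptional strips \<open>Z\<close> null for
    \<open>V1\<close>. Off \<open>Z\<close> the set \<open>U\<close> avoids the converse of
    \<open>\<kappa>1\<close>; since \<open>(p, q)\<close> maps \<open>\<kappa>\<close> into
    \<open>\<kappa>1\<close>, the preimage of \<open>U - Z\<close> in the box avoids the converse of
    \<open>\<kappa>\<close>.\<close>
  have null: "space Y1 \<times> space X1 - \<kappa>1\<inverse> \<in> null_sets (completion V1)"
  proof -
    obtain U X0 Y0 where U: "U \<in> sets (Y1 \<Otimes>\<^sub>M X1)" and X0: "X0 \<in> null_sets X1" and Y0: "Y0 \<in> null_sets Y1"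
      and cover: "space Y1 \<times> space X1 - \<kappa>1\<inverse> \<subseteq> U \<union> (Y0 \<times> space X1 \<union> space Y1 \<times> X0)"
      and sub: "U \<subseteq> (space Y1 \<times> space X1 - \<kappa>1\<inverse>) \<union> (Y0 \<times> space X1 \<union> space Y1 \<times> X0)"
      using omega_closed_complement_cover[OF \<kappa>1] by blast
    define Z where "Z = Y0 \<times> space X1 \<union> space Y1 \<times> X0"
    have Z: "Z \<in> null_sets V1"
    proof -
      have "Y0 \<times> space X1 \<in> null_sets V1" "space Y1 \<times> X0 \<in> null_sets V1"
        using V1_Y[of Y0] V1_X[of X0] X0 Y0 by (auto simp: null_sets_def sV1(1))
      then show ?thesis unfolding Z_def by (rule null_sets.Un)
    qed
    have UZ: "U - Z \<in> sets (Y1 \<Otimes>\<^sub>M X1)" using U Z sV1(1) by (auto dest: null_setsD2)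
    have "r -` (U - Z) \<inter> R \<subseteq> space Y \<times> space X - \<kappa>\<inverse>"
      using sub RS \<kappa> unfolding Z_def r_def by fastforce
    moreover have "space Y \<times> space X - \<kappa>\<inverse> \<in> null_sets (completion V)"
      using \<sigma> by (simp add: arveson_measures_on_def V_def)
    ultimately have "r -` (U - Z) \<inter> R \<in> null_sets (completion V)"
      by (rule null_sets_completion_subset)
    \<comment> \<open>This preimage is measurable, so it is null for \<open>V\<close> itself and not
      just for the completion; \<open>V1_le\<close> then applies.\<close>
    then have "r -` (U - Z) \<inter> R \<in> null_sets V"
      using rE[OF UZ] sV(1) by (subst (asm) null_sets_completion_iff) auto
    then have "emeasure V1 (U - Z) = 0" using V1_le[OF UZ] by (simp add: null_setsD1)
    then have "U - Z \<in> null_sets V1" using UZ sV1(1) by (auto simp: null_sets_def)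
    then have "(U - Z) \<union> Z \<in> null_sets (completion V1)"
      using Z by (intro null_sets_completionI null_sets.Un)
    then show ?thesis
      by (rule null_sets_completion_subset[rotated]) (use cover in \<open>auto simp: Z_def\<close>)
  qed
  have "\<sigma>1 \<in> arveson_measures_on Y1 X1 (\<kappa>1\<inverse>)"
    using \<sigma>1 null by (simp add: arveson_measures_on_def V1_def)
  moreover have "\<sigma>1 E \<noteq> 0" using E(2) by (simp add: \<sigma>1_def r_def R_def)
  ultimately show ?thesis
    using \<kappa>1 E(1) compact unfolding operator_M0_set_def T1_def by blast
qed

section \<open>Tensor products\<close>

text \<open>Rectangles form an intersection-stable generator. Passing to complements uses that the
  whole space is itself a rectangle and hence has value 0.\<close>

lemma complex_measure_vanishes_if_rectangles:
  assumes \<sigma>: "complex_measure (M \<Otimes>\<^sub>M N) \<sigma>"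
    and rect: "\<And>A B. A \<in> sets M \<Longrightarrow> B \<in> sets N \<Longrightarrow> \<sigma> (A \<times> B) = 0"
    and E: "E \<in> sets (M \<Otimes>\<^sub>M N)"
  shows "\<sigma> E = 0"
proof -
  let ?G = "{a \<times> b |a b. a \<in> sets M \<and> b \<in> sets N}" and ?\<Omega> = "space M \<times> space N"
  have sig: "sigma_sets ?\<Omega> ?G = sets (M \<Otimes>\<^sub>M N)" by (simp add: sets_pair_measure)
  have "E \<in> sigma_sets ?\<Omega> ?G" using E by (simp add: sig)
  with Int_stable_pair_measure_generator pair_measure_closed show ?thesis
  proof (induct rule: sigma_sets_induct_disjoint)
    case (basic A)
    then show ?case using rect by auto
  next
    case empty
    show ?case using \<sigma> by (rule complex_measure_empty)
  next
    case (compl A)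
    then have A: "A \<in> sets (M \<Otimes>\<^sub>M N)" by (simp add: sig)
    have AO: "A \<subseteq> ?\<Omega>" using sets.sets_into_space[OF A] by (simp add: space_pair_measure)
    have "\<sigma> (A \<union> (?\<Omega> - A)) = \<sigma> A + \<sigma> (?\<Omega> - A)"
      using A by (intro complex_measure_Un[OF \<sigma>]) auto
    moreover have "A \<union> (?\<Omega> - A) = ?\<Omega>" using AO by auto
    ultimately show ?case using rect[of "space M" "space N"] compl(2) by simp
  next
    case (union A)
    then have "(\<lambda>i. \<sigma> (A i)) sums \<sigma> (\<Union>i. A i)"
      by (intro complex_measure_sums[OF \<sigma>]) (auto simp: sig)
    then show ?case using union(3) by (simp add: sums_iff)
  qed
qed

lemma complex_measure_vanishes_if_finite_measure:
  assumes \<sigma>: "complex_measure M \<sigma>" and M: "sigma_finite_measure M"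
    and zero: "\<And>C. C \<in> sets M \<Longrightarrow> emeasure M C < \<infinity> \<Longrightarrow> \<sigma> C = 0" and A: "A \<in> sets M"
  shows "\<sigma> A = 0"
proof -
  interpret sigma_finite_measure M by fact
  obtain S :: "nat \<Rightarrow> _" where S: "range S \<subseteq> sets M" "(\<Union>i. S i) = space M" "\<And>i. emeasure M (S i) \<noteq> \<infinity>"
    "disjoint_family S" by (rule sigma_finite_disjoint) blast
  have "(\<lambda>i. \<sigma> (A \<inter> S i)) sums \<sigma> (\<Union>i. A \<inter> S i)"
  proof (rule complex_measure_sums[OF \<sigma>])
    show "disjoint_family (\<lambda>i. A \<inter> S i)" using S(4) unfolding disjoint_family_on_def by blast
  qed (use S A in auto)
  moreover have "(\<Union>i. A \<inter> S i) = A" using S(2) sets.sets_into_space[OF A] by blast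
  moreover have "\<sigma> (A \<inter> S i) = 0" for i
  proof (rule zero)
    have "emeasure M (A \<inter> S i) \<le> emeasure M (S i)" using S A by (intro emeasure_mono) auto
    also have "\<dots> < \<infinity>" using S(3)[of i] by (simp add: less_top)
    finally show "emeasure M (A \<inter> S i) < \<infinity>" .
  qed (use S A in auto)
  ultimately show ?thesis by (simp add: sums_iff)
qed

text \<open>Preserving unions, intersections and the empty set is enough. This covers maps such as
  \<open>A \<mapsto> (A \<times> A2) \<times> (B1 \<times> B2)\<close>, which let one side of a box
  vary while the others stay fixed.\<close>

lemma complex_measure_vimage:
  assumes \<sigma>: "complex_measure M \<sigma>"
    and F: "\<And>A. A \<in> sets N \<Longrightarrow> F A \<in> sets M" "F {} = {}"
    and UN: "\<And>A::nat \<Rightarrow> _. F (\<Union>i. A i) = (\<Union>i. F (A i))"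
    and Int: "\<And>A B. F (A \<inter> B) = F A \<inter> F B"
  shows "complex_measure N (\<lambda>A. \<sigma> (F A))"
  unfolding complex_measure_def
proof (intro conjI allI impI)
  show "\<sigma> (F {}) = 0" using F(2) complex_measure_empty[OF \<sigma>] by simp
  fix A :: "nat \<Rightarrow> _" assume A: "range A \<subseteq> sets N \<and> disjoint_family A"
  have "disjoint_family (\<lambda>i. F (A i))"
    unfolding disjoint_family_on_def
  proof (intro ballI impI)
    fix m n :: nat assume "m \<noteq> n"
    then have "A m \<inter> A n = {}" using A by (simp add: disjoint_family_on_def)
    then show "F (A m) \<inter> F (A n) = {}" using Int[of "A m" "A n"] F(2) by simp
  qed
  then show "(\<lambda>i. \<sigma> (F (A i))) sums \<sigma> (F (\<Union>i. A i))"
    unfolding UN using A F(1) by (intro complex_measure_sums[OF \<sigma>]) auto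
qed

text \<open>Contraposition, with one coordinate released at a time. Sigma-finiteness removes the
  finiteness condition from each of the four sides; then rectangles generate the arbitrary sets of
  each pair, and finally those of the whole product.\<close>

lemma complex_measure_nonzero_finite_box:
  assumes \<sigma>: "complex_measure ((M1 \<Otimes>\<^sub>M M2) \<Otimes>\<^sub>M (N1 \<Otimes>\<^sub>M N2)) \<sigma>"
    and sf: "sigma_finite_measure M1" "sigma_finite_measure M2" "sigma_finite_measure N1" "sigma_finite_measure N2"
    and E: "E \<in> sets ((M1 \<Otimes>\<^sub>M M2) \<Otimes>\<^sub>M (N1 \<Otimes>\<^sub>M N2))" "\<sigma> E \<noteq> 0"
  obtains A1 A2 B1 B2 where "A1 \<in> sets M1" "A2 \<in> sets M2" "B1 \<in> sets N1" "B2 \<in> sets N2"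
    "emeasure M1 A1 < \<infinity>" "emeasure M2 A2 < \<infinity>" "emeasure N1 B1 < \<infinity>" "emeasure N2 B2 < \<infinity>"
    "\<sigma> ((A1 \<times> A2) \<times> (B1 \<times> B2)) \<noteq> 0"
proof (rule ccontr)
  note box = that
  assume neg: "\<not> thesis"
  have 0: "\<sigma> ((A1 \<times> A2) \<times> (B1 \<times> B2)) = 0" if "A1 \<in> sets M1" "A2 \<in> sets M2" "B1 \<in> sets N1" "B2 \<in> sets N2"
    "emeasure M1 A1 < \<infinity>" "emeasure M2 A2 < \<infinity>" "emeasure N1 B1 < \<infinity>" "emeasure N2 B2 < \<infinity>" for A1 A2 B1 B2
    using box[of A1 A2 B1 B2] neg that by blast
  have 1: "\<sigma> ((A1 \<times> A2) \<times> (B1 \<times> B2)) = 0" if "A1 \<in> sets M1" "A2 \<in> sets M2" "B1 \<in> sets N1" "B2 \<in> sets N2"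
    "emeasure M2 A2 < \<infinity>" "emeasure N1 B1 < \<infinity>" "emeasure N2 B2 < \<infinity>" for A1 A2 B1 B2
    by (rule complex_measure_vanishes_if_finite_measure[OF complex_measure_vimage[OF \<sigma>, of M1 "\<lambda>A. (A \<times> A2) \<times> (B1 \<times> B2)"] sf(1)])
      (use that 0 in auto)
  have 2: "\<sigma> ((A1 \<times> A2) \<times> (B1 \<times> B2)) = 0" if "A1 \<in> sets M1" "A2 \<in> sets M2" "B1 \<in> sets N1" "B2 \<in> sets N2"
    "emeasure N1 B1 < \<infinity>" "emeasure N2 B2 < \<infinity>" for A1 A2 B1 B2
    by (rule complex_measure_vanishes_if_finite_measure[OF complex_measure_vimage[OF \<sigma>, of M2 "\<lambda>A. (A1 \<times> A) \<times> (B1 \<times> B2)"] sf(2)])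
      (use that 1 in auto)
  have 3: "\<sigma> ((A1 \<times> A2) \<times> (B1 \<times> B2)) = 0" if "A1 \<in> sets M1" "A2 \<in> sets M2" "B1 \<in> sets N1" "B2 \<in> sets N2"
    "emeasure N2 B2 < \<infinity>" for A1 A2 B1 B2
    by (rule complex_measure_vanishes_if_finite_measure[OF complex_measure_vimage[OF \<sigma>, of N1 "\<lambda>A. (A1 \<times> A2) \<times> (A \<times> B2)"] sf(3)])
      (use that 2 in auto)
  have 4: "\<sigma> ((A1 \<times> A2) \<times> (B1 \<times> B2)) = 0" if "A1 \<in> sets M1" "A2 \<in> sets M2" "B1 \<in> sets N1" "B2 \<in> sets N2" for A1 A2 B1 B2
    by (rule complex_measure_vanishes_if_finite_measure[OF complex_measure_vimage[OF \<sigma>, of N2 "\<lambda>A. (A1 \<times> A2) \<times> (B1 \<times> A)"] sf(4)])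
      (use that 3 in auto)
  have 5: "\<sigma> (A \<times> (B1 \<times> B2)) = 0" if "A \<in> sets (M1 \<Otimes>\<^sub>M M2)" "B1 \<in> sets N1" "B2 \<in> sets N2" for A B1 B2
    by (rule complex_measure_vanishes_if_rectangles[OF complex_measure_vimage[OF \<sigma>, of "M1 \<Otimes>\<^sub>M M2" "\<lambda>A. A \<times> (B1 \<times> B2)"]])
      (use that 4 in auto)
  have 6: "\<sigma> (A \<times> B) = 0" if "A \<in> sets (M1 \<Otimes>\<^sub>M M2)" "B \<in> sets (N1 \<Otimes>\<^sub>M N2)" for A B
    by (rule complex_measure_vanishes_if_rectangles[OF complex_measure_vimage[OF \<sigma>, of "N1 \<Otimes>\<^sub>M N2" "\<lambda>B. A \<times> B"]])
      (use that 5 in auto)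
  have "\<sigma> E = 0"
    using \<sigma> 6 E(1) by (rule complex_measure_vanishes_if_rectangles)
  with E(2) show False by simp
qed

section \<open>Elementary tensors and their finite sums\<close>

definition tensor :: "('a \<Rightarrow> complex) \<Rightarrow> ('b \<Rightarrow> complex) \<Rightarrow> 'a \<times> 'b \<Rightarrow> complex" where
  "tensor f k = (\<lambda>(x, y). f x * k y)"

text \<open>A function does not determine the summands of which it consists, so the representation
  is kept as a list. Applying operators factorwise is then a \<open>map\<close>, and no question of
  well-definedness arises.\<close>

definition tensor_sum :: "(('a \<Rightarrow> complex) \<times> ('b \<Rightarrow> complex)) list \<Rightarrow> 'a \<times> 'b \<Rightarrow> complex" where
  "tensor_sum xs = (\<lambda>z. \<Sum>(f, k)\<leftarrow>xs. tensor f k z)"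

lemma tensor_sum_Nil: "tensor_sum [] = (\<lambda>z. 0)"
  by (simp add: tensor_sum_def)

lemma tensor_sum_Cons: "tensor_sum ((f, k) # xs) = (\<lambda>z. tensor f k z + tensor_sum xs z)"
  by (simp add: tensor_sum_def)

lemma tensor_sum_append: "tensor_sum (xs @ ys) z = tensor_sum xs z + tensor_sum ys z"
  by (simp add: tensor_sum_def)

lemma tensor_sum_scale: "tensor_sum (map (\<lambda>(f, k). (\<lambda>x. a * f x, k)) xs) z = a * tensor_sum xs z"
  by (induction xs) (auto simp: tensor_sum_Nil tensor_sum_Cons tensor_def split_beta algebra_simps)

text \<open>The general field covers both uses: real squared norms in \<open>tensor_L2\<close> and
  complex pairings in \<open>L2_inner_tensor\<close>.\<close>

lemma integrable_tensor:
  fixes a :: "'a \<Rightarrow> 'c::{banach, second_countable_topology, real_normed_field}"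
  assumes MN: "sigma_finite_measure M" "sigma_finite_measure N"
    and a: "integrable M a" and b: "integrable N b"
  shows "integrable (M \<Otimes>\<^sub>M N) (\<lambda>(x, y). a x * b y)"
    and "(LINT z|(M \<Otimes>\<^sub>M N). (case z of (x, y) \<Rightarrow> a x * b y)) = (LINT x|M. a x) * (LINT y|N. b y)"
proof -
  interpret pair_sigma_finite M N using MN by (simp add: pair_sigma_finite_def)
  have [measurable]: "a \<in> borel_measurable M" "b \<in> borel_measurable N" using a b by auto
  show i: "integrable (M \<Otimes>\<^sub>M N) (\<lambda>(x, y). a x * b y)"
  proof (rule Fubini_integrable)
    show "integrable M (\<lambda>x. \<integral>y. norm (case (x, y) of (x, y) \<Rightarrow> a x * b y) \<partial>N)"
      using a by (simp add: norm_mult)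
    show "AE x in M. integrable N (\<lambda>y. case (x, y) of (x, y) \<Rightarrow> a x * b y)" using b by simp
  qed measurable
  show "(LINT z|(M \<Otimes>\<^sub>M N). (case z of (x, y) \<Rightarrow> a x * b y)) = (LINT x|M. a x) * (LINT y|N. b y)"
    using integral_fst'[OF i] by simp
qed

lemma tensor_L2:
  assumes MN: "sigma_finite_measure M" "sigma_finite_measure N"
    and f: "f \<in> L2 M" and k: "k \<in> L2 N"
  shows "tensor f k \<in> L2 (M \<Otimes>\<^sub>M N)"
proof -
  have [measurable]: "f \<in> borel_measurable M" "k \<in> borel_measurable N" using f k by (auto dest: L2_measurable)
  have "integrable (M \<Otimes>\<^sub>M N) (\<lambda>(x, y). (norm (f x))\<^sup>2 * (norm (k y))\<^sup>2)"
    using f k by (intro integrable_tensor MN) (auto simp: L2_def)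
  then have "integrable (M \<Otimes>\<^sub>M N) (\<lambda>z. (norm (tensor f k z))\<^sup>2)"
    by (rule Bochner_Integration.integrable_cong[OF refl, THEN iffD1, rotated])
      (auto simp: tensor_def norm_mult power_mult_distrib)
  moreover have "tensor f k \<in> borel_measurable (M \<Otimes>\<^sub>M N)"
    unfolding tensor_def by measurable
  ultimately show ?thesis by (simp add: L2_def)
qed

lemma L2_inner_tensor:
  assumes MN: "sigma_finite_measure M" "sigma_finite_measure N"
    and f: "f \<in> L2 M" "f' \<in> L2 M" and k: "k \<in> L2 N" "k' \<in> L2 N"
  shows "L2_inner (M \<Otimes>\<^sub>M N) (tensor f k) (tensor f' k') = L2_inner M f f' * L2_inner N k k'"
proof -
  have "L2_inner (M \<Otimes>\<^sub>M N) (tensor f k) (tensor f' k')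
      = (LINT z|(M \<Otimes>\<^sub>M N). (case z of (x, y) \<Rightarrow> (f x * cnj (f' x)) * (k y * cnj (k' y))))"
    unfolding L2_inner_def tensor_def by (intro Bochner_Integration.integral_cong) (auto simp: mult_ac)
  then show ?thesis
    using integrable_tensor(2)[OF MN L2_mult_integrable[OF f] L2_mult_integrable[OF k]]
    by (simp add: L2_inner_def)
qed

lemma tensor_sum_L2:
  assumes MN: "sigma_finite_measure M" "sigma_finite_measure N"
    and xs: "set xs \<subseteq> L2 M \<times> L2 N"
  shows "tensor_sum xs \<in> L2 (M \<Otimes>\<^sub>M N)"
  using xs
proof (induction xs)
  case (Cons a xs)
  then show ?case
    by (cases a) (auto simp: tensor_sum_Cons intro!: L2_add tensor_L2 MN)
qed (simp add: tensor_sum_Nil)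

lemma L2_indicator: "A \<in> sets M \<Longrightarrow> emeasure M A < \<infinity> \<Longrightarrow> indicator A \<in> L2 M"
  unfolding L2_iff_nn_integral
proof
  assume A: "A \<in> sets M" "emeasure M A < \<infinity>"
  show "indicator A \<in> borel_measurable M" using A by simp
  have "(\<integral>\<^sup>+x. (ennreal (norm (indicator A x :: complex)))\<^sup>2 \<partial>M) = (\<integral>\<^sup>+x. indicator A x \<partial>M)"
    by (intro nn_integral_cong) (auto split: split_indicator)
  then show "(\<integral>\<^sup>+x. (ennreal (norm (indicator A x :: complex)))\<^sup>2 \<partial>M) < \<infinity>" using A by simp
qed

text \<open>On a box with sides of finite measure \<open>u\<close> is integrable, being multiplied
  by a square integrable indicator. Its set integrals there form a complex measure that vanishes on
  rectangles, hence everywhere. Countably many such boxes cover the product.\<close>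

lemma L2_eq_0_if_orthogonal_rectangles:
  assumes MN: "sigma_finite_measure M" "sigma_finite_measure N"
    and u: "u \<in> L2 (M \<Otimes>\<^sub>M N)"
    and orth: "\<And>A B. A \<in> sets M \<Longrightarrow> B \<in> sets N \<Longrightarrow> emeasure M A < \<infinity> \<Longrightarrow> emeasure N B < \<infinity> \<Longrightarrow>
      L2_inner (M \<Otimes>\<^sub>M N) u (tensor (indicator A) (indicator B)) = 0"
  shows "AE z in M \<Otimes>\<^sub>M N. u z = 0"
proof -
  interpret M: sigma_finite_measure M by fact
  interpret N: sigma_finite_measure N by fact
  interpret pair_sigma_finite M N ..
  let ?P = "M \<Otimes>\<^sub>M N"
  obtain S :: "nat \<Rightarrow> _" where S: "range S \<subseteq> sets M" "(\<Union>i. S i) = space M" "\<And>i. emeasure M (S i) \<noteq> \<infinity>"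
    by (rule M.sigma_finite) blast
  obtain R :: "nat \<Rightarrow> _" where R: "range R \<subseteq> sets N" "(\<Union>i. R i) = space N" "\<And>i. emeasure N (R i) \<noteq> \<infinity>"
    by (rule N.sigma_finite) blast
  have box: "AE z in ?P. indicator (S i \<times> R j) z *\<^sub>R u z = 0" for i j
  proof -
    let ?v = "\<lambda>z. indicator (S i \<times> R j) z *\<^sub>R u z"
    have SR: "S i \<in> sets M" "R j \<in> sets N" using S R by auto
    have int: "integrable ?P (\<lambda>z. u z * cnj (tensor (indicator A) (indicator B) z))"
      if "A \<in> sets M" "B \<in> sets N" "emeasure M A < \<infinity>" "emeasure N B < \<infinity>" for A B
      using that by (intro L2_mult_integrable u tensor_L2 MN L2_indicator)
    have v: "?v = (\<lambda>z. u z * cnj (tensor (indicator (S i)) (indicator (R j)) z))"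
      by (auto simp: fun_eq_iff tensor_def indicator_def)
    have iv: "integrable ?P ?v"
      unfolding v using SR S(3) R(3) by (intro int) (auto simp: less_top)
    have "sigma_finite_measure ?P" ..
    then show ?thesis
    proof (rule sigma_finite_measure.density_zero[OF _ iv])
      fix E assume "E \<in> sets ?P"
      then show "(LINT z:E|?P. ?v z) = 0"
      proof (rule complex_measure_vanishes_if_rectangles[OF complex_measure_set_integral[OF refl iv], rotated])
        fix A B assume AB: "A \<in> sets M" "B \<in> sets N"
        have fin: "emeasure M (A \<inter> S i) < \<infinity>" "emeasure N (B \<inter> R j) < \<infinity>"
          using AB SR S(3)[of i] R(3)[of j] emeasure_mono[of "A \<inter> S i" "S i" M] emeasure_mono[of "B \<inter> R j" "R j" N]
          by (auto simp: less_top[symmetric] top_unique)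
        have "(LINT z:A \<times> B|?P. ?v z) = L2_inner ?P u (tensor (indicator (A \<inter> S i)) (indicator (B \<inter> R j)))"
          unfolding set_lebesgue_integral_def L2_inner_def tensor_def
          by (intro Bochner_Integration.integral_cong) (auto simp: indicator_def)
        also have "\<dots> = 0" using AB SR fin by (intro orth) auto
        finally show "(LINT z:A \<times> B|?P. ?v z) = 0" .
      qed
    qed
  qed
  have "AE z in ?P. \<forall>i j. indicator (S i \<times> R j) z *\<^sub>R u z = 0"
    unfolding AE_all_countable by (intro allI box)
  then show ?thesis
  proof (rule AE_mp, intro AE_I2 impI)
    fix z assume z: "z \<in> space ?P" and 0: "\<forall>i j. indicator (S i \<times> R j) z *\<^sub>R u z = 0"
    have "fst z \<in> (\<Union>i. S i)" "snd z \<in> (\<Union>j. R j)"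
      using z S(2) R(2) by (auto simp: space_pair_measure)
    then obtain i j where "z \<in> S i \<times> R j" by (auto simp: mem_Times_iff)
    then show "u z = 0" using 0[rule_format, of i j] by simp
  qed
qed

text \<open>Indicators of rectangles with finite sides are one-term tensor sums, so only null
  functions are orthogonal to all tensor sums, and the density criterion applies.\<close>

lemma tensor_sums_dense:
  assumes MN: "sigma_finite_measure M" "sigma_finite_measure N"
    and h: "h \<in> L2 (M \<Otimes>\<^sub>M N)"
  obtains xs where "\<And>n::nat. set (xs n) \<subseteq> L2 M \<times> L2 N"
    "(\<lambda>n. L2_norm (M \<Otimes>\<^sub>M N) (\<lambda>z. tensor_sum (xs n) z - h z)) \<longlonglongrightarrow> 0"
proof -
  define S where "S = tensor_sum ` {xs. set xs \<subseteq> L2 M \<times> L2 N}"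
  obtain F where F: "\<And>n::nat. F n \<in> S" "(\<lambda>n. L2_norm (M \<Otimes>\<^sub>M N) (\<lambda>z. F n z - h z)) \<longlonglongrightarrow> 0"
  proof (rule L2_dense_if_orthogonal_trivial[of S "M \<Otimes>\<^sub>M N" h])
    show "S \<subseteq> L2 (M \<Otimes>\<^sub>M N)" using tensor_sum_L2[OF MN] by (auto simp: S_def)
    show "(\<lambda>z. 0) \<in> S" unfolding S_def by (rule image_eqI[of _ _ "[]"]) (auto simp: tensor_sum_Nil)
    show "(\<lambda>z. a * f z + b * g z) \<in> S" if fg: "f \<in> S" "g \<in> S" for f g a b
    proof -
      obtain xs ys where xy: "set xs \<subseteq> L2 M \<times> L2 N" "set ys \<subseteq> L2 M \<times> L2 N" "f = tensor_sum xs" "g = tensor_sum ys"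
        using fg unfolding S_def by blast
      let ?s = "\<lambda>a. map (\<lambda>(f, k). (\<lambda>x. a * f x, k))"
      show ?thesis
        unfolding S_def
      proof (rule image_eqI)
        show "(\<lambda>z. a * f z + b * g z) = tensor_sum (?s a xs @ ?s b ys)"
          by (simp add: fun_eq_iff tensor_sum_append tensor_sum_scale xy)
        show "?s a xs @ ?s b ys \<in> {xs. set xs \<subseteq> L2 M \<times> L2 N}"
          using xy by (auto intro!: L2_scale)
      qed
    qed
    show "AE z in M \<Otimes>\<^sub>M N. u z = 0"
      if u: "u \<in> L2 (M \<Otimes>\<^sub>M N)" and orth: "\<And>g. g \<in> S \<Longrightarrow> L2_inner (M \<Otimes>\<^sub>M N) u g = 0" for u
    proof (rule L2_eq_0_if_orthogonal_rectangles[OF MN u])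
      fix A B assume "A \<in> sets M" "B \<in> sets N" "emeasure M A < \<infinity>" "emeasure N B < \<infinity>"
      then show "L2_inner (M \<Otimes>\<^sub>M N) u (tensor (indicator A) (indicator B)) = 0"
        unfolding S_def
        by (intro orth[unfolded S_def] image_eqI[of _ _ "[(indicator A, indicator B)]"])
          (auto simp: tensor_sum_Cons tensor_sum_Nil intro: L2_indicator)
    qed
    fix F assume "\<And>n::nat. F n \<in> S" "(\<lambda>n. L2_norm (M \<Otimes>\<^sub>M N) (\<lambda>z. F n z - h z)) \<longlonglongrightarrow> 0"
    then show thesis by (rule that)
  qed (rule h)
  have "\<exists>xs. set xs \<subseteq> L2 M \<times> L2 N \<and> F n = tensor_sum xs" for n
    using F(1)[of n] by (auto simp: S_def)
  then obtain xs where "\<And>n. set (xs n) \<subseteq> L2 M \<times> L2 N" "\<And>n. F n = tensor_sum (xs n)" by metis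
  with F(2) show ?thesis by (intro that[of xs]) simp_all
qed

text \<open>With \<open>c = k z\<close> both sums are slices of tensor sums at a fixed second
  coordinate \<open>z\<close>.\<close>

lemma bounded_L2_operator_sum_list:
  assumes A: "bounded_L2_operator M M' A" and xs: "set xs \<subseteq> L2 M \<times> UNIV"
  shows "(\<lambda>x. \<Sum>(f, c)\<leftarrow>xs. f x * c) \<in> L2 M \<and>
    (AE y in M'. A (\<lambda>x. \<Sum>(f, c)\<leftarrow>xs. f x * c) y = (\<Sum>(f, c)\<leftarrow>xs. A f y * c))"
  using xs
proof (induction xs)
  case Nil
  show ?case using bounded_L2_operator_lincomb[OF A L2_zero L2_zero, of 0 0] by simp
next
  case (Cons a xs)
  obtain f c where a: "a = (f, c)" by fastforce
  have f: "f \<in> L2 M" using Cons(2) a by simp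
  let ?g = "\<lambda>x. \<Sum>(f, c)\<leftarrow>xs. f x * c"
  have g: "?g \<in> L2 M" "AE y in M'. A ?g y = (\<Sum>(f, c)\<leftarrow>xs. A f y * c)" using Cons by auto
  have e: "(\<lambda>x. \<Sum>(f, c)\<leftarrow>a # xs. f x * c) = (\<lambda>x. c * f x + 1 * ?g x)"
    by (simp add: a mult.commute)
  show ?case
    unfolding e
  proof
    show "(\<lambda>x. c * f x + 1 * ?g x) \<in> L2 M" using f g by (intro L2_lincomb)
    have "AE y in M'. A (\<lambda>x. c * f x + 1 * ?g x) y = c * A f y + 1 * A ?g y"
      using A f g(1) by (rule bounded_L2_operator_lincomb)
    then show "AE y in M'. A (\<lambda>x. c * f x + 1 * ?g x) y = (\<Sum>(f, c)\<leftarrow>a # xs. A f y * c)"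
      using g(2) by eventually_elim (simp add: a mult.commute)
  qed
qed

text \<open>For fixed \<open>z\<close> in the second factor a tensor sum is a finite linear combination of its first
  components, so the operator norm bound can be applied slice by slice and then integrated.\<close>

lemma tensor_sum_map_fst_bound:
  assumes sf: "sigma_finite_measure M" "sigma_finite_measure M'" "sigma_finite_measure N"
    and A: "bounded_L2_operator M M' A" and bound: "\<And>f. f \<in> L2 M \<Longrightarrow> L2_norm M' (A f) \<le> \<alpha> * L2_norm M f"
    and \<alpha>: "0 \<le> \<alpha>" and xs: "set xs \<subseteq> L2 M \<times> L2 N"
  shows "L2_norm (M' \<Otimes>\<^sub>M N) (tensor_sum (map (\<lambda>(f, k). (A f, k)) xs)) \<le> \<alpha> * L2_norm (M \<Otimes>\<^sub>M N) (tensor_sum xs)"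
proof -
  interpret MN: pair_sigma_finite M N using sf by (simp add: pair_sigma_finite_def)
  interpret MN': pair_sigma_finite M' N using sf by (simp add: pair_sigma_finite_def)
  let ?ys = "map (\<lambda>(f, k). (A f, k)) xs"
  have ys: "set ?ys \<subseteq> L2 M' \<times> L2 N" using xs bounded_L2_operator_L2[OF A] by auto
  have L: "tensor_sum xs \<in> L2 (M \<Otimes>\<^sub>M N)" "tensor_sum ?ys \<in> L2 (M' \<Otimes>\<^sub>M N)"
    using tensor_sum_L2[OF sf(1,3) xs] tensor_sum_L2[OF sf(2,3) ys] .
  note [measurable] = L[THEN L2_measurable]
  \<comment> \<open>This holds for every \<open>z\<close>. The exceptional null set in
    \<open>y\<close> depends on \<open>z\<close>, but it disappears with the inner integral before
    \<open>z\<close> is integrated.\<close>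
  have slice: "(\<integral>\<^sup>+y. (ennreal (norm (tensor_sum ?ys (y, z))))\<^sup>2 \<partial>M')
      \<le> ennreal (\<alpha>\<^sup>2) * (\<integral>\<^sup>+x. (ennreal (norm (tensor_sum xs (x, z))))\<^sup>2 \<partial>M)" for z
  proof -
    let ?cs = "map (\<lambda>(f, k). (f, k z)) xs"
    let ?g = "\<lambda>x. \<Sum>(f, c)\<leftarrow>?cs. f x * c"
    have g: "?g \<in> L2 M" and ae: "AE y in M'. A ?g y = (\<Sum>(f, c)\<leftarrow>?cs. A f y * c)"
    proof -
      have "set ?cs \<subseteq> L2 M \<times> UNIV" using xs by auto
      from bounded_L2_operator_sum_list[OF A this]
      show "?g \<in> L2 M" "AE y in M'. A ?g y = (\<Sum>(f, c)\<leftarrow>?cs. A f y * c)" by blast+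
    qed
    have g_eq: "?g x = tensor_sum xs (x, z)" for x
      by (simp add: tensor_sum_def tensor_def case_prod_unfold comp_def)
    have Ag_eq: "(\<Sum>(f, c)\<leftarrow>?cs. A f y * c) = tensor_sum ?ys (y, z)" for y
      by (simp add: tensor_sum_def tensor_def case_prod_unfold comp_def)
    have "(\<integral>\<^sup>+y. (ennreal (norm (tensor_sum ?ys (y, z))))\<^sup>2 \<partial>M') = (\<integral>\<^sup>+y. (ennreal (norm (A ?g y)))\<^sup>2 \<partial>M')"
      using ae unfolding Ag_eq by (intro nn_integral_cong_AE) auto
    also have "\<dots> = ennreal ((L2_norm M' (A ?g))\<^sup>2)"
      by (rule nn_integral_L2[OF bounded_L2_operator_L2[OF A g]])
    also have "\<dots> \<le> ennreal ((\<alpha> * L2_norm M ?g)\<^sup>2)"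
      by (intro ennreal_leI power_mono bound g) simp
    also have "\<dots> = ennreal (\<alpha>\<^sup>2) * ennreal ((L2_norm M ?g)\<^sup>2)"
      by (simp only: power_mult_distrib) (rule ennreal_mult; simp)
    also have "ennreal ((L2_norm M ?g)\<^sup>2) = (\<integral>\<^sup>+x. (ennreal (norm (?g x)))\<^sup>2 \<partial>M)"
      by (rule nn_integral_L2[OF g, symmetric])
    finally show ?thesis unfolding g_eq .
  qed
  have "ennreal ((L2_norm (M' \<Otimes>\<^sub>M N) (tensor_sum ?ys))\<^sup>2)
      = (\<integral>\<^sup>+z. (ennreal (norm (tensor_sum ?ys z)))\<^sup>2 \<partial>(M' \<Otimes>\<^sub>M N))"
    by (rule nn_integral_L2[OF L(2), symmetric])
  also have "\<dots> = (\<integral>\<^sup>+z. \<integral>\<^sup>+y. (ennreal (norm (tensor_sum ?ys (y, z))))\<^sup>2 \<partial>M' \<partial>N)"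
    by (rule MN'.nn_integral_snd[symmetric]) measurable
  also have "\<dots> \<le> (\<integral>\<^sup>+z. ennreal (\<alpha>\<^sup>2) * (\<integral>\<^sup>+x. (ennreal (norm (tensor_sum xs (x, z))))\<^sup>2 \<partial>M) \<partial>N)"
    by (intro nn_integral_mono slice)
  also have "\<dots> = ennreal (\<alpha>\<^sup>2) * (\<integral>\<^sup>+z. \<integral>\<^sup>+x. (ennreal (norm (tensor_sum xs (x, z))))\<^sup>2 \<partial>M \<partial>N)"
    by (rule nn_integral_cmult) measurable
  also have "(\<integral>\<^sup>+z. \<integral>\<^sup>+x. (ennreal (norm (tensor_sum xs (x, z))))\<^sup>2 \<partial>M \<partial>N)
      = (\<integral>\<^sup>+z. (ennreal (norm (tensor_sum xs z)))\<^sup>2 \<partial>(M \<Otimes>\<^sub>M N))"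
    by (rule MN.nn_integral_snd) measurable
  also have "\<dots> = ennreal ((L2_norm (M \<Otimes>\<^sub>M N) (tensor_sum xs))\<^sup>2)"
    by (rule nn_integral_L2[OF L(1)])
  also have "ennreal (\<alpha>\<^sup>2) * \<dots> = ennreal ((\<alpha> * L2_norm (M \<Otimes>\<^sub>M N) (tensor_sum xs))\<^sup>2)"
    by (simp only: power_mult_distrib) (rule ennreal_mult[symmetric]; simp)
  finally have "(L2_norm (M' \<Otimes>\<^sub>M N) (tensor_sum ?ys))\<^sup>2 \<le> (\<alpha> * L2_norm (M \<Otimes>\<^sub>M N) (tensor_sum xs))\<^sup>2"
    by (simp add: ennreal_le_iff)
  then show ?thesis by (rule power2_le_imp_le) (use \<alpha> in simp)
qed

lemma L2_norm_tensor_sum_swap: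
  assumes MN: "sigma_finite_measure M" "sigma_finite_measure N" and xs: "set xs \<subseteq> L2 M \<times> L2 N"
  shows "L2_norm (N \<Otimes>\<^sub>M M) (tensor_sum (map prod.swap xs)) = L2_norm (M \<Otimes>\<^sub>M N) (tensor_sum xs)"
proof -
  interpret pair_sigma_finite M N using MN by (simp add: pair_sigma_finite_def)
  have [measurable]: "tensor_sum xs \<in> borel_measurable (M \<Otimes>\<^sub>M N)"
    using tensor_sum_L2[OF MN xs] by (rule L2_measurable)
  have eq: "tensor_sum (map prod.swap xs) (y, x) = tensor_sum xs (x, y)" for x y
    by (induction xs) (auto simp: tensor_sum_Nil tensor_sum_Cons tensor_def)
  have "(LINT z|(N \<Otimes>\<^sub>M M). (norm (tensor_sum (map prod.swap xs) z))\<^sup>2)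
      = (LINT (y, x)|(N \<Otimes>\<^sub>M M). (norm (tensor_sum xs (x, y)))\<^sup>2)"
    by (intro Bochner_Integration.integral_cong) (auto simp: eq)
  also have "\<dots> = (LINT z|(M \<Otimes>\<^sub>M N). (norm (tensor_sum xs z))\<^sup>2)"
    by (rule integral_product_swap) measurable
  finally show ?thesis by (simp add: L2_norm_def)
qed

lemma tensor_sum_map_snd_bound:
  assumes sf: "sigma_finite_measure M" "sigma_finite_measure N" "sigma_finite_measure N'"
    and A: "bounded_L2_operator N N' A" and bound: "\<And>f. f \<in> L2 N \<Longrightarrow> L2_norm N' (A f) \<le> \<alpha> * L2_norm N f"
    and \<alpha>: "0 \<le> \<alpha>" and xs: "set xs \<subseteq> L2 M \<times> L2 N"
  shows "L2_norm (M \<Otimes>\<^sub>M N') (tensor_sum (map (\<lambda>(f, k). (f, A k)) xs)) \<le> \<alpha> * L2_norm (M \<Otimes>\<^sub>M N) (tensor_sum xs)"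
proof -
  let ?ys = "map (\<lambda>(f, k). (f, A k)) xs"
  have ys: "set ?ys \<subseteq> L2 M \<times> L2 N'" using xs bounded_L2_operator_L2[OF A] by auto
  have "L2_norm (M \<Otimes>\<^sub>M N') (tensor_sum ?ys) = L2_norm (N' \<Otimes>\<^sub>M M) (tensor_sum (map prod.swap ?ys))"
    by (rule L2_norm_tensor_sum_swap[OF sf(1,3) ys, symmetric])
  also have "map prod.swap ?ys = map (\<lambda>(k, f). (A k, f)) (map prod.swap xs)" by auto
  also have "L2_norm (N' \<Otimes>\<^sub>M M) (tensor_sum \<dots>) \<le> \<alpha> * L2_norm (N \<Otimes>\<^sub>M M) (tensor_sum (map prod.swap xs))"
    using xs by (intro tensor_sum_map_fst_bound[OF sf(2,3,1) A bound \<alpha>]) auto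
  also have "L2_norm (N \<Otimes>\<^sub>M M) (tensor_sum (map prod.swap xs)) = L2_norm (M \<Otimes>\<^sub>M N) (tensor_sum xs)"
    by (rule L2_norm_tensor_sum_swap[OF sf(1,2) xs])
  finally show ?thesis .
qed

section \<open>Projections and compactness on tensor products\<close>

lemma bounded_L2_operator_proj:
  assumes T: "bounded_L2_operator M N T" and E: "L2_orthonormal N E"
  shows "bounded_L2_operator M N (\<lambda>f y. T f y - L2_proj N E (T f) y)"
    and "bounded_L2_operator M N (\<lambda>f. L2_proj N E (T f))"
proof -
  have EL2: "E \<subseteq> L2 N" using E by (simp add: L2_orthonormal_def)
  note TL2 = bounded_L2_operator_L2[OF T]
  obtain C where C: "0 < C" "\<And>f. f \<in> L2 M \<Longrightarrow> L2_norm N (T f) \<le> C * L2_norm M f"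
    using T by (rule bounded_L2_operator_bound) blast
  have P: "L2_proj N E (T (\<lambda>x. a * f x + b * g x)) = (\<lambda>y. a * L2_proj N E (T f) y + b * L2_proj N E (T g) y)"
    if fg: "f \<in> L2 M" "g \<in> L2 M" for f g a b
    using L2_proj_cong_AE[OF EL2 TL2[OF L2_lincomb[OF fg]] L2_lincomb[OF TL2[OF fg(1)] TL2[OF fg(2)]] bounded_L2_operator_lincomb[OF T fg]]
      L2_proj_lincomb[OF EL2 TL2[OF fg(1)] TL2[OF fg(2)]] by simp
  have b1: "L2_norm N (\<lambda>y. T f y - L2_proj N E (T f) y) \<le> C * L2_norm M f" if "f \<in> L2 M" for f
    using L2_norm_minus_proj_le[OF E TL2[OF that]] C(2)[OF that] by linarith
  have b2: "L2_norm N (L2_proj N E (T f)) \<le> (2 * C) * L2_norm M f" if f: "f \<in> L2 M" for f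
  proof -
    have "L2_norm N (L2_proj N E (T f)) \<le> L2_norm N (\<lambda>y. L2_proj N E (T f) y - T f y) + L2_norm N (T f)"
      using L2_proj_L2[OF EL2] TL2[OF f] by (rule L2_norm_le_diff_add)
    also have "L2_norm N (\<lambda>y. L2_proj N E (T f) y - T f y) = L2_norm N (\<lambda>y. T f y - L2_proj N E (T f) y)"
      by (rule L2_norm_minus_commute)
    finally show ?thesis using b1[OF f] C(2)[OF f] by simp
  qed
  show "bounded_L2_operator M N (\<lambda>f. L2_proj N E (T f))"
    unfolding bounded_L2_operator_def using P b2 L2_proj_L2[OF EL2] by fastforce
  show "bounded_L2_operator M N (\<lambda>f y. T f y - L2_proj N E (T f) y)"
    unfolding bounded_L2_operator_def
  proof (intro conjI ballI allI)
    show "AE y in N. T (\<lambda>x. a * f x + b * g x) y - L2_proj N E (T (\<lambda>x. a * f x + b * g x)) y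
        = a * (T f y - L2_proj N E (T f) y) + b * (T g y - L2_proj N E (T g) y)"
      if fg: "f \<in> L2 M" "g \<in> L2 M" for f g a b
      using bounded_L2_operator_lincomb[OF T fg, of a b] unfolding P[OF fg]
      by eventually_elim (simp add: algebra_simps)
    show "\<exists>C. \<forall>f\<in>L2 M. L2_norm N (\<lambda>y. T f y - L2_proj N E (T f) y) \<le> C * L2_norm M f"
      using b1 by blast
  qed (use L2_diff[OF TL2 L2_proj_L2[OF EL2]] in blast)
qed

text \<open>Pairings of tensors factor, so distinct pairs give 0 and equal pairs give 1; both claims
  follow. Injectivity matters because \<open>L2_proj\<close> sums over a set, where coinciding
  tensors would be counted once.\<close>

lemma L2_orthonormal_tensor:
  assumes sf: "sigma_finite_measure M" "sigma_finite_measure N"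
    and E: "L2_orthonormal M E" and D: "L2_orthonormal N D"
  shows "L2_orthonormal (M \<Otimes>\<^sub>M N) (case_prod tensor ` (E \<times> D))" "inj_on (case_prod tensor) (E \<times> D)"
proof -
  have fin: "finite E" "finite D" and L: "\<And>e. e \<in> E \<Longrightarrow> e \<in> L2 M" "\<And>d. d \<in> D \<Longrightarrow> d \<in> L2 N"
    using E D by (auto simp: L2_orthonormal_def)
  have inE: "L2_inner M e e' = (if e = e' then 1 else 0)" if "e \<in> E" "e' \<in> E" for e e'
    using E that by (auto simp: L2_orthonormal_def L2_inner_self)
  have inD: "L2_inner N d d' = (if d = d' then 1 else 0)" if "d \<in> D" "d' \<in> D" for d d'
    using D that by (auto simp: L2_orthonormal_def L2_inner_self)
  have inn: "L2_inner (M \<Otimes>\<^sub>M N) (tensor e d) (tensor e' d') = (if e = e' \<and> d = d' then 1 else 0)"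
    if "e \<in> E" "e' \<in> E" "d \<in> D" "d' \<in> D" for e e' d d'
    using that by (simp add: L2_inner_tensor[OF sf] L inE inD)
  show inj: "inj_on (case_prod tensor) (E \<times> D)"
  proof (rule inj_onI, clarify)
    fix e d e' d' assume *: "e \<in> E" "d \<in> D" "e' \<in> E" "d' \<in> D" and eq: "tensor e d = tensor e' d'"
    have "L2_inner (M \<Otimes>\<^sub>M N) (tensor e d) (tensor e' d') = 1"
      unfolding eq using * inn[of e' e' d' d'] by simp
    then show "e = e' \<and> d = d'" using inn[of e e' d d'] * by (simp split: if_splits)
  qed
  have n1: "L2_norm (M \<Otimes>\<^sub>M N) (tensor e d) = 1" if "e \<in> E" "d \<in> D" for e d
  proof -
    have "(L2_norm (M \<Otimes>\<^sub>M N) (tensor e d))\<^sup>2 = 1"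
      unfolding L2_norm_sq using inn[of e e d d] that by simp
    then show ?thesis by (metis L2_norm_nonneg power2_eq_iff_nonneg one_power2 zero_le_one)
  qed
  show "L2_orthonormal (M \<Otimes>\<^sub>M N) (case_prod tensor ` (E \<times> D))"
    unfolding L2_orthonormal_def
  proof (intro conjI ballI impI)
    show "finite (case_prod tensor ` (E \<times> D))" using fin by simp
    show "case_prod tensor ` (E \<times> D) \<subseteq> L2 (M \<Otimes>\<^sub>M N)" using L tensor_L2[OF sf] by auto
    show "L2_norm (M \<Otimes>\<^sub>M N) t = 1" if "t \<in> case_prod tensor ` (E \<times> D)" for t
      using that n1 by auto
    show "L2_inner (M \<Otimes>\<^sub>M N) s t = 0" if "s \<in> case_prod tensor ` (E \<times> D)" "t \<in> case_prod tensor ` (E \<times> D)" "s \<noteq> t" for s t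
      using that inn by auto
  qed
qed

text \<open>The coefficient of \<open>tensor f k\<close> against \<open>tensor e d\<close> is a
  product, so the double sum splits. Coefficients being numbers, this is an equality of functions,
  without exceptional set.\<close>

lemma L2_proj_tensor_sum:
  assumes sf: "sigma_finite_measure M" "sigma_finite_measure N"
    and E: "L2_orthonormal M E" and D: "L2_orthonormal N D" and xs: "set xs \<subseteq> L2 M \<times> L2 N"
  shows "L2_proj (M \<Otimes>\<^sub>M N) (case_prod tensor ` (E \<times> D)) (tensor_sum xs)
    = tensor_sum (map (\<lambda>(f, k). (L2_proj M E f, L2_proj N D k)) xs)"
  using xs
proof (induction xs)
  case Nil
  then show ?case by (simp add: tensor_sum_Nil L2_proj_def L2_inner_def)
next
  case (Cons a xs)
  let ?Q = "L2_proj (M \<Otimes>\<^sub>M N) (case_prod tensor ` (E \<times> D))"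
  have L: "\<And>e. e \<in> E \<Longrightarrow> e \<in> L2 M" "\<And>d. d \<in> D \<Longrightarrow> d \<in> L2 N"
    using E D by (auto simp: L2_orthonormal_def)
  obtain f k where a: "a = (f, k)" and fk: "f \<in> L2 M" "k \<in> L2 N" using Cons(2) by (cases a) auto
  have EL2: "case_prod tensor ` (E \<times> D) \<subseteq> L2 (M \<Otimes>\<^sub>M N)"
    using L2_orthonormal_tensor(1)[OF sf E D] by (simp add: L2_orthonormal_def)
  have "?Q (tensor f k) = tensor (L2_proj M E f) (L2_proj N D k)"
  proof
    fix z :: "'a \<times> 'b" obtain x y where z: "z = (x, y)" by fastforce
    have "?Q (tensor f k) z = (\<Sum>(e, d)\<in>E \<times> D. L2_inner (M \<Otimes>\<^sub>M N) (tensor f k) (tensor e d) * tensor e d z)"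
      unfolding L2_proj_def by (subst sum.reindex[OF L2_orthonormal_tensor(2)[OF sf E D]]) (simp add: split_beta comp_def)
    also have "\<dots> = (\<Sum>(e, d)\<in>E \<times> D. (L2_inner M f e * e x) * (L2_inner N k d * d y))"
    proof -
      have "tensor e d z = e x * d y" for e :: "'a \<Rightarrow> complex" and d :: "'b \<Rightarrow> complex"
        by (simp add: tensor_def z)
      then show ?thesis by (intro sum.cong) (auto simp: L2_inner_tensor[OF sf] fk L)
    qed
    also have "\<dots> = (\<Sum>e\<in>E. L2_inner M f e * e x) * (\<Sum>d\<in>D. L2_inner N k d * d y)"
      by (simp add: sum_product sum.cartesian_product)
    also have "\<dots> = tensor (L2_proj M E f) (L2_proj N D k) z"
      by (simp add: tensor_def L2_proj_def z)
    finally show "?Q (tensor f k) z = tensor (L2_proj M E f) (L2_proj N D k) z" .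
  qed
  moreover have "?Q (\<lambda>z. 1 * tensor f k z + 1 * tensor_sum xs z) = (\<lambda>z. 1 * ?Q (tensor f k) z + 1 * ?Q (tensor_sum xs) z)"
    using Cons(2) by (intro L2_proj_lincomb[OF EL2] tensor_L2[OF sf] tensor_sum_L2[OF sf] fk) auto
  ultimately show ?case using Cons by (simp add: a tensor_sum_Cons)
qed

text \<open>\<open>T\<close> is given only by pairings of elementary tensors. Rectangles separate
  functions, so these pairings fix \<open>T\<close> on elementary tensors and, by linearity, on
  tensor sums. The estimate is made there and extended by density.\<close>

theorem compact_L2_operator_tensor:
  assumes sf: "sigma_finite_measure X1" "sigma_finite_measure X2" "sigma_finite_measure Y1" "sigma_finite_measure Y2"
    and T: "bounded_L2_operator (X1 \<Otimes>\<^sub>M X2) (Y1 \<Otimes>\<^sub>M Y2) T"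
    and T1: "compact_L2_operator X1 Y1 T1" and T2: "compact_L2_operator X2 Y2 T2"
    and pairing: "\<And>f1 f2 g1 g2. f1 \<in> L2 X1 \<Longrightarrow> f2 \<in> L2 X2 \<Longrightarrow> g1 \<in> L2 Y1 \<Longrightarrow> g2 \<in> L2 Y2 \<Longrightarrow>
      L2_inner (Y1 \<Otimes>\<^sub>M Y2) (T (tensor f1 f2)) (tensor g1 g2) = L2_inner Y1 (T1 f1) g1 * L2_inner Y2 (T2 f2) g2"
  shows "compact_L2_operator (X1 \<Otimes>\<^sub>M X2) (Y1 \<Otimes>\<^sub>M Y2) T"
proof (rule finite_rank_approx_imp_compact_L2_operator[OF T])
  let ?X = "X1 \<Otimes>\<^sub>M X2" and ?Y = "Y1 \<Otimes>\<^sub>M Y2"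
  have bT1: "bounded_L2_operator X1 Y1 T1" and bT2: "bounded_L2_operator X2 Y2 T2"
    using T1 T2 by (auto simp: compact_L2_operator_def)
  note TL2 = bounded_L2_operator_L2[OF T]
  note T1L2 = bounded_L2_operator_L2[OF bT1] and T2L2 = bounded_L2_operator_L2[OF bT2]
  have elem: "AE z in ?Y. T (tensor f k) z = tensor (T1 f) (T2 k) z" if fk: "f \<in> L2 X1" "k \<in> L2 X2" for f k
  proof -
    have L: "T (tensor f k) \<in> L2 ?Y" "tensor (T1 f) (T2 k) \<in> L2 ?Y"
      using fk T1L2 T2L2 by (auto intro!: TL2 tensor_L2 sf)
    have "AE z in ?Y. T (tensor f k) z - tensor (T1 f) (T2 k) z = 0"
    proof (rule L2_eq_0_if_orthogonal_rectangles[OF sf(3,4) L2_diff[OF L]])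
      fix A B assume AB: "A \<in> sets Y1" "B \<in> sets Y2" "emeasure Y1 A < \<infinity>" "emeasure Y2 B < \<infinity>"
      then have i: "indicator A \<in> L2 Y1" "indicator B \<in> L2 Y2" by (auto intro: L2_indicator)
      show "L2_inner ?Y (\<lambda>z. T (tensor f k) z - tensor (T1 f) (T2 k) z) (tensor (indicator A) (indicator B)) = 0"
        using pairing[OF fk i] L2_inner_tensor[OF sf(3,4) T1L2[OF fk(1)] i(1) T2L2[OF fk(2)] i(2)]
        by (subst L2_inner_diff_left[OF L tensor_L2[OF sf(3,4) i]]) simp
    qed
    then show ?thesis by simp
  qed
  have sums: "AE z in ?Y. T (tensor_sum xs) z = tensor_sum (map (\<lambda>(f, k). (T1 f, T2 k)) xs) z"
    if "set xs \<subseteq> L2 X1 \<times> L2 X2" for xs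
    using that
  proof (induction xs)
    case Nil
    show ?case using bounded_L2_operator_lincomb[OF T L2_zero L2_zero, of 0 0] by (simp add: tensor_sum_Nil)
  next
    case (Cons a xs)
    obtain f k where a: "a = (f, k)" and fk: "f \<in> L2 X1" "k \<in> L2 X2" using Cons(2) by (cases a) auto
    have xs: "tensor_sum xs \<in> L2 ?X" using Cons(2) by (intro tensor_sum_L2 sf) auto
    have IH: "AE z in ?Y. T (tensor_sum xs) z = tensor_sum (map (\<lambda>(f, k). (T1 f, T2 k)) xs) z" using Cons by auto
    have "AE z in ?Y. T (\<lambda>z. 1 * tensor f k z + 1 * tensor_sum xs z) z = 1 * T (tensor f k) z + 1 * T (tensor_sum xs) z"
      using tensor_L2[OF sf(1,2) fk] xs by (rule bounded_L2_operator_lincomb[OF T])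
    then show ?case
      using elem[OF fk] IH by eventually_elim (simp add: a tensor_sum_Cons)
  qed
  obtain C where C: "0 < C" "\<And>f. f \<in> L2 ?X \<Longrightarrow> L2_norm ?Y (T f) \<le> C * L2_norm ?X f"
    using T by (rule bounded_L2_operator_bound) blast
  obtain C1 where C1: "0 < C1" "\<And>f. f \<in> L2 X1 \<Longrightarrow> L2_norm Y1 (T1 f) \<le> C1 * L2_norm X1 f"
    using bT1 by (rule bounded_L2_operator_bound) blast
  obtain C2 where C2: "0 < C2" "\<And>f. f \<in> L2 X2 \<Longrightarrow> L2_norm Y2 (T2 f) \<le> C2 * L2_norm X2 f"
    using bT2 by (rule bounded_L2_operator_bound) blast
  fix \<delta> :: real assume \<delta>: "0 < \<delta>"
  \<comment> \<open>The two error terms cost \<open>\<epsilon> * C2\<close> and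
    \<open>(C1 + 1) * \<epsilon>\<close>, together at most \<open>\<delta>\<close>. The projected
    first factor has norm at most \<open>C1 + \<epsilon>\<close>, and the cap at 1 makes this at
    most \<open>C1 + 1\<close>.\<close>
  define \<epsilon> where "\<epsilon> = min 1 (\<delta> / (C1 + C2 + 1))"
  have \<epsilon>: "0 < \<epsilon>" "\<epsilon> \<le> 1" "\<epsilon> * (C1 + C2 + 1) \<le> \<delta>"
  proof -
    show "0 < \<epsilon>" "\<epsilon> \<le> 1" using \<delta> C1 C2 by (auto simp: \<epsilon>_def)
    have "\<epsilon> \<le> \<delta> / (C1 + C2 + 1)" by (simp add: \<epsilon>_def)
    then show "\<epsilon> * (C1 + C2 + 1) \<le> \<delta>" using C1(1) C2(1) by (simp add: pos_le_divide_eq)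
  qed
  obtain E1 where E1: "L2_orthonormal Y1 E1"
    "\<And>f. f \<in> L2 X1 \<Longrightarrow> L2_norm Y1 (\<lambda>y. T1 f y - L2_proj Y1 E1 (T1 f) y) \<le> \<epsilon> * L2_norm X1 f"
    using compact_L2_operator_finite_rank_approx[OF T1 \<epsilon>(1)] by blast
  obtain E2 where E2: "L2_orthonormal Y2 E2"
    "\<And>f. f \<in> L2 X2 \<Longrightarrow> L2_norm Y2 (\<lambda>y. T2 f y - L2_proj Y2 E2 (T2 f) y) \<le> \<epsilon> * L2_norm X2 f"
    using compact_L2_operator_finite_rank_approx[OF T2 \<epsilon>(1)] by blast
  define E where "E = case_prod tensor ` (E1 \<times> E2)"
  have E: "L2_orthonormal ?Y E" unfolding E_def by (rule L2_orthonormal_tensor[OF sf(3,4) E1(1) E2(1)])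
  then have EL2: "finite E" "E \<subseteq> L2 ?Y" by (auto simp: L2_orthonormal_def)
  define A1 where "A1 f = (\<lambda>y. T1 f y - L2_proj Y1 E1 (T1 f) y)" for f
  define A2 where "A2 f = (\<lambda>y. T2 f y - L2_proj Y2 E2 (T2 f) y)" for f
  define P1 where "P1 f = L2_proj Y1 E1 (T1 f)" for f
  have bA1: "bounded_L2_operator X1 Y1 A1" and bP1: "bounded_L2_operator X1 Y1 P1"
    unfolding A1_def P1_def by (rule bounded_L2_operator_proj[OF bT1 E1(1)])+
  have bA2: "bounded_L2_operator X2 Y2 A2"
    unfolding A2_def by (rule bounded_L2_operator_proj[OF bT2 E2(1)])
  have P1: "L2_norm Y1 (P1 f) \<le> (C1 + 1) * L2_norm X1 f" if f: "f \<in> L2 X1" for f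
  proof -
    have "L2_norm Y1 (P1 f) \<le> L2_norm Y1 (\<lambda>y. P1 f y - T1 f y) + L2_norm Y1 (T1 f)"
      using f bounded_L2_operator_L2[OF bP1] T1L2 by (intro L2_norm_le_diff_add) auto
    also have "L2_norm Y1 (\<lambda>y. P1 f y - T1 f y) = L2_norm Y1 (A1 f)"
      unfolding A1_def P1_def by (rule L2_norm_minus_commute)
    also have "L2_norm Y1 (A1 f) \<le> \<epsilon> * L2_norm X1 f" unfolding A1_def using f by (rule E1)
    also have "\<epsilon> * L2_norm X1 f \<le> 1 * L2_norm X1 f" using \<epsilon> by (intro mult_right_mono) auto
    finally show ?thesis using C1(2)[OF f] by (simp add: distrib_right)
  qed
  have span: "L2_norm ?Y (\<lambda>z. T (tensor_sum xs) z - L2_proj ?Y E (T (tensor_sum xs)) z) \<le> \<delta> * L2_norm ?X (tensor_sum xs)"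
    if xs: "set xs \<subseteq> L2 X1 \<times> L2 X2" for xs
  proof -
    let ?h = "tensor_sum xs"
    have h: "?h \<in> L2 ?X" using xs by (rule tensor_sum_L2[OF sf(1,2)])
    define ys where "ys = map (\<lambda>(f, k). (T1 f, T2 k)) xs"
    have ysL: "set ys \<subseteq> L2 Y1 \<times> L2 Y2" using xs T1L2 T2L2 by (auto simp: ys_def)
    have y: "tensor_sum ys \<in> L2 ?Y" using ysL by (rule tensor_sum_L2[OF sf(3,4)])
    have ae: "AE z in ?Y. T ?h z = tensor_sum ys z" unfolding ys_def by (rule sums[OF xs])
    define us where "us = map (\<lambda>(f, k). (A1 f, T2 k)) xs"
    define vs where "vs = map (\<lambda>(f, k). (P1 f, A2 k)) xs"
    have us: "set us \<subseteq> L2 Y1 \<times> L2 Y2" and vs: "set vs \<subseteq> L2 Y1 \<times> L2 Y2"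
      using xs T2L2 bounded_L2_operator_L2[OF bA1] bounded_L2_operator_L2[OF bA2] bounded_L2_operator_L2[OF bP1]
      by (auto simp: us_def vs_def)
    have split: "tensor_sum ys z - L2_proj ?Y E (tensor_sum ys) z = tensor_sum us z + tensor_sum vs z" for z
    proof -
      have "tensor_sum ys z - tensor_sum (map (\<lambda>(f, k). (L2_proj Y1 E1 f, L2_proj Y2 E2 k)) ys) z
          = tensor_sum us z + tensor_sum vs z"
        unfolding ys_def us_def vs_def
        by (induction xs) (auto simp: tensor_sum_Nil tensor_sum_Cons tensor_def A1_def A2_def P1_def split_beta algebra_simps)
      then show ?thesis unfolding E_def L2_proj_tensor_sum[OF sf(3,4) E1(1) E2(1) ysL] .
    qed
    \<comment> \<open>The norm bounds treat one factor at a time, so each error term passes through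
      the mixed space over \<open>X1\<close> and \<open>Y2\<close>.\<close>
    have mid: "set (map (\<lambda>(f, k). (f, T2 k)) xs) \<subseteq> L2 X1 \<times> L2 Y2" "set (map (\<lambda>(f, k). (f, A2 k)) xs) \<subseteq> L2 X1 \<times> L2 Y2"
      using xs T2L2 bounded_L2_operator_L2[OF bA2] by auto
    have "us = map (\<lambda>(f, k). (A1 f, k)) (map (\<lambda>(f, k). (f, T2 k)) xs)" by (auto simp: us_def)
    then have "L2_norm ?Y (tensor_sum us) \<le> \<epsilon> * L2_norm (X1 \<Otimes>\<^sub>M Y2) (tensor_sum (map (\<lambda>(f, k). (f, T2 k)) xs))"
      using tensor_sum_map_fst_bound[OF sf(1,3,4) bA1 E1(2)[folded A1_def] _ mid(1)] \<epsilon> by simp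
    also have "\<dots> \<le> \<epsilon> * (C2 * L2_norm ?X ?h)"
      using C2 \<epsilon> by (intro mult_left_mono tensor_sum_map_snd_bound[OF sf(1,2,4) bT2 C2(2) _ xs]) auto
    finally have nu: "L2_norm ?Y (tensor_sum us) \<le> \<epsilon> * C2 * L2_norm ?X ?h" by simp
    have "vs = map (\<lambda>(f, k). (P1 f, k)) (map (\<lambda>(f, k). (f, A2 k)) xs)" by (auto simp: vs_def)
    then have "L2_norm ?Y (tensor_sum vs) \<le> (C1 + 1) * L2_norm (X1 \<Otimes>\<^sub>M Y2) (tensor_sum (map (\<lambda>(f, k). (f, A2 k)) xs))"
      using tensor_sum_map_fst_bound[OF sf(1,3,4) bP1 P1 _ mid(2)] C1 by simp
    also have "\<dots> \<le> (C1 + 1) * (\<epsilon> * L2_norm ?X ?h)"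
      using C1 \<epsilon> by (intro mult_left_mono tensor_sum_map_snd_bound[OF sf(1,2,4) bA2 E2(2)[folded A2_def] _ xs]) auto
    finally have nv: "L2_norm ?Y (tensor_sum vs) \<le> (C1 + 1) * \<epsilon> * L2_norm ?X ?h" by simp
    have "L2_norm ?Y (\<lambda>z. T ?h z - L2_proj ?Y E (T ?h) z) = L2_norm ?Y (\<lambda>z. tensor_sum us z + tensor_sum vs z)"
    proof (rule L2_norm_cong_AE)
      show "AE z in ?Y. T ?h z - L2_proj ?Y E (T ?h) z = tensor_sum us z + tensor_sum vs z"
        unfolding L2_proj_cong_AE[OF EL2(2) TL2[OF h] y ae] using ae by eventually_elim (simp add: split)
      show "(\<lambda>z. T ?h z - L2_proj ?Y E (T ?h) z) \<in> borel_measurable ?Y"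
        by (rule L2_measurable[OF L2_diff[OF TL2[OF h] L2_proj_L2[OF EL2(2)]]])
      show "(\<lambda>z. tensor_sum us z + tensor_sum vs z) \<in> borel_measurable ?Y"
        by (rule L2_measurable[OF L2_add[OF tensor_sum_L2[OF sf(3,4) us] tensor_sum_L2[OF sf(3,4) vs]]])
    qed
    also have "\<dots> \<le> L2_norm ?Y (tensor_sum us) + L2_norm ?Y (tensor_sum vs)"
      by (rule L2_norm_triangle[OF tensor_sum_L2[OF sf(3,4) us] tensor_sum_L2[OF sf(3,4) vs]])
    also have "\<dots> \<le> \<epsilon> * (C1 + C2 + 1) * L2_norm ?X ?h"
      using nu nv by (simp add: algebra_simps)
    also have "\<dots> \<le> \<delta> * L2_norm ?X ?h" by (intro mult_right_mono \<epsilon>) simp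
    finally show ?thesis .
  qed
  have "L2_norm ?Y (\<lambda>z. T h z - L2_proj ?Y E (T h) z) \<le> \<delta> * L2_norm ?X h" if h: "h \<in> L2 ?X" for h
  proof -
    obtain xs where xs: "\<And>n::nat. set (xs n) \<subseteq> L2 X1 \<times> L2 X2"
      and lim: "(\<lambda>n. L2_norm ?X (\<lambda>z. tensor_sum (xs n) z - h z)) \<longlonglongrightarrow> 0"
      using tensor_sums_dense[OF sf(1,2) h] by blast
    \<comment> \<open>The residual map \<open>B\<close> is bounded by \<open>C\<close> on the whole
      space. Replacing \<open>h\<close> by an approximant at distance \<open>d n\<close> costs
      \<open>C * d n\<close>, and the norm of the approximant exceeds that of \<open>h\<close> by at
      most \<open>d n\<close>; both errors vanish in the limit.\<close>
    define B where "B f = (\<lambda>z. T f z - L2_proj ?Y E (T f) z)" for f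
    have bB: "bounded_L2_operator ?X ?Y B" unfolding B_def by (rule bounded_L2_operator_proj[OF T E])
    have BC: "L2_norm ?Y (B f) \<le> C * L2_norm ?X f" if "f \<in> L2 ?X" for f
      unfolding B_def using L2_norm_minus_proj_le[OF E TL2[OF that]] C(2)[OF that] by linarith
    define d where "d n = L2_norm ?X (\<lambda>z. tensor_sum (xs n) z - h z)" for n
    have "L2_norm ?Y (B h) \<le> C * d n + \<delta> * (d n + L2_norm ?X h)" for n
    proof -
      let ?g = "tensor_sum (xs n)"
      have g: "?g \<in> L2 ?X" using xs by (intro tensor_sum_L2 sf)
      have "L2_norm ?Y (B h) \<le> L2_norm ?Y (\<lambda>z. B h z - B ?g z) + L2_norm ?Y (B ?g)"
        using bounded_L2_operator_L2[OF bB h] bounded_L2_operator_L2[OF bB g] by (rule L2_norm_le_diff_add)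
      also have "L2_norm ?Y (\<lambda>z. B h z - B ?g z) = L2_norm ?Y (B (\<lambda>x. h x - ?g x))"
        by (rule bounded_L2_operator_diff_norm[OF bB h g])
      also have "L2_norm ?Y (B (\<lambda>x. h x - ?g x)) \<le> C * L2_norm ?X (\<lambda>x. h x - ?g x)"
        by (rule BC[OF L2_diff[OF h g]])
      also have "L2_norm ?X (\<lambda>x. h x - ?g x) = d n" unfolding d_def by (rule L2_norm_minus_commute)
      also have "L2_norm ?Y (B ?g) \<le> \<delta> * L2_norm ?X ?g" unfolding B_def by (rule span[OF xs])
      also have "\<delta> * L2_norm ?X ?g \<le> \<delta> * (d n + L2_norm ?X h)"
        unfolding d_def using \<delta> by (intro mult_left_mono L2_norm_le_diff_add g h) simp
      finally show ?thesis by simp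
    qed
    moreover have "(\<lambda>n. C * d n + \<delta> * (d n + L2_norm ?X h)) \<longlonglongrightarrow> C * 0 + \<delta> * (0 + L2_norm ?X h)"
      using lim unfolding d_def[symmetric] by (intro tendsto_intros)
    ultimately show ?thesis
      unfolding B_def[symmetric] using LIMSEQ_le_const[of _ _ "L2_norm ?Y (B h)"] by force
  qed
  then show "\<exists>E. finite E \<and> E \<subseteq> L2 ?Y \<and> (\<forall>f\<in>L2 ?X. L2_norm ?Y (\<lambda>y. T f y - L2_proj ?Y E (T f) y) \<le> \<delta> * L2_norm ?X f)"
    using EL2 by blast
qed

section \<open>Products of Arveson measures\<close>

text \<open>Every point has a compact neighbourhood, which has finite measure, and inside it lies a
  small ball about a point of a countable dense set. The balls of radius \<open>1 / Suc n\<close>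
  about that set which have finite measure thus form a countable cover.\<close>

lemma standard_measure_sigma_finite:
  assumes "standard_measure M"
  shows "sigma_finite_measure M"
proof -
  obtain T where T: "completely_metrizable_space T" "separable_space T" "locally_compact_space T" "radon_measure T M"
    using assms by (auto simp: standard_measure_def)
  have sp: "space M = topspace T" and sM: "sets M = sigma_sets (topspace T) {U. openin T U}"
    and fin: "\<And>K. compactin T K \<Longrightarrow> emeasure M K < \<infinity>"
    using T(4) by (auto simp: radon_measure_def)
  have op: "U \<in> sets M" if "openin T U" for U using that unfolding sM by (intro sigma_sets.Basic) simp
  obtain S d where Sd: "Metric_space S d" "T = Metric_space.mtopology S d"
    using T(1) unfolding completely_metrizable_space_def by blast
  interpret Metric_space S d by fact
  have top: "topspace T = S" by (simp add: Sd(2))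
  obtain C where C: "countable C" "C \<subseteq> topspace T" "T closure_of C = topspace T"
    using T(2) by (auto simp: separable_space_def)
  define A where "A = {U \<in> (\<lambda>(c, n). mball c (1 / real (Suc n))) ` (C \<times> UNIV). emeasure M U < \<infinity>}"
  have "\<exists>U\<in>A. x \<in> U" if x: "x \<in> S" for x
  proof -
    obtain U K where U: "openin T U" "compactin T K" "x \<in> U" "U \<subseteq> K"
      using T(3) x top unfolding locally_compact_space_def by blast
    obtain r where r: "0 < r" "mball x r \<subseteq> U"
      using U(1,3) unfolding Sd(2) openin_mtopology by blast
    \<comment> \<open>The centre \<open>c\<close> will lie within \<open>1 / Suc n\<close> of
      \<open>x\<close>, so points of its ball are within twice that radius of \<open>x\<close>,
      which is less than \<open>r\<close>.\<close>
    obtain n where n: "1 / real (Suc n) < r / 2" using nat_approx_posE[of "r / 2"] r(1) by auto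
    have "C \<inter> mball x (1 / real (Suc n)) \<noteq> {}"
    proof -
      have "x \<in> T closure_of C" using C(3) top x by simp
      moreover have "openin T (mball x (1 / real (Suc n)))" unfolding Sd(2) by (rule openin_mball)
      moreover have "x \<in> mball x (1 / real (Suc n))" using x by simp
      ultimately show ?thesis unfolding in_closure_of by blast
    qed
    then obtain c where c: "c \<in> C" "c \<in> mball x (1 / real (Suc n))" by blast
    have sub: "mball c (1 / real (Suc n)) \<subseteq> mball x r"
    proof
      fix y assume y: "y \<in> mball c (1 / real (Suc n))"
      have "d x y \<le> d x c + d c y" using c y by (intro triangle) auto
      then show "y \<in> mball x r" using c y n x by auto
    qed
    \<comment> \<open>Monotonicity of the measure requires a measurable \<open>K\<close>; compact
      sets are closed because the topology is Hausdorff.\<close>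
    have Ks: "K \<in> sets M"
    proof -
      have "closedin T K"
        using compactin_imp_closedin[OF metrizable_imp_Hausdorff_space[OF
            completely_metrizable_imp_metrizable_space[OF T(1)]] U(2)] .
      then have o: "openin T (topspace T - K)" and K: "K \<subseteq> topspace T" by (auto simp: closedin_def)
      have "space M - (topspace T - K) \<in> sets M" using op[OF o] by (rule sets.compl_sets)
      moreover have "space M - (topspace T - K) = K" using K unfolding sp by blast
      ultimately show ?thesis by simp
    qed
    have "emeasure M (mball c (1 / real (Suc n))) \<le> emeasure M K"
      using sub r(2) U(4) Ks by (intro emeasure_mono) auto
    also have "\<dots> < \<infinity>" using U(2) by (rule fin)
    finally have "mball c (1 / real (Suc n)) \<in> A" using c(1) unfolding A_def by auto
    moreover have "x \<in> mball c (1 / real (Suc n))" using c(2) x by (auto simp: commute)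
    ultimately show ?thesis by blast
  qed
  then have "space M \<subseteq> \<Union>A" unfolding sp top by blast
  moreover have "countable A"
  proof (rule countable_subset)
    show "countable ((\<lambda>(c, n). mball c (1 / real (Suc n))) ` (C \<times> (UNIV :: nat set)))"
      using C(1) by (intro countable_image countable_SIGMA) simp_all
  qed (simp add: A_def)
  moreover have As: "A \<subseteq> sets M"
    unfolding A_def using openin_mball op by (auto simp: Sd(2))
  moreover have "\<Union>A \<subseteq> space M" using As sets.sets_into_space by blast
  moreover have "\<forall>a\<in>A. emeasure M a \<noteq> \<infinity>" by (auto simp: A_def)
  ultimately show ?thesis
    by (intro sigma_finite_measure.intro exI[of _ A]) auto
qed

section \<open>Null sets and domination in product spaces\<close>

lemma AE_pair_measure_fst:
  assumes "sigma_finite_measure N" "AE x in M. P x" shows "AE z in M \<Otimes>\<^sub>M N. P (fst z)"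
proof -
  interpret N: sigma_finite_measure N by fact
  obtain Z where Z: "Z \<in> null_sets M" "{x \<in> space M. \<not> P x} \<subseteq> Z"
    using assms(2) by (auto simp: eventually_ae_filter)
  show ?thesis
  proof (rule AE_I')
    show "Z \<times> space N \<in> null_sets (M \<Otimes>\<^sub>M N)" using Z(1) by (rule N.times_in_null_sets1) simp
  qed (use Z(2) in \<open>auto simp: space_pair_measure\<close>)
qed

lemma AE_pair_measure_snd:
  assumes "sigma_finite_measure N" "AE y in N. P y" shows "AE z in M \<Otimes>\<^sub>M N. P (snd z)"
proof -
  interpret N: sigma_finite_measure N by fact
  obtain Z where Z: "Z \<in> null_sets N" "{y \<in> space N. \<not> P y} \<subseteq> Z"
    using assms(2) by (auto simp: eventually_ae_filter)
  show ?thesis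
  proof (rule AE_I')
    show "space M \<times> Z \<in> null_sets (M \<Otimes>\<^sub>M N)" using Z(1) by (intro N.times_in_null_sets2) simp
  qed (use Z(2) in \<open>auto simp: space_pair_measure\<close>)
qed

text \<open>Product measures integrate the measures of slices: the bound \<open>d\<close> is applied
  inside to each slice, the bound \<open>c\<close> to the outer integral.\<close>

lemma pair_measure_dominated:
  assumes sf: "sigma_finite_measure N" "sigma_finite_measure N'"
    and s: "sets M' = sets M" "sets N' = sets N" and cd: "0 \<le> c" "0 \<le> d"
    and M: "\<And>A. A \<in> sets M \<Longrightarrow> emeasure M' A \<le> ennreal c * emeasure M A"
    and N: "\<And>B. B \<in> sets N \<Longrightarrow> emeasure N' B \<le> ennreal d * emeasure N B"
    and E: "E \<in> sets (M \<Otimes>\<^sub>M N)"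
  shows "emeasure (M' \<Otimes>\<^sub>M N') E \<le> ennreal (c * d) * emeasure (M \<Otimes>\<^sub>M N) E"
proof -
  have E': "E \<in> sets (M' \<Otimes>\<^sub>M N')" using E s by (simp cong: sets_pair_measure_cong)
  interpret N: sigma_finite_measure N by fact
  have meas: "(\<lambda>x. emeasure N (Pair x -` E)) \<in> borel_measurable M"
    using E by (rule N.measurable_emeasure_Pair)
  have "emeasure (M' \<Otimes>\<^sub>M N') E = (\<integral>\<^sup>+x. emeasure N' (Pair x -` E) \<partial>M')"
    by (rule sigma_finite_measure.emeasure_pair_measure_alt[OF sf(2) E'])
  also have "\<dots> \<le> (\<integral>\<^sup>+x. ennreal d * emeasure N (Pair x -` E) \<partial>M')"
    using E by (intro nn_integral_mono N) (rule sets_Pair1)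
  also have "\<dots> \<le> ennreal c * (\<integral>\<^sup>+x. ennreal d * emeasure N (Pair x -` E) \<partial>M)"
  proof (rule nn_integral_distr_dominated[where r="\<lambda>x. x"])
    show "(\<lambda>x. x) \<in> measurable M' M" by (rule measurable_ident_sets[OF s(1)])
    fix A assume A: "A \<in> sets M"
    then have "(\<lambda>x. x) -` A \<inter> space M' = A" using sets.sets_into_space[of A M'] s(1) by auto
    then show "emeasure M' ((\<lambda>x. x) -` A \<inter> space M') \<le> ennreal c * emeasure M A" using M[OF A] by simp
  qed (use meas in simp)
  also have "\<dots> = ennreal c * (ennreal d * (\<integral>\<^sup>+x. emeasure N (Pair x -` E) \<partial>M))"
    using meas by (simp add: nn_integral_cmult)
  also have "\<dots> = ennreal (c * d) * emeasure (M \<Otimes>\<^sub>M N) E"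
    using cd by (simp add: N.emeasure_pair_measure_alt[OF E] ennreal_mult mult.assoc)
  finally show ?thesis .
qed

text \<open>The image of a product measure under a product map is the product of the images. With
  both maps \<open>fst\<close> or both \<open>snd\<close>, it bounds a marginal of the permuted
  product by the product of the marginals.\<close>

lemma emeasure_pair_vimage_dominated:
  assumes fin: "finite_measure V1" "finite_measure V2" and sf: "sigma_finite_measure M2"
    and p: "p1 \<in> measurable V1 M1" "p2 \<in> measurable V2 M2" and c: "0 \<le> c1" "0 \<le> c2"
    and dom1: "\<And>A. A \<in> sets M1 \<Longrightarrow> emeasure V1 (p1 -` A \<inter> space V1) \<le> ennreal c1 * emeasure M1 A"
    and dom2: "\<And>A. A \<in> sets M2 \<Longrightarrow> emeasure V2 (p2 -` A \<inter> space V2) \<le> ennreal c2 * emeasure M2 A"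
    and C: "C \<in> sets (M1 \<Otimes>\<^sub>M M2)"
  shows "emeasure (V1 \<Otimes>\<^sub>M V2) ((\<lambda>(z1, z2). (p1 z1, p2 z2)) -` C \<inter> space (V1 \<Otimes>\<^sub>M V2))
    \<le> ennreal (c1 * c2) * emeasure (M1 \<Otimes>\<^sub>M M2) C"
proof -
  have sfd: "sigma_finite_measure (distr V2 M2 p2)"
    using fin(2) p(2) by (intro finite_measure.axioms(1) finite_measure.finite_measure_distr)
  have "emeasure (V1 \<Otimes>\<^sub>M V2) ((\<lambda>(z1, z2). (p1 z1, p2 z2)) -` C \<inter> space (V1 \<Otimes>\<^sub>M V2))
      = emeasure (distr V1 M1 p1 \<Otimes>\<^sub>M distr V2 M2 p2) C"
    unfolding pair_measure_distr[OF p sfd] using C p by (subst emeasure_distr) auto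
  also have "\<dots> \<le> ennreal (c1 * c2) * emeasure (M1 \<Otimes>\<^sub>M M2) C"
    using dom1 dom2 p by (intro pair_measure_dominated[OF sf sfd _ _ c _ _ C]) (auto simp: emeasure_distr)
  finally show ?thesis .
qed

lemma arveson_pairing_integrable:
  assumes \<sigma>: "\<sigma> \<in> arveson_measures N M" and f: "f \<in> L2 M" and g: "g \<in> L2 N"
  defines "V \<equiv> variation (N \<Otimes>\<^sub>M M) \<sigma>"
  shows "integrable V (\<lambda>z. f (snd z) * cnj (g (fst z)))"
    and "integrable V (\<lambda>z. f (snd z) * cnj (g (fst z)) * polar_density (N \<Otimes>\<^sub>M M) \<sigma> z)"
proof -
  let ?h = "polar_density (N \<Otimes>\<^sub>M M) \<sigma>"
  have cm: "complex_measure (N \<Otimes>\<^sub>M M) \<sigma>" "emeasure (variation (N \<Otimes>\<^sub>M M) \<sigma>) (space (N \<Otimes>\<^sub>M M)) < \<infinity>"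
    using \<sigma> by (auto elim: arveson_measuresE)
  have L: "(\<lambda>z. f (snd z)) \<in> L2 V" "(\<lambda>z. g (fst z)) \<in> L2 V"
    using arveson_L2[OF \<sigma>] f g unfolding V_def by blast+
  then show "integrable V (\<lambda>z. f (snd z) * cnj (g (fst z)))" by (rule L2_mult_integrable)
  have "integrable V (\<lambda>z. (f (snd z) * ?h z) * cnj (g (fst z)))"
    using L2_mult_unit_bounded(1)[OF L(1) borel_measurable_integrable[OF polar_density_integrable[OF cm, folded V_def]]
        polar_density_bound[OF cm, folded V_def]] L(2) by (rule L2_mult_integrable)
  then show "integrable V (\<lambda>z. f (snd z) * cnj (g (fst z)) * ?h z)" by (simp only: mult_ac)
qed

lemma rho_eq_projections: "rho = (\<lambda>z. ((fst (fst z), fst (snd z)), (snd (fst z), snd (snd z))))"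
  by (auto simp: rho_def fun_eq_iff)

text \<open>The witness for the product is the image of \<open>\<sigma>1 \<times> \<sigma>2\<close> under the coordinate permutation \<open>rho\<close>,
  written through the polar densities.\<close>

theorem arveson_measure_product:
  assumes sf: "sigma_finite_measure X1" "sigma_finite_measure Y1" "sigma_finite_measure X2" "sigma_finite_measure Y2"
    and \<sigma>1: "\<sigma>1 \<in> arveson_measures_on Y1 X1 (\<kappa>1\<inverse>)" and \<sigma>2: "\<sigma>2 \<in> arveson_measures_on Y2 X2 (\<kappa>2\<inverse>)"
  obtains \<sigma> where "\<sigma> \<in> arveson_measures_on (Y1 \<Otimes>\<^sub>M Y2) (X1 \<Otimes>\<^sub>M X2) ((rho ` (\<kappa>1 \<times> \<kappa>2))\<inverse>)"
    "\<And>E1 E2. E1 \<in> sets (Y1 \<Otimes>\<^sub>M X1) \<Longrightarrow> E2 \<in> sets (Y2 \<Otimes>\<^sub>M X2) \<Longrightarrow>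
      \<exists>E\<in>sets ((Y1 \<Otimes>\<^sub>M Y2) \<Otimes>\<^sub>M (X1 \<Otimes>\<^sub>M X2)). \<sigma> E = \<sigma>1 E1 * \<sigma>2 E2"
    "\<And>f1 f2 g1 g2. f1 \<in> L2 X1 \<Longrightarrow> f2 \<in> L2 X2 \<Longrightarrow> g1 \<in> L2 Y1 \<Longrightarrow> g2 \<in> L2 Y2 \<Longrightarrow>
      cm_integral ((Y1 \<Otimes>\<^sub>M Y2) \<Otimes>\<^sub>M (X1 \<Otimes>\<^sub>M X2)) \<sigma> (\<lambda>(y, x). tensor f1 f2 x * cnj (tensor g1 g2 y))
      = cm_integral (Y1 \<Otimes>\<^sub>M X1) \<sigma>1 (\<lambda>(y, x). f1 x * cnj (g1 y)) * cm_integral (Y2 \<Otimes>\<^sub>M X2) \<sigma>2 (\<lambda>(y, x). f2 x * cnj (g2 y))"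
proof -
  let ?P1 = "Y1 \<Otimes>\<^sub>M X1" and ?P2 = "Y2 \<Otimes>\<^sub>M X2" and ?Y = "Y1 \<Otimes>\<^sub>M Y2" and ?X = "X1 \<Otimes>\<^sub>M X2"
  let ?Q = "?Y \<Otimes>\<^sub>M ?X"
  define V1 where "V1 = variation ?P1 \<sigma>1"
  define V2 where "V2 = variation ?P2 \<sigma>2"
  define h1 where "h1 = polar_density ?P1 \<sigma>1"
  define h2 where "h2 = polar_density ?P2 \<sigma>2"
  have a1: "\<sigma>1 \<in> arveson_measures Y1 X1" and a2: "\<sigma>2 \<in> arveson_measures Y2 X2"
    using \<sigma>1 \<sigma>2 by (auto simp: arveson_measures_on_def)
  from a1 obtain c1 where c1: "0 < c1" "complex_measure ?P1 \<sigma>1" "emeasure V1 (space ?P1) < \<infinity>"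
    "\<And>A. A \<in> sets Y1 \<Longrightarrow> emeasure V1 (A \<times> space X1) \<le> ennreal c1 * emeasure Y1 A"
    "\<And>B. B \<in> sets X1 \<Longrightarrow> emeasure V1 (space Y1 \<times> B) \<le> ennreal c1 * emeasure X1 B"
    by (rule arveson_measuresE[of \<sigma>1 Y1 X1, folded V1_def]) (rule that)
  from a2 obtain c2 where c2: "0 < c2" "complex_measure ?P2 \<sigma>2" "emeasure V2 (space ?P2) < \<infinity>"
    "\<And>A. A \<in> sets Y2 \<Longrightarrow> emeasure V2 (A \<times> space X2) \<le> ennreal c2 * emeasure Y2 A"
    "\<And>B. B \<in> sets X2 \<Longrightarrow> emeasure V2 (space Y2 \<times> B) \<le> ennreal c2 * emeasure X2 B"
    by (rule arveson_measuresE[of \<sigma>2 Y2 X2, folded V2_def]) (rule that)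
  have sV1 [measurable_cong]: "sets V1 = sets ?P1" and sV2 [measurable_cong]: "sets V2 = sets ?P2"
    by (auto simp: V1_def V2_def)
  have spV: "space V1 = space Y1 \<times> space X1" "space V2 = space Y2 \<times> space X2"
    by (auto simp: V1_def V2_def space_pair_measure)
  have fm1: "finite_measure V1" and h1: "integrable V1 h1" "AE z in V1. norm (h1 z) \<le> 1"
    "\<And>E. E \<in> sets ?P1 \<Longrightarrow> \<sigma>1 E = (LINT z:E|V1. h1 z)"
    unfolding V1_def h1_def using finite_measure_variation polar_density_integrable polar_density_bound polar_density_eq
      c1(2) c1(3)[unfolded V1_def] by blast+
  have fm2: "finite_measure V2" and h2: "integrable V2 h2" "AE z in V2. norm (h2 z) \<le> 1"
    "\<And>E. E \<in> sets ?P2 \<Longrightarrow> \<sigma>2 E = (LINT z:E|V2. h2 z)"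
    unfolding V2_def h2_def using finite_measure_variation polar_density_integrable polar_density_bound polar_density_eq
      c2(2) c2(3)[unfolded V2_def] by blast+
  have [measurable]: "h1 \<in> borel_measurable ?P1" "h2 \<in> borel_measurable ?P2"
    using borel_measurable_integrable[OF h1(1)] borel_measurable_integrable[OF h2(1)]
    by (simp_all add: V1_def V2_def)
  have sfV: "sigma_finite_measure V1" "sigma_finite_measure V2"
    using fm1 fm2 by (auto intro: finite_measure.axioms(1))
  define VV where "VV = V1 \<Otimes>\<^sub>M V2"
  have fmVV: "finite_measure VV" unfolding VV_def by (rule finite_measure_pair_measure[OF fm2 fm1])
  have sVV [measurable_cong]: "sets VV = sets (?P1 \<Otimes>\<^sub>M ?P2)"
    unfolding VV_def by (rule sets_pair_measure_cong[OF sV1 sV2])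
  have spVV: "space VV = (space Y1 \<times> space X1) \<times> (space Y2 \<times> space X2)"
    by (simp add: VV_def space_pair_measure spV)
  have spQ: "space ?Q = (space Y1 \<times> space Y2) \<times> (space X1 \<times> space X2)"
    by (simp add: space_pair_measure)
  \<comment> \<open>Arveson measures live on \<open>Y \<times> X\<close>, so \<open>rho\<close> is
    used here with the roles of the two spaces interchanged: it sends
    \<open>((y1, x1), (y2, x2))\<close> to \<open>((y1, y2), (x1, x2))\<close>.\<close>
  have rho: "rho \<in> measurable VV ?Q"
    unfolding rho_eq_projections by measurable
  define W where "W = distr VV ?Q rho"
  have fmW: "finite_measure W" unfolding W_def using fmVV rho by (rule finite_measure.finite_measure_distr)
  have sW: "sets W = sets ?Q" by (simp add: W_def)
  \<comment> \<open>Composed with \<open>rho\<close> this is \<open>h1 z1 * h2 z2\<close>. It is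
    bounded by 1 almost everywhere, so the variation of \<open>\<sigma>\<close> is dominated by
    \<open>W\<close> with constant 1.\<close>
  define k where "k = (\<lambda>z. h1 (fst (fst z), fst (snd z)) * h2 (snd (fst z), snd (snd z)))"
  have k[measurable]: "k \<in> borel_measurable ?Q" unfolding k_def by measurable
  have k_rho: "k (rho (z1, z2)) = h1 z1 * h2 z2" for z1 z2
    by (simp add: k_def rho_def split_beta)
  have kW: "k \<in> borel_measurable W" using k by (simp add: W_def)
  have "AE z in VV. norm (h1 (fst z)) \<le> 1" "AE z in VV. norm (h2 (snd z)) \<le> 1"
    unfolding VV_def using AE_pair_measure_fst[OF sfV(2) h1(2)] AE_pair_measure_snd[OF sfV(2) h2(2)] .
  then have "AE z in VV. norm (k (rho z)) \<le> 1"
  proof eventually_elim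
    case (elim z)
    then show ?case using k_rho[of "fst z" "snd z"] by (simp add: norm_mult mult_le_one)
  qed
  then have kb: "AE z in W. norm (k z) \<le> 1"
    unfolding W_def using rho k by (subst AE_distr_iff) auto
  define \<sigma> where "\<sigma> = (\<lambda>E. LINT z:E|W. k z)"
  note dens = complex_measure_from_density[OF fmW sW kW kb, folded \<sigma>_def]
  have emW: "emeasure W E = emeasure VV (rho -` E \<inter> space VV)" if "E \<in> sets ?Q" for E
    unfolding W_def using rho that by (simp add: emeasure_distr)
  have WY: "emeasure W (C \<times> space ?X) \<le> ennreal (c1 * c2) * emeasure ?Y C" if C: "C \<in> sets ?Y" for C
  proof -
    have "emeasure W (C \<times> space ?X) = emeasure VV (rho -` (C \<times> space ?X) \<inter> space VV)"
      using C by (intro emW) auto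
    also have "rho -` (C \<times> space ?X) \<inter> space VV = (\<lambda>(z1, z2). (fst z1, fst z2)) -` C \<inter> space VV"
      by (auto simp: rho_def spVV space_pair_measure)
    also have "emeasure VV \<dots> \<le> ennreal (c1 * c2) * emeasure ?Y C"
      unfolding VV_def
    proof (rule emeasure_pair_vimage_dominated[OF fm1 fm2 sf(4)])
      show "emeasure V1 (fst -` A \<inter> space V1) \<le> ennreal c1 * emeasure Y1 A" if "A \<in> sets Y1" for A
        using c1(4)[OF that] fst_vimage_pair_measure[OF that, of X1] by (simp add: V1_def)
      show "emeasure V2 (fst -` A \<inter> space V2) \<le> ennreal c2 * emeasure Y2 A" if "A \<in> sets Y2" for A
        using c2(4)[OF that] fst_vimage_pair_measure[OF that, of X2] by (simp add: V2_def)
    qed (use c1(1) c2(1) C in auto)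
    finally show ?thesis .
  qed
  have WX: "emeasure W (space ?Y \<times> C) \<le> ennreal (c1 * c2) * emeasure ?X C" if C: "C \<in> sets ?X" for C
  proof -
    have "emeasure W (space ?Y \<times> C) = emeasure VV (rho -` (space ?Y \<times> C) \<inter> space VV)"
      using C by (intro emW) auto
    also have "rho -` (space ?Y \<times> C) \<inter> space VV = (\<lambda>(z1, z2). (snd z1, snd z2)) -` C \<inter> space VV"
      by (auto simp: rho_def spVV space_pair_measure)
    also have "emeasure VV \<dots> \<le> ennreal (c1 * c2) * emeasure ?X C"
      unfolding VV_def
    proof (rule emeasure_pair_vimage_dominated[OF fm1 fm2 sf(3)])
      show "emeasure V1 (snd -` A \<inter> space V1) \<le> ennreal c1 * emeasure X1 A" if "A \<in> sets X1" for A
        using c1(5)[OF that] snd_vimage_pair_measure[OF that, of Y1] by (simp add: V1_def)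
      show "emeasure V2 (snd -` A \<inter> space V2) \<le> ennreal c2 * emeasure X2 A" if "A \<in> sets X2" for A
        using c2(5)[OF that] snd_vimage_pair_measure[OF that, of Y2] by (simp add: V2_def)
    qed (use c1(1) c2(1) C in auto)
    finally show ?thesis .
  qed
  have V_le: "emeasure (variation ?Q \<sigma>) E \<le> emeasure W E" if "E \<in> sets ?Q" for E
    using dens(2)[OF that] by simp
  have arv: "\<sigma> \<in> arveson_measures ?Y ?X"
  proof (rule arveson_measuresI[OF dens(1), of "c1 * c2"])
    have "emeasure (variation ?Q \<sigma>) (space ?Y \<times> space ?X) \<le> emeasure W (space ?Y \<times> space ?X)"
      by (rule V_le) auto
    also have "\<dots> < \<infinity>" using finite_measure.emeasure_finite[OF fmW] by (simp add: less_top)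
    finally show "emeasure (variation ?Q \<sigma>) (space ?Y \<times> space ?X) < \<infinity>" .
    show "emeasure (variation ?Q \<sigma>) (A \<times> space ?X) \<le> ennreal (c1 * c2) * emeasure ?Y A" if "A \<in> sets ?Y" for A
      by (rule order_trans[OF V_le WY]) (use that in auto)
    show "emeasure (variation ?Q \<sigma>) (space ?Y \<times> B) \<le> ennreal (c1 * c2) * emeasure ?X B" if "B \<in> sets ?X" for B
      by (rule order_trans[OF V_le WX]) (use that in auto)
  qed (use c1 c2 in simp)
  have null: "space ?Y \<times> space ?X - (rho ` (\<kappa>1 \<times> \<kappa>2))\<inverse> \<in> null_sets (completion (variation ?Q \<sigma>))"
  proof -
    have "space Y1 \<times> space X1 - \<kappa>1\<inverse> \<in> null_sets (completion V1)" "space Y2 \<times> space X2 - \<kappa>2\<inverse> \<in> null_sets (completion V2)"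
      using \<sigma>1 \<sigma>2 by (auto simp: arveson_measures_on_def V1_def V2_def)
    then obtain Z1 Z2 where Z: "Z1 \<in> null_sets V1" "space Y1 \<times> space X1 - \<kappa>1\<inverse> \<subseteq> Z1"
        "Z2 \<in> null_sets V2" "space Y2 \<times> space X2 - \<kappa>2\<inverse> \<subseteq> Z2"
      unfolding null_sets_completion_iff2 by blast
    \<comment> \<open>A point misses the product set as soon as one of its two coordinate pairs
      misses its factor. \<open>Z\<close> collects the points with a pair in one of the measurable
      null sets \<open>Z1\<close>, \<open>Z2\<close> covering these failures.\<close>
    define Z where "Z = {z \<in> space ?Q. ((fst (fst z), fst (snd z)) \<in> Z1) \<or> ((snd (fst z), snd (snd z)) \<in> Z2)}"
    have [measurable]: "Z1 \<in> sets ?P1" "Z2 \<in> sets ?P2" using Z by (auto simp: null_sets_def sV1 sV2)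
    have ZQ: "Z \<in> sets ?Q" unfolding Z_def by measurable
    have "rho -` Z \<inter> space VV \<subseteq> Z1 \<times> space V2 \<union> space V1 \<times> Z2"
      by (auto simp: rho_def Z_def spVV spV)
    moreover have "Z1 \<times> space V2 \<union> space V1 \<times> Z2 \<in> null_sets VV"
      unfolding VV_def using Z
      by (intro null_sets.Un sigma_finite_measure.times_in_null_sets1[OF sfV(2)] sigma_finite_measure.times_in_null_sets2[OF sfV(2)]) auto
    ultimately have "emeasure VV (rho -` Z \<inter> space VV) = 0"
      by (meson emeasure_mono null_setsD1 null_setsD2 le_zero_eq order.trans order_refl emeasure_eq_0)
    then have "emeasure (variation ?Q \<sigma>) Z = 0" using V_le[OF ZQ] emW[OF ZQ] by simp
    then have Zn: "Z \<in> null_sets (completion (variation ?Q \<sigma>))"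
      using ZQ by (intro null_sets_completionI) (auto simp: null_sets_def)
    show ?thesis
    proof (rule null_sets_completion_subset[OF _ Zn], rule subsetI)
      fix z assume z: "z \<in> space ?Y \<times> space ?X - (rho ` (\<kappa>1 \<times> \<kappa>2))\<inverse>"
      obtain y1 y2 x1 x2 where zz: "z = ((y1, y2), (x1, x2))" by (metis surj_pair)
      have sp: "y1 \<in> space Y1" "y2 \<in> space Y2" "x1 \<in> space X1" "x2 \<in> space X2"
        using z zz by (auto simp: space_pair_measure)
      have "\<not> ((x1, y1) \<in> \<kappa>1 \<and> (x2, y2) \<in> \<kappa>2)"
      proof
        assume "(x1, y1) \<in> \<kappa>1 \<and> (x2, y2) \<in> \<kappa>2"
        then have "rho ((x1, y1), (x2, y2)) \<in> rho ` (\<kappa>1 \<times> \<kappa>2)" by (intro imageI) auto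
        then show False using z by (simp add: zz rho_def)
      qed
      then have "(y1, x1) \<in> Z1 \<or> (y2, x2) \<in> Z2" using Z(2,4) sp by auto
      then show "z \<in> Z" using sp by (simp add: Z_def zz spQ)
    qed
  qed
  have prod: "(LINT z|VV. (case z of (z1, z2) \<Rightarrow> a z1 * b z2)) = (LINT z|V1. a z) * (LINT z|V2. b z)"
    and prodi: "integrable VV (\<lambda>(z1, z2). a z1 * b z2)"
    if "integrable V1 a" "integrable V2 b" for a b :: "_ \<Rightarrow> complex"
    unfolding VV_def by (rule integrable_tensor[OF sfV that])+
  show ?thesis
  proof (rule that[of \<sigma>])
    show "\<sigma> \<in> arveson_measures_on ?Y ?X ((rho ` (\<kappa>1 \<times> \<kappa>2))\<inverse>)"
      using arv null by (simp add: arveson_measures_on_def)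
  next
    fix E1 E2 assume [measurable]: "E1 \<in> sets ?P1" "E2 \<in> sets ?P2"
    \<comment> \<open>Up to the permutation \<open>rho\<close> this is
      \<open>E1 \<times> E2\<close>, on which the density and the indicator both factor.\<close>
    define E where "E = {z \<in> space ?Q. ((fst (fst z), fst (snd z)) \<in> E1) \<and> ((snd (fst z), snd (snd z)) \<in> E2)}"
    have E: "E \<in> sets ?Q" unfolding E_def by measurable
    have i: "integrable V1 (\<lambda>z. indicator E1 z *\<^sub>R h1 z)" "integrable V2 (\<lambda>z. indicator E2 z *\<^sub>R h2 z)"
      by (intro integrable_mult_indicator h1 h2; simp add: sV1 sV2)+
    have "\<sigma> E = (LINT z|VV. indicator E (rho z) *\<^sub>R k (rho z))"
      unfolding \<sigma>_def set_lebesgue_integral_def W_def using rho E k by (subst integral_distr) auto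
    also have "\<dots> = (LINT z|VV. (case z of (z1, z2) \<Rightarrow> (indicator E1 z1 *\<^sub>R h1 z1) * (indicator E2 z2 *\<^sub>R h2 z2)))"
    proof (rule Bochner_Integration.integral_cong[OF refl])
      fix z assume z: "z \<in> space VV"
      obtain y1 x1 y2 x2 where zz: "z = ((y1, x1), (y2, x2))" by (metis surj_pair)
      show "indicator E (rho z) *\<^sub>R k (rho z) = (case z of (z1, z2) \<Rightarrow> (indicator E1 z1 *\<^sub>R h1 z1) * (indicator E2 z2 *\<^sub>R h2 z2))"
        using z by (auto simp: zz rho_def k_def E_def spVV spQ split: split_indicator)
    qed
    also have "\<dots> = \<sigma>1 E1 * \<sigma>2 E2"
      by (subst prod[OF i]) (simp add: h1(3) h2(3) set_lebesgue_integral_def)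
    finally show "\<exists>E\<in>sets ?Q. \<sigma> E = \<sigma>1 E1 * \<sigma>2 E2" using E by blast
  next
    fix f1 f2 g1 g2 :: "_ \<Rightarrow> complex"
    assume f: "f1 \<in> L2 X1" "f2 \<in> L2 X2" and g: "g1 \<in> L2 Y1" "g2 \<in> L2 Y2"
    note [measurable] = f[THEN L2_measurable] g[THEN L2_measurable]
    define u where "u = (\<lambda>(y, x). tensor f1 f2 x * cnj (tensor g1 g2 y))"
    have u[measurable]: "u \<in> borel_measurable ?Q" unfolding u_def tensor_def by measurable
    define u1 where "u1 z = f1 (snd z) * cnj (g1 (fst z))" for z
    define u2 where "u2 z = f2 (snd z) * cnj (g2 (fst z))" for z
    have u_rho: "u (rho (z1, z2)) = u1 z1 * u2 z2" for z1 z2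
      by (simp add: u_def u1_def u2_def rho_def tensor_def split_beta)
    note i1 = arveson_pairing_integrable[OF a1 f(1) g(1), folded V1_def h1_def, folded u1_def]
    note i2 = arveson_pairing_integrable[OF a2 f(2) g(2), folded V2_def h2_def, folded u2_def]
    have "integrable W u"
      unfolding W_def
    proof (subst integrable_distr_eq[OF rho u])
      show "integrable VV (\<lambda>z. u (rho z))"
        using prodi[OF i1(1) i2(1)] by (rule Bochner_Integration.integrable_cong[OF refl, THEN iffD1, rotated])
          (auto simp: u_rho)
    qed
    then have "cm_integral ?Q \<sigma> u = (LINT z|W. u z * k z)"
      using u by (intro dens(3)) (auto simp: W_def)
    also have "\<dots> = (LINT z|VV. u (rho z) * k (rho z))"
      unfolding W_def using rho by (subst integral_distr) auto
    also have "\<dots> = (LINT z|VV. (case z of (z1, z2) \<Rightarrow> (u1 z1 * h1 z1) * (u2 z2 * h2 z2)))"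
      by (intro Bochner_Integration.integral_cong) (auto simp: u_rho k_rho)
    also have "\<dots> = (LINT z|V1. u1 z * h1 z) * (LINT z|V2. u2 z * h2 z)"
      using prod[OF i1(2) i2(2)] by (simp only: u1_def u2_def)
    also have "\<dots> = cm_integral ?P1 \<sigma>1 (\<lambda>(y, x). f1 x * cnj (g1 y)) * cm_integral ?P2 \<sigma>2 (\<lambda>(y, x). f2 x * cnj (g2 y))"
      by (simp add: cm_integral_def V1_def V2_def h1_def h2_def u1_def u2_def split_beta)
    finally show "cm_integral ?Q \<sigma> (\<lambda>(y, x). tensor f1 f2 x * cnj (tensor g1 g2 y)) =
      cm_integral ?P1 \<sigma>1 (\<lambda>(y, x). f1 x * cnj (g1 y)) * cm_integral ?P2 \<sigma>2 (\<lambda>(y, x). f2 x * cnj (g2 y))"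
      unfolding u_def .
  qed
qed

section \<open>Products of omega-closed sets\<close>

lemma null_sets_times_left:
  "sigma_finite_measure N \<Longrightarrow> A \<in> null_sets M \<Longrightarrow> A \<times> space N \<in> null_sets (M \<Otimes>\<^sub>M N)"
  by (rule sigma_finite_measure.times_in_null_sets1) auto

lemma null_sets_times_right:
  "sigma_finite_measure N \<Longrightarrow> B \<in> null_sets N \<Longrightarrow> space M \<times> B \<in> null_sets (M \<Otimes>\<^sub>M N)"
  by (rule sigma_finite_measure.times_in_null_sets2) auto

text \<open>The complement of the product set is the union of the cylinders over the two
  complements. Cylinders over rectangles are again rectangles after permutation, and cylinders over
  null sets are null by sigma-finiteness, so the exceptional strips remain marginally null.\<close>

lemma omega_closed_rho:
  fixes X1 :: "'a measure" and Y1 :: "'b measure" and X2 :: "'c measure" and Y2 :: "'d measure"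
  assumes sf: "sigma_finite_measure X2" "sigma_finite_measure Y2"
    and \<kappa>: "omega_closed X1 Y1 \<kappa>1" "omega_closed X2 Y2 \<kappa>2"
  shows "omega_closed (X1 \<Otimes>\<^sub>M X2) (Y1 \<Otimes>\<^sub>M Y2) (rho ` (\<kappa>1 \<times> \<kappa>2))"
proof -
  let ?X = "X1 \<Otimes>\<^sub>M X2" and ?Y = "Y1 \<Otimes>\<^sub>M Y2"
  let ?D1 = "space X1 \<times> space Y1 - \<kappa>1" and ?D2 = "space X2 \<times> space Y2 - \<kappa>2"
  let ?D = "space ?X \<times> space ?Y - rho ` (\<kappa>1 \<times> \<kappa>2)"
  have \<kappa>s: "\<kappa>1 \<subseteq> space X1 \<times> space Y1" "\<kappa>2 \<subseteq> space X2 \<times> space Y2"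
    using \<kappa> by (auto simp: omega_closed_def)
  obtain A1 B1 where 1: "\<And>i::nat. A1 i \<in> sets X1" "\<And>i. B1 i \<in> sets Y1"
      "marginally_equivalent X1 Y1 ?D1 (\<Union>i. A1 i \<times> B1 i)"
    using \<kappa>(1) unfolding omega_closed_def omega_open_def by blast
  obtain A2 B2 where 2: "\<And>i::nat. A2 i \<in> sets X2" "\<And>i. B2 i \<in> sets Y2"
      "marginally_equivalent X2 Y2 ?D2 (\<Union>i. A2 i \<times> B2 i)"
    using \<kappa>(2) unfolding omega_closed_def omega_open_def by blast
  obtain Z1 W1 where Z1: "Z1 \<in> null_sets X1" "W1 \<in> null_sets Y1"
      "(?D1 - (\<Union>i. A1 i \<times> B1 i)) \<union> ((\<Union>i. A1 i \<times> B1 i) - ?D1) \<subseteq> Z1 \<times> space Y1 \<union> space X1 \<times> W1"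
    using 1(3) unfolding marginally_equivalent_def marginally_null_def by blast
  obtain Z2 W2 where Z2: "Z2 \<in> null_sets X2" "W2 \<in> null_sets Y2"
      "(?D2 - (\<Union>i. A2 i \<times> B2 i)) \<union> ((\<Union>i. A2 i \<times> B2 i) - ?D2) \<subseteq> Z2 \<times> space Y2 \<union> space X2 \<times> W2"
    using 2(3) unfolding marginally_equivalent_def marginally_null_def by blast
  define Z where "Z = Z1 \<times> space X2 \<union> space X1 \<times> Z2"
  define W where "W = W1 \<times> space Y2 \<union> space Y1 \<times> W2"
  have Z: "Z \<in> null_sets ?X" and W: "W \<in> null_sets ?Y"
    unfolding Z_def W_def using Z1 Z2 sf
    by (auto intro!: null_sets.Un null_sets_times_left null_sets_times_right)
  \<comment> \<open>Even indices enumerate the cylinders from the first factor and odd ones those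
    from the second, merging two sequences of rectangles into one.\<close>
  define A where "A n = (if even n then A1 (n div 2) \<times> space X2 else space X1 \<times> A2 (n div 2))" for n
  define B where "B n = (if even n then B1 (n div 2) \<times> space Y2 else space Y1 \<times> B2 (n div 2))" for n
  have AB: "A n \<in> sets ?X" "B n \<in> sets ?Y" for n using 1 2 by (auto simp: A_def B_def)
  have S1: "A1 i \<subseteq> space X1" "B1 i \<subseteq> space Y1" "A2 i \<subseteq> space X2" "B2 i \<subseteq> space Y2" for i
    using 1(1,2)[of i, THEN sets.sets_into_space] 2(1,2)[of i, THEN sets.sets_into_space] by auto
  have memU: "((x1, x2), (y1, y2)) \<in> (\<Union>n. A n \<times> B n) \<longleftrightarrow>
      ((x1, y1) \<in> (\<Union>i. A1 i \<times> B1 i) \<and> x2 \<in> space X2 \<and> y2 \<in> space Y2) \<or>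
      ((x2, y2) \<in> (\<Union>i. A2 i \<times> B2 i) \<and> x1 \<in> space X1 \<and> y1 \<in> space Y1)" (is "?L \<longleftrightarrow> ?R") for x1 x2 y1 y2
  proof
    assume ?L
    then obtain n where "(x1, x2) \<in> A n" "(y1, y2) \<in> B n" by blast
    then show ?R by (cases "even n") (auto simp: A_def B_def)
  next
    assume ?R
    then show ?L
    proof (elim disjE conjE)
      assume *: "(x1, y1) \<in> (\<Union>i. A1 i \<times> B1 i)" "x2 \<in> space X2" "y2 \<in> space Y2"
      then obtain i where "x1 \<in> A1 i" "y1 \<in> B1 i" by blast
      then have "((x1, x2), (y1, y2)) \<in> A (2 * i) \<times> B (2 * i)" using * by (simp add: A_def B_def)
      then show ?L by blast
    next
      assume *: "(x2, y2) \<in> (\<Union>i. A2 i \<times> B2 i)" "x1 \<in> space X1" "y1 \<in> space Y1"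
      then obtain i where "x2 \<in> A2 i" "y2 \<in> B2 i" by blast
      then have "((x1, x2), (y1, y2)) \<in> A (2 * i + 1) \<times> B (2 * i + 1)" using * by (simp add: A_def B_def)
      then show ?L by blast
    qed
  qed
  have memD: "((x1, x2), (y1, y2)) \<in> ?D \<longleftrightarrow>
      ((x1, y1) \<in> ?D1 \<and> x2 \<in> space X2 \<and> y2 \<in> space Y2) \<or>
      ((x2, y2) \<in> ?D2 \<and> x1 \<in> space X1 \<and> y1 \<in> space Y1)" for x1 x2 y1 y2
  proof -
    have "((x1, x2), (y1, y2)) \<in> rho ` (\<kappa>1 \<times> \<kappa>2) \<longleftrightarrow> (x1, y1) \<in> \<kappa>1 \<and> (x2, y2) \<in> \<kappa>2"
      unfolding rho_def by force
    then show ?thesis by (auto simp: space_pair_measure)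
  qed
  have "(?D - (\<Union>n. A n \<times> B n)) \<union> ((\<Union>n. A n \<times> B n) - ?D) \<subseteq> Z \<times> space ?Y \<union> space ?X \<times> W"
  proof
    fix z assume z: "z \<in> (?D - (\<Union>n. A n \<times> B n)) \<union> ((\<Union>n. A n \<times> B n) - ?D)"
    obtain x1 x2 y1 y2 where zz: "z = ((x1, x2), (y1, y2))" by (metis surj_pair)
    have AS: "A n \<subseteq> space ?X" "B n \<subseteq> space ?Y" for n using AB by (auto dest: sets.sets_into_space)
    have sp: "x1 \<in> space X1" "x2 \<in> space X2" "y1 \<in> space Y1" "y2 \<in> space Y2"
      using z AS unfolding zz by (auto simp: space_pair_measure)
    have "(x1, y1) \<in> (?D1 - (\<Union>i. A1 i \<times> B1 i)) \<union> ((\<Union>i. A1 i \<times> B1 i) - ?D1) \<or>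
          (x2, y2) \<in> (?D2 - (\<Union>i. A2 i \<times> B2 i)) \<union> ((\<Union>i. A2 i \<times> B2 i) - ?D2)"
    proof -
      \<comment> \<open>Pointwise form of the fact that the symmetric difference of two unions is
        contained in the union of the symmetric differences.\<close>
      have gen: "p \<in> (D1 - U1) \<union> (U1 - D1) \<or> q \<in> (D2 - U2) \<union> (U2 - D2)"
        if "a \<in> (D - U) \<union> (U - D)" "a \<in> D \<longleftrightarrow> p \<in> D1 \<or> q \<in> D2" "a \<in> U \<longleftrightarrow> p \<in> U1 \<or> q \<in> U2"
        for a :: "('a \<times> 'c) \<times> ('b \<times> 'd)" and p :: "'a \<times> 'b" and q :: "'c \<times> 'd" and D U D1 U1 D2 U2
        using that by blast
      show ?thesis
        by (rule gen[OF z]) (simp_all only: zz memD memU sp simp_thms)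
    qed
    then have "(x1, y1) \<in> Z1 \<times> space Y1 \<union> space X1 \<times> W1 \<or> (x2, y2) \<in> Z2 \<times> space Y2 \<union> space X2 \<times> W2"
      using Z1(3) Z2(3) by blast
    then show "z \<in> Z \<times> space ?Y \<union> space ?X \<times> W"
      using sp unfolding zz Z_def W_def by (auto simp: space_pair_measure)
  qed
  then have "marginally_equivalent ?X ?Y ?D (\<Union>n. A n \<times> B n)"
    unfolding marginally_equivalent_def marginally_null_def using Z W by blast
  then have "omega_open ?X ?Y ?D"
    unfolding omega_open_def using AB by blast
  moreover have "rho ` (\<kappa>1 \<times> \<kappa>2) \<subseteq> space ?X \<times> space ?Y"
    using \<kappa>s by (auto simp: rho_def space_pair_measure)
  ultimately show ?thesis by (simp add: omega_closed_def)
qed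

theorem theorem3p16:
  fixes X1 :: "'a measure" and Y1 :: "'b measure"
    and X2 :: "'c measure" and Y2 :: "'d measure"
    and \<kappa>1 :: "('a \<times> 'b) set" and \<kappa>2 :: "('c \<times> 'd) set"
  assumes "standard_measure X1" and "standard_measure Y1"
    and "standard_measure X2" and "standard_measure Y2"
    and "omega_closed X1 Y1 \<kappa>1" and "omega_closed X2 Y2 \<kappa>2"
  shows "operator_M0_set (X1 \<Otimes>\<^sub>M X2) (Y1 \<Otimes>\<^sub>M Y2) (rho ` (\<kappa>1 \<times> \<kappa>2)) \<longleftrightarrow>
         operator_M0_set X1 Y1 \<kappa>1 \<and> operator_M0_set X2 Y2 \<kappa>2"
proof -
  note sf = assms(1-4)[THEN standard_measure_sigma_finite]
  interpret X1: sigma_finite_measure X1 by (rule sf)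
  interpret Y1: sigma_finite_measure Y1 by (rule sf)
  interpret X2: sigma_finite_measure X2 by (rule sf)
  interpret Y2: sigma_finite_measure Y2 by (rule sf)
  let ?X = "X1 \<Otimes>\<^sub>M X2" and ?Y = "Y1 \<Otimes>\<^sub>M Y2" and ?\<kappa> = "rho ` (\<kappa>1 \<times> \<kappa>2)"
  show ?thesis
  proof
    assume "operator_M0_set ?X ?Y ?\<kappa>"
    then obtain \<sigma> E where \<sigma>: "\<sigma> \<in> arveson_measures_on ?Y ?X (?\<kappa>\<inverse>)"
      and E: "E \<in> sets (?Y \<Otimes>\<^sub>M ?X)" "\<sigma> E \<noteq> 0"
      and T: "compact_L2_operator ?X ?Y (arveson_operator ?X ?Y \<sigma>)"
      unfolding operator_M0_set_def by blast
    have cm: "complex_measure (?Y \<Otimes>\<^sub>M ?X) \<sigma>"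
      using \<sigma> by (auto simp: arveson_measures_on_def elim: arveson_measuresE)
    then obtain B1 B2 A1 A2 where box: "B1 \<in> sets Y1" "B2 \<in> sets Y2" "A1 \<in> sets X1" "A2 \<in> sets X2"
      and fin: "emeasure Y1 B1 < \<infinity>" "emeasure Y2 B2 < \<infinity>" "emeasure X1 A1 < \<infinity>" "emeasure X2 A2 < \<infinity>"
      and nz: "\<sigma> ((B1 \<times> B2) \<times> (A1 \<times> A2)) \<noteq> 0"
      using complex_measure_nonzero_finite_box[OF cm sf(2,4,1,3) E] by blast
    \<comment> \<open>One constant bounds the measures of all four sides of the box; including 1
      makes it positive even if a side is null.\<close>
    define K where "K = Max {1, measure Y1 B1, measure Y2 B2, measure X1 A1, measure X2 A2}"
    have "1 \<le> K" "measure Y1 B1 \<le> K" "measure Y2 B2 \<le> K" "measure X1 A1 \<le> K" "measure X2 A2 \<le> K"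
      unfolding K_def by (rule Max_ge; simp)+
    then have K: "0 < K" "emeasure Y1 B1 \<le> ennreal K" "emeasure Y2 B2 \<le> ennreal K"
        "emeasure X1 A1 \<le> ennreal K" "emeasure X2 A2 \<le> ennreal K"
      using fin by (auto simp: emeasure_eq_ennreal_measure less_top intro!: ennreal_leI)
    have sub: "A1 \<subseteq> space X1" "A2 \<subseteq> space X2" "B1 \<subseteq> space Y1" "B2 \<subseteq> space Y2"
      using box by (auto dest: sets.sets_into_space)
    \<comment> \<open>The strips leave the first coordinates free and cut the second ones to sets of
      measure at most \<open>K\<close>. Testing on \<open>B1 \<times> A1\<close> restores the
      missing sides, so the projected measure takes the nonzero value of \<open>\<sigma>\<close> on
      the box.\<close>
    have M1: "operator_M0_set X1 Y1 \<kappa>1"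
    proof (rule operator_M0_set_compress[where p=fst and q=fst and A="space X1 \<times> A2" and B="space Y1 \<times> B2"
          and E="B1 \<times> A1", OF _ _ _ _ K(1) _ _ assms(5) _ \<sigma> T])
      fix C assume C: "C \<in> sets X1"
      have "fst -` C \<inter> (space X1 \<times> A2) = C \<times> A2" using sets.sets_into_space[OF C] by auto
      then show "emeasure ?X (fst -` C \<inter> (space X1 \<times> A2)) \<le> ennreal K * emeasure X1 C"
        using C box K by (simp add: X2.emeasure_pair_measure_Times mult.commute[of "ennreal K"] mult_left_mono)
    next
      fix C assume C: "C \<in> sets Y1"
      have "fst -` C \<inter> (space Y1 \<times> B2) = C \<times> B2" using sets.sets_into_space[OF C] by auto
      then show "emeasure ?Y (fst -` C \<inter> (space Y1 \<times> B2)) \<le> ennreal K * emeasure Y1 C"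
        using C box K by (simp add: Y2.emeasure_pair_measure_Times mult.commute[of "ennreal K"] mult_left_mono)
    next
      have "(\<lambda>(y, x). (fst y, fst x)) -` (B1 \<times> A1) \<inter> (space Y1 \<times> B2) \<times> (space X1 \<times> A2) = (B1 \<times> B2) \<times> (A1 \<times> A2)"
        using sub by auto
      then show "\<sigma> ((\<lambda>(y, x). (fst y, fst x)) -` (B1 \<times> A1) \<inter> (space Y1 \<times> B2) \<times> (space X1 \<times> A2)) \<noteq> 0"
        using nz by simp
    qed (use box in \<open>auto simp: rho_def\<close>)
    have M2: "operator_M0_set X2 Y2 \<kappa>2"
    proof (rule operator_M0_set_compress[where p=snd and q=snd and A="A1 \<times> space X2" and B="B1 \<times> space Y2"
          and E="B2 \<times> A2", OF _ _ _ _ K(1) _ _ assms(6) _ \<sigma> T])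
      fix C assume C: "C \<in> sets X2"
      have "snd -` C \<inter> (A1 \<times> space X2) = A1 \<times> C" using sets.sets_into_space[OF C] by auto
      then show "emeasure ?X (snd -` C \<inter> (A1 \<times> space X2)) \<le> ennreal K * emeasure X2 C"
        using C box K by (simp add: X2.emeasure_pair_measure_Times mult_right_mono)
    next
      fix C assume C: "C \<in> sets Y2"
      have "snd -` C \<inter> (B1 \<times> space Y2) = B1 \<times> C" using sets.sets_into_space[OF C] by auto
      then show "emeasure ?Y (snd -` C \<inter> (B1 \<times> space Y2)) \<le> ennreal K * emeasure Y2 C"
        using C box K by (simp add: Y2.emeasure_pair_measure_Times mult_right_mono)
    next
      have "(\<lambda>(y, x). (snd y, snd x)) -` (B2 \<times> A2) \<inter> (B1 \<times> space Y2) \<times> (A1 \<times> space X2) = (B1 \<times> B2) \<times> (A1 \<times> A2)"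
        using sub by auto
      then show "\<sigma> ((\<lambda>(y, x). (snd y, snd x)) -` (B2 \<times> A2) \<inter> (B1 \<times> space Y2) \<times> (A1 \<times> space X2)) \<noteq> 0"
        using nz by simp
    qed (use box in \<open>auto simp: rho_def\<close>)
    show "operator_M0_set X1 Y1 \<kappa>1 \<and> operator_M0_set X2 Y2 \<kappa>2" using M1 M2 by simp
  next
    assume M: "operator_M0_set X1 Y1 \<kappa>1 \<and> operator_M0_set X2 Y2 \<kappa>2"
    obtain \<sigma>1 E1 where \<sigma>1: "\<sigma>1 \<in> arveson_measures_on Y1 X1 (\<kappa>1\<inverse>)" and E1: "E1 \<in> sets (Y1 \<Otimes>\<^sub>M X1)" "\<sigma>1 E1 \<noteq> 0"
      and T1: "compact_L2_operator X1 Y1 (arveson_operator X1 Y1 \<sigma>1)"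
      using M unfolding operator_M0_set_def by blast
    obtain \<sigma>2 E2 where \<sigma>2: "\<sigma>2 \<in> arveson_measures_on Y2 X2 (\<kappa>2\<inverse>)" and E2: "E2 \<in> sets (Y2 \<Otimes>\<^sub>M X2)" "\<sigma>2 E2 \<noteq> 0"
      and T2: "compact_L2_operator X2 Y2 (arveson_operator X2 Y2 \<sigma>2)"
      using M unfolding operator_M0_set_def by blast
    have a1: "\<sigma>1 \<in> arveson_measures Y1 X1" and a2: "\<sigma>2 \<in> arveson_measures Y2 X2"
      using \<sigma>1 \<sigma>2 by (auto simp: arveson_measures_on_def)
    obtain \<sigma> where \<sigma>: "\<sigma> \<in> arveson_measures_on ?Y ?X (?\<kappa>\<inverse>)"
      "\<And>E1 E2. E1 \<in> sets (Y1 \<Otimes>\<^sub>M X1) \<Longrightarrow> E2 \<in> sets (Y2 \<Otimes>\<^sub>M X2) \<Longrightarrow>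
        \<exists>E\<in>sets (?Y \<Otimes>\<^sub>M ?X). \<sigma> E = \<sigma>1 E1 * \<sigma>2 E2"
      "\<And>f1 f2 g1 g2. f1 \<in> L2 X1 \<Longrightarrow> f2 \<in> L2 X2 \<Longrightarrow> g1 \<in> L2 Y1 \<Longrightarrow> g2 \<in> L2 Y2 \<Longrightarrow>
        cm_integral (?Y \<Otimes>\<^sub>M ?X) \<sigma> (\<lambda>(y, x). tensor f1 f2 x * cnj (tensor g1 g2 y))
        = cm_integral (Y1 \<Otimes>\<^sub>M X1) \<sigma>1 (\<lambda>(y, x). f1 x * cnj (g1 y)) * cm_integral (Y2 \<Otimes>\<^sub>M X2) \<sigma>2 (\<lambda>(y, x). f2 x * cnj (g2 y))"
      by (rule arveson_measure_product[OF sf \<sigma>1 \<sigma>2]) (rule that)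
    have a: "\<sigma> \<in> arveson_measures ?Y ?X" using \<sigma>(1) by (simp add: arveson_measures_on_def)
    have "compact_L2_operator ?X ?Y (arveson_operator ?X ?Y \<sigma>)"
    proof (rule compact_L2_operator_tensor[OF sf(1,3,2,4) arveson_operator_bounded[OF a] T1 T2])
      fix f1 f2 g1 g2 :: "_ \<Rightarrow> complex"
      assume f: "f1 \<in> L2 X1" "f2 \<in> L2 X2" and g: "g1 \<in> L2 Y1" "g2 \<in> L2 Y2"
      show "L2_inner ?Y (arveson_operator ?X ?Y \<sigma> (tensor f1 f2)) (tensor g1 g2)
        = L2_inner Y1 (arveson_operator X1 Y1 \<sigma>1 f1) g1 * L2_inner Y2 (arveson_operator X2 Y2 \<sigma>2 f2) g2"
        using arveson_operator_inner[OF a tensor_L2[OF sf(1,3) f] tensor_L2[OF sf(2,4) g]]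
          arveson_operator_inner[OF a1 f(1) g(1)] arveson_operator_inner[OF a2 f(2) g(2)] \<sigma>(3)[OF f g]
        by simp
    qed
    \<comment> \<open>The value is the product of two nonzero complex numbers, so the product
      measure is not zero.\<close>
    moreover have "\<exists>E\<in>sets (?Y \<Otimes>\<^sub>M ?X). \<sigma> E \<noteq> 0"
      using \<sigma>(2)[OF E1(1) E2(1)] E1(2) E2(2) by force
    moreover have "omega_closed ?X ?Y ?\<kappa>"
      by (rule omega_closed_rho[OF sf(3,4) assms(5,6)])
    ultimately show "operator_M0_set ?X ?Y ?\<kappa>"
      unfolding operator_M0_set_def using \<sigma>(1) by blast
  qed
qed

end
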